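(* Let $A_1\in\mathcal K_1(\mathbb R^n)$ and $A_2,\ldots,A_n\in\mathcal K_2(\mathbb R^n)$. Then $$V_n(A_1,\ldots,A_n)=\frac1{\varkappa_n}\int_{\partial B_{2n}}h_{A_1}\,D_n\big(I_n,\mathrm{Hess}_{\mathbb R}h_{A_2},\ldots,\mathrm{Hess}_{\mathbb R}h_{A_n}\big)\,\upsilon_{\partial B_{2n}} .$$
   Context: $\mathcal K_\ell(\mathbb R^n)$ is the set of convex bodies (non-empty compact convex subsets) of $\mathbb R^n$ whose support function $h_A(x)=\max_{v\in A}(x,v)$ is of class $\mathcal C^\ell$ on $\mathbb R^n\setminus\{0\}$. $V_n$ is the Minkowski mixed volume in $\mathbb R^n$, normalized by $V_n(A,\ldots,A)=\mathrm{vol}_n(A)$. $B_{2n}$ is the closed unit ball of $\mathbb C^n=\mathbb R^n+i\mathbb R^n$ centred at the origin and $\upsilon_{\partial B_{2n}}$ the standard volume form on the $(2n-1)$-sphere $\partial B_{2n}$. The bodies $A_\ell\subset\mathbb R^n$ are regarded as subsets of $\mathbb C^n$, so at $u\in\partial B_{2n}$ one has $h_{A_\ell}(u)=h_{A_\ell}(\operatorname{Re}u)$, and $\mathrm{Hess}_{\mathbb R}h_{A_\ell}$ is the $n\times n$ real Hessian with respect to $x=\operatorname{Re}u$; the integrand is thus defined for almost every $u$ (those with $\operatorname{Re}u\neq0$). $\varkappa_n$ is the Lebesgue measure of the unit ball of $\mathbb R^n$, $I_n$ the identity matrix. For $n\times n$ matrices $M_\ell=(m^{(\ell)}_{j,k})$,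 the mixed discriminant is $D_n(M_1,\ldots,M_n)=\frac1{n!}\sum_{\sigma,\tau\in\mathfrak S_n}\operatorname{sgn}(\sigma\tau)\prod_{\ell=1}^n m^{(\ell)}_{\sigma(\ell),\tau(\ell)}$. *)

theory Defs
  imports "HOL-Analysis.Analysis"
begin

text \<open>For compact nonempty \<open>A\<close> the supremum is attained, i.e. it is the maximum.\<close>

definition support_fun :: "'a::euclidean_space set \<Rightarrow> 'a \<Rightarrow> real" where
  "support_fun A x = (SUP v\<in>A. x \<bullet> v)"

definition partial :: "'n::finite \<Rightarrow> (real^'n \<Rightarrow> real) \<Rightarrow> real^'n \<Rightarrow> real" where
  "partial i f x = deriv (\<lambda>t. f (x + t *\<^sub>R axis i 1)) 0"

definition hessian :: "(real^'n::finite \<Rightarrow> real) \<Rightarrow> real^'n \<Rightarrow> real^'n^'n" where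
  "hessian f x = (\<chi> j k. partial j (partial k f) x)"

text \<open>Class \<open>C\<^sup>k\<close>; meant for open \<open>S\<close>, where differentiability within \<open>S\<close> is differentiability.\<close>

fun Ck_on :: "nat \<Rightarrow> (real^'n::finite \<Rightarrow> real) \<Rightarrow> (real^'n) set \<Rightarrow> bool" where
  "Ck_on 0 f S \<longleftrightarrow> continuous_on S f"
| "Ck_on (Suc k) f S \<longleftrightarrow> f differentiable_on S \<and> (\<forall>i. Ck_on k (partial i f) S)"

definition convex_bodies_C :: "nat \<Rightarrow> (real^'n::finite) set set" where
  "convex_bodies_C k = {A. A \<noteq> {} \<and> compact A \<and> convex A \<and> Ck_on k (support_fun A) (- {0})}"

definition minkowski_comb :: "('n::finite \<Rightarrow> real) \<Rightarrow> ('n \<Rightarrow> (real^'n) set) \<Rightarrow> (real^'n) set" where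
  "minkowski_comb t A = {\<Sum>l\<in>UNIV. t l *\<^sub>R x l | x. \<forall>l. x l \<in> A l}"

text \<open>Here and below an \<open>n\<close>-tuple is a family indexed by \<open>'n\<close>, with \<open>n = CARD('n)\<close>.
  By Minkowski's theorem the volume of \<open>\<Sum>\<^sub>l t\<^sub>l A\<^sub>l\<close>, for \<open>t \<ge> 0\<close>, is a homogeneous polynomial
  of degree \<open>n\<close> in \<open>t\<close>, with coefficients \<open>c \<alpha>\<close>, \<open>\<alpha>\<close> ranging over the multi-indices of
  length \<open>n\<close>. The mixed volume is \<open>1/n!\<close> times the coefficient of \<open>\<Prod>\<^sub>l t\<^sub>l\<close>. The factor gives
  \<open>V(A,\<dots>,A) = vol A\<close>, since \<open>vol (\<Sum>\<^sub>l t\<^sub>l A) = (\<Sum>\<^sub>l t\<^sub>l)\<^sup>n vol A\<close>.\<close>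

definition mixed_volume :: "('n::finite \<Rightarrow> (real^'n) set) \<Rightarrow> real" where
  "mixed_volume A = (THE v. \<exists>c :: ('n \<Rightarrow> nat) \<Rightarrow> real.
     (\<forall>t. (\<forall>l. 0 \<le> t l) \<longrightarrow>
        measure lborel (minkowski_comb t A) =
          (\<Sum>\<alpha> | (\<Sum>l\<in>UNIV. \<alpha> l) = CARD('n). c \<alpha> * (\<Prod>l\<in>UNIV. t l ^ \<alpha> l))) \<and>
     v = c (\<lambda>_. 1) / fact (CARD('n)))"

definition mixed_discriminant :: "('n::finite \<Rightarrow> real^'n^'n) \<Rightarrow> real" where
  "mixed_discriminant M = 1 / fact (CARD('n)) *
     (\<Sum>\<sigma> | \<sigma> permutes UNIV. \<Sum>\<tau> | \<tau> permutes UNIV.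
        of_int (sign (\<sigma> \<circ> \<tau>)) * (\<Prod>l\<in>UNIV. M l $ \<sigma> l $ \<tau> l))"

text \<open>The measure of the standard volume form \<open>\<upsilon>\<close> on the unit sphere of a Euclidean space of
  dimension \<open>m\<close>. In polar coordinates Lebesgue measure is \<open>r\<^sup>m\<^sup>-\<^sup>1 dr \<and> \<upsilon>\<close>, so that \<open>\<upsilon>(E)\<close> is \<open>m\<close>
  times the Lebesgue measure of the cone \<open>{r u | 0 < r \<le> 1, u \<in> E}\<close>, the preimage of \<open>E\<close> under
  the radial projection \<^term>\<open>sgn\<close> of the punctured ball; see \<open>emeasure_sphere_measure\<close>.\<close>

definition sphere_measure :: "'a::euclidean_space measure" where
  "sphere_measure = scale_measure (ennreal (real DIM('a)))
     (distr (restrict_space lborel (cball 0 1 - {0})) (restrict_space borel (sphere 0 1)) sgn)"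

lemma emeasure_sphere_measure:
  fixes E :: "'a::euclidean_space set"
  assumes "E \<in> sets borel" "E \<subseteq> sphere 0 1"
  shows "emeasure sphere_measure E =
    ennreal (real DIM('a)) * emeasure lborel {r *\<^sub>R u | r u. 0 < r \<and> r \<le> 1 \<and> u \<in> E}"
proof -
  let ?P = "cball (0::'a) 1 - {0}"
  let ?N = "restrict_space lborel ?P"
  have P: "?P \<in> sets lborel" by simp
  have m: "sgn \<in> measurable ?N (restrict_space borel (sphere 0 1))"
  proof (rule measurable_restrict_space2)
    show "sgn \<in> space ?N \<rightarrow> sphere (0::'a) 1"
      by (auto simp: space_restrict_space norm_sgn)
    have "continuous_on ?P (sgn :: 'a \<Rightarrow> 'a)"
      unfolding sgn_div_norm[abs_def] by (intro continuous_intros) auto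
    then have "(sgn :: 'a \<Rightarrow> 'a) \<in> borel_measurable (restrict_space borel ?P)"
      by (rule borel_measurable_continuous_on_restrict)
    then show "(sgn :: 'a \<Rightarrow> 'a) \<in> borel_measurable ?N"
      by (simp cong: measurable_cong_sets add: sets_restrict_space)
  qed
  have E: "E \<in> sets (restrict_space borel (sphere 0 1))"
    using assms by (auto simp: sets_restrict_space_iff)
  have "sgn -` E \<inter> space ?N = {r *\<^sub>R u | r u. 0 < r \<and> r \<le> 1 \<and> u \<in> E}" (is "?L = ?R")
  proof (intro set_eqI iffI)
    fix x assume "x \<in> ?L"
    then have "x = norm x *\<^sub>R sgn x" "0 < norm x" "norm x \<le> 1" "sgn x \<in> E"
      by (auto simp: space_restrict_space sgn_div_norm)
    then show "x \<in> ?R" by blast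
  next
    fix x assume "x \<in> ?R"
    then obtain r u where "x = r *\<^sub>R u" "0 < r" "r \<le> 1" "u \<in> E" by blast
    moreover from this have "norm u = 1" using assms by auto
    ultimately show "x \<in> ?L"
      by (auto simp: space_restrict_space sgn_div_norm)
  qed
  moreover have "emeasure ?N ?L = emeasure lborel ?L"
    by (rule emeasure_restrict_space) (auto simp: space_restrict_space)
  ultimately show ?thesis
    by (simp add: sphere_measure_def emeasure_distr[OF m E])
qed

definition Re_vec :: "complex^'n::finite \<Rightarrow> real^'n" where
  "Re_vec u = (\<chi> i. Re (u $ i))"

end

theory Submission
  imports Defs
begin

text \<open>Let \<open>h\<close> be the support function of a body \<open>K\<close> with the origin in its interior and with positive
  curvature. The map \<open>x \<mapsto> \<bar>x\<bar> \<nabla>h(x)\<close> sends the unit ball bijectively onto \<open>K\<close> and depends linearly on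
  \<open>h\<close>; hence the volume of \<open>\<Sum>\<^sub>l t\<^sub>l A\<^sub>l\<close> is the integral of a determinant that is a form in \<open>t\<close>. At a
  unit vector \<open>u\<close> this determinant is \<open>n h(u) D\<^sub>n(I, Hess h, \<dots>, Hess h)\<close>, because \<open>Hess h\<close> annihilates
  \<open>u\<close> on both sides.

  To isolate one body, compare \<open>K + s A\<^sub>l\<close> with the image of \<open>{x. \<bar>x\<bar> \<le> 1 + s h\<^sub>l(x) / h(x)}\<close>, which contains it.
  This bounds the derivative of the volume in the direction of \<open>A\<^sub>l\<close> by the integral of
  \<open>n h\<^sub>l D\<^sub>n(I, Hess h, \<dots>, Hess h)\<close> over the sphere of \<open>\<real>\<^sup>n\<close>. Summed over \<open>l\<close> with weights \<open>t\<^sub>l\<close>, both sides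
  are \<open>n\<close> times the volume, so every one of the bounds is an equality, and the coefficient of
  \<open>\<Prod>\<^sub>l t\<^sub>l\<close> gives the formula on the sphere of \<open>\<real>\<^sup>n\<close>. Positive curvature and the smoothness of \<open>A\<^sub>1\<close> are
  removed by approximation. Finally, the integrand is homogeneous of degree \<open>2 - n\<close>, and for such
  functions integrals over the spheres of \<open>\<real>\<^sup>n\<close> and \<open>\<complex>\<^sup>n\<close> differ by the factor \<open>\<kappa>\<^sub>n\<close>.\<close>

section \<open>Forms, mixed discriminants and polarization\<close>

text \<open>The determinant alone makes the volume a form in \<open>t\<close>, but in its
  coefficient of the product of all \<open>t l\<close> every body in turn supplies the factor
  \<open>h\<close>. That these contributions have equal integrals is the symmetry of the mixed
  volume. Classically it comes from integration by parts on the sphere, which differentiates the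
  Hessians once more and so asks for more than class C^2. The one-sided volume comparison stays
  within two derivatives, and Euler's identity for forms leaves no room for strict inequality.

  The factor |x| in |x| grad h(x) makes the Jacobian constant along rays, so volumes of images of
  star-shaped regions become sphere integrals; h > 0 makes the rays r grad h(u) sweep out the whole
  space.

  \<open>mixed_volume\<close> is a definite description over polynomial expansions of the volume, so
  such an expansion has to be established for the given bodies, the nonsmooth one included. The
  wanted coefficient is a signed sum of values at indicator vectors, so it passes to limits together
  with the volumes. In that limit the slot of the nonsmooth body holds the identity matrix, so
  uncontrolled second derivatives of its approximants never appear.\<close>

text \<open>A form of degree \<open>n\<close> in \<open>t\<close>, with one coefficient for each map from the \<open>n\<close> factors of a monomial
  to the variables; different \<open>c\<close> may define the same form.\<close>

definition mform :: "(('n::finite \<Rightarrow> 'l::finite) \<Rightarrow> real) \<Rightarrow> ('l \<Rightarrow> real) \<Rightarrow> real" where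
  "mform c t = (\<Sum>f\<in>UNIV. c f * (\<Prod>i\<in>UNIV. t (f i)))"

text \<open>Multilinearity in the rows: \<open>f i\<close> names the matrix that supplies row
  \<open>i\<close>.\<close>

lemma det_sum_scaleR:
  fixes M :: "'n::finite \<Rightarrow> real^'n^'n"
  shows "det (\<Sum>l\<in>UNIV. t l *\<^sub>R M l) = mform (\<lambda>f. det (\<chi> i. M (f i) $ i)) t"
proof -
  have "(\<Sum>l\<in>UNIV. t l *\<^sub>R M l) = (\<chi> i. \<Sum>l\<in>UNIV. t l *s (M l $ i))"
    by (simp add: vec_eq_iff)
  then have "det (\<Sum>l\<in>UNIV. t l *\<^sub>R M l) =
      (\<Sum>f | \<forall>i. f i \<in> UNIV. det (\<chi> i. t (f i) *s (M (f i) $ i)))"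
    using det_linear_rows_sum[of "UNIV :: 'n set" "\<lambda>i l. t l *s (M l $ i)"] by simp
  also have "\<dots> = (\<Sum>f\<in>UNIV. det (\<chi> i. M (f i) $ i) * (\<Prod>i\<in>UNIV. t (f i)))"
    by (simp add: det_rows_mul mult.commute)
  finally show ?thesis by (simp add: mform_def)
qed

text \<open>The left side is the coefficient of the product of all \<open>t l\<close> in the
  determinant of the sum of the \<open>t l *\<^sub>R M l\<close>. Writing f as the inverse of
  \<sigma> and relabelling the permutations in the determinant by \<tau> composed with that inverse
  turns row and column indices into two independent permutations.\<close>

lemma sum_bij_det_eq_mixed_discriminant:
  fixes M :: "'n::finite \<Rightarrow> real^'n^'n"
  shows "(\<Sum>f | bij f. det (\<chi> i. M (f i) $ i)) = fact (CARD('n)) * mixed_discriminant M"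
proof -
  let ?P = "{p. p permutes (UNIV::'n set)}"
  have "(\<Sum>f\<in>?P. det (\<chi> i. M (f i) $ i)) = (\<Sum>f\<in>?P. det (\<chi> i. M (inv f i) $ i))"
    by (rule sum_permutations_inverse)
  also have "\<dots> = (\<Sum>\<sigma>\<in>?P. \<Sum>\<tau>\<in>?P. of_int (sign (\<sigma> \<circ> \<tau>)) * (\<Prod>l\<in>UNIV. M l $ \<sigma> l $ \<tau> l))"
  proof (rule sum.cong[OF refl])
    fix \<sigma> assume "\<sigma> \<in> ?P"
    then have s: "\<sigma> permutes UNIV" and b: "bij \<sigma>" by (auto simp: permutes_bij)
    have "det (\<chi> i. M (inv \<sigma> i) $ i) =
        (\<Sum>p\<in>?P. of_int (sign p) * (\<Prod>i\<in>UNIV. M (inv \<sigma> i) $ i $ p i))"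
      by (simp add: det_def)
    also have "\<dots> = (\<Sum>\<tau>\<in>?P. of_int (sign (\<tau> \<circ> inv \<sigma>)) *
        (\<Prod>i\<in>UNIV. M (inv \<sigma> i) $ i $ (\<tau> \<circ> inv \<sigma>) i))"
      by (rule sum_permutations_compose_right[OF permutes_inv[OF s]])
    also have "\<dots> = (\<Sum>\<tau>\<in>?P. of_int (sign (\<sigma> \<circ> \<tau>)) * (\<Prod>l\<in>UNIV. M l $ \<sigma> l $ \<tau> l))"
    proof (rule sum.cong[OF refl])
      fix \<tau> assume "\<tau> \<in> ?P"
      then have t: "\<tau> permutes UNIV" by auto
      have ps: "permutation \<sigma>" "permutation \<tau>" "permutation (inv \<sigma>)"
        using s t permutes_inv[OF s] by (auto simp: permutation_permutes)
      have sg: "sign (\<tau> \<circ> inv \<sigma>) = sign (\<sigma> \<circ> \<tau>)"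
        using ps by (simp add: sign_compose sign_inverse mult.commute)
      have "(\<Prod>i\<in>UNIV. M (inv \<sigma> i) $ i $ (\<tau> \<circ> inv \<sigma>) i) = (\<Prod>l\<in>UNIV. M l $ \<sigma> l $ \<tau> l)"
        by (rule prod.reindex_bij_witness[of _ \<sigma> "inv \<sigma>"])
           (use b in \<open>auto simp: bij_is_surj bij_is_inj surj_f_inv_f inv_f_f\<close>)
      then show "of_int (sign (\<tau> \<circ> inv \<sigma>)) * (\<Prod>i\<in>UNIV. M (inv \<sigma> i) $ i $ (\<tau> \<circ> inv \<sigma>) i) =
        of_int (sign (\<sigma> \<circ> \<tau>)) * (\<Prod>l\<in>UNIV. M l $ \<sigma> l $ \<tau> l)"
        by (simp add: sg)
    qed
    finally show "det (\<chi> i. M (inv \<sigma> i) $ i) =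
      (\<Sum>\<tau>\<in>?P. of_int (sign (\<sigma> \<circ> \<tau>)) * (\<Prod>l\<in>UNIV. M l $ \<sigma> l $ \<tau> l))" .
  qed
  finally have "(\<Sum>f\<in>?P. det (\<chi> i. M (f i) $ i)) = fact (CARD('n)) * mixed_discriminant M"
    by (simp add: mixed_discriminant_def)
  moreover have "?P = {f. bij f}"
    by (auto simp: permutes_bij intro: bij_imp_permutes)
  ultimately show ?thesis by simp
qed

text \<open>The two permutations play the same role and can be exchanged. This bridges the Jacobian
  matrix of the gradient, which is the transpose of \<open>hessian\<close>, and
  \<open>hessian\<close> itself in the final formula.\<close>

lemma mixed_discriminant_transpose:
  "mixed_discriminant (\<lambda>l. transpose (M l)) = mixed_discriminant M"
proof -
  have "sign (\<sigma> \<circ> \<tau>) = sign (\<tau> \<circ> \<sigma>)" if "\<sigma> permutes UNIV" "\<tau> permutes UNIV" for \<sigma> \<tau> :: "'a \<Rightarrow> 'a"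
    using that by (simp add: sign_compose mult.commute permutes_imp_permutation)
  then show ?thesis
    unfolding mixed_discriminant_def transpose_def by (subst sum.swap) (intro arg_cong2[where f="(*)"] refl sum.cong, auto)
qed

section \<open>Inclusion-exclusion weights and polarization\<close>

definition mweight :: "'l::finite set \<Rightarrow> real" where
  "mweight S = (\<Prod>x\<in>UNIV - S. -1)"

text \<open>\<open>mweight S\<close> is the inclusion-exclusion sign, -1 to the number of elements
  outside \<open>S\<close>. The sum is the expansion of the product of all 1 + g x with g = 0 on
  \<open>R\<close> and g = -1 elsewhere, in which every element outside \<open>R\<close> contributes
  a factor 0.\<close>

lemma sum_mweight_supersets:
  "(\<Sum>S\<in>UNIV. mweight S * (if R \<subseteq> S then 1 else 0)) = (if R = (UNIV::'l::finite set) then 1 else 0)"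
proof -
  let ?g = "\<lambda>x. if x \<in> R then 0 else (-1::real)"
  have "(\<Prod>x\<in>(UNIV::'l set). 1 + ?g x) = (\<Sum>S\<in>Pow UNIV. prod (\<lambda>_. 1) S * prod ?g (UNIV - S))"
    by (rule prod_add) simp
  also have "\<dots> = (\<Sum>S\<in>UNIV. mweight S * (if R \<subseteq> S then 1 else 0))"
  proof (rule sum.cong)
    fix S :: "'l set"
    have "prod ?g (UNIV - S) = mweight S * (if R \<subseteq> S then 1 else 0)"
    proof (cases "R \<subseteq> S")
      case True
      then have "prod ?g (UNIV - S) = (\<Prod>x\<in>UNIV - S. -1)" by (intro prod.cong) auto
      then show ?thesis using True by (simp add: mweight_def)
    next
      case False
      then obtain x where "x \<in> R" "x \<notin> S" by auto
      then have "prod ?g (UNIV - S) = 0" by (intro prod_zero) auto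
      then show ?thesis using False by simp
    qed
    then show "prod (\<lambda>_. 1) S * prod ?g (UNIV - S) = mweight S * (if R \<subseteq> S then 1 else 0)" by simp
  qed simp
  also have "(\<Prod>x\<in>(UNIV::'l set). 1 + ?g x) = (if R = UNIV then 1 else 0)"
  proof (cases "R = UNIV")
    case False
    then obtain x where "x \<notin> R" by auto
    then have "(\<Prod>x\<in>(UNIV::'l set). 1 + ?g x) = 0" by (intro prod_zero) (auto intro!: bexI[of _ x])
    then show ?thesis using False by simp
  qed simp
  finally show ?thesis by simp
qed

text \<open>At \<open>indicator S\<close> the monomial of \<open>f\<close> survives exactly if the
  range of \<open>f\<close> lies in \<open>S\<close>, so the weights select the surjective maps,
  which here are the bijections. Only nonnegative points are evaluated, where the form is a
  volume.\<close>

lemma polarization: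
  fixes c :: "('n::finite \<Rightarrow> 'n) \<Rightarrow> real"
  shows "(\<Sum>S\<in>UNIV. mweight S * mform c (indicator S)) = (\<Sum>f | bij f. c f)"
proof -
  have i: "(\<Prod>i\<in>UNIV. indicator S (f i)) = (if range f \<subseteq> S then 1 else (0::real))"
    for S and f :: "'n \<Rightarrow> 'n"
    by (auto simp: indicator_def image_subset_iff intro!: prod_zero)
  have "(\<Sum>S\<in>UNIV. mweight S * mform c (indicator S)) =
      (\<Sum>S\<in>UNIV. \<Sum>f\<in>UNIV. c f * (mweight S * (if range f \<subseteq> S then 1 else 0)))"
    unfolding mform_def by (simp only: i sum_distrib_left) (simp add: algebra_simps)
  also have "\<dots> = (\<Sum>f\<in>UNIV. c f * (if range f = UNIV then 1 else 0))"
    by (subst sum.swap) (simp only: sum_distrib_left[symmetric] sum_mweight_supersets)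
  also have "\<dots> = (\<Sum>f | bij f. c f)"
  proof -
    have "bij f \<longleftrightarrow> range f = UNIV" for f :: "'n \<Rightarrow> 'n"
      by (metis bij_def finite_UNIV_surj_inj finite_class.finite_UNIV)
    then show ?thesis by (simp add: sum.If_cases if_distrib[of "(*) _"] cong: if_cong)
  qed
  finally show ?thesis .
qed

text \<open>Existence: coefficients of maps with the same fibre sizes are added up. Uniqueness: the
  weights of \<open>polarization\<close> read off the coefficient of the product of all variables
  from the values at the indicators, for any expansion in multi-indices.\<close>

lemma mixed_volume_eq:
  fixes A :: "'n::finite \<Rightarrow> (real^'n) set" and c :: "('n \<Rightarrow> 'n) \<Rightarrow> real"
  assumes P: "\<And>t. (\<And>l. 0 \<le> t l) \<Longrightarrow> measure lborel (minkowski_comb t A) = mform c t"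
  shows "mixed_volume A = (\<Sum>f | bij f. c f) / fact (CARD('n))"
proof -
  let ?cnt = "\<lambda>(f::'n\<Rightarrow>'n) l. card {i. f i = l}"
  let ?A = "{\<alpha>. (\<Sum>l\<in>UNIV. \<alpha> l) = CARD('n)} :: ('n \<Rightarrow> nat) set"
  have finA: "finite ?A"
  proof -
    have "?A \<subseteq> UNIV \<rightarrow> {..CARD('n)}"
    proof
      fix \<alpha> :: "'n \<Rightarrow> nat" assume "\<alpha> \<in> ?A"
      then have "\<alpha> l \<le> CARD('n)" for l using member_le_sum[of l UNIV \<alpha>] by auto
      then show "\<alpha> \<in> UNIV \<rightarrow> {..CARD('n)}" by auto
    qed
    moreover have "finite ((UNIV::'n set) \<rightarrow> {..CARD('n)})"
      using finite_PiE[of "UNIV::'n set" "\<lambda>_. {..CARD('n)}"] by (simp add: PiE_UNIV_domain)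
    ultimately show ?thesis by (rule finite_subset)
  qed
  have mon: "(\<Prod>i\<in>UNIV. t (f i)) = (\<Prod>l\<in>UNIV. t l ^ ?cnt f l)" for t :: "'n \<Rightarrow> real" and f
  proof -
    have "(\<Prod>i\<in>UNIV. t (f i)) = (\<Prod>l\<in>UNIV. \<Prod>i\<in>{x\<in>UNIV. f x = l}. t (f i))"
      by (rule prod.group[symmetric]) auto
    also have "\<dots> = (\<Prod>l\<in>UNIV. t l ^ ?cnt f l)"
      by (intro prod.cong) auto
    finally show ?thesis .
  qed
  define c' where "c' \<alpha> = (\<Sum>f | ?cnt f = \<alpha>. c f)" for \<alpha>
  have cntA: "?cnt f \<in> ?A" for f
  proof -
    have "(\<Sum>l\<in>UNIV. ?cnt f l) = card (\<Union>l\<in>UNIV. {i. f i = l})"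
      by (subst card_UN_disjoint) auto
    also have "(\<Union>l\<in>UNIV. {i. f i = l}) = UNIV" by auto
    finally show ?thesis by simp
  qed
  have ex: "measure lborel (minkowski_comb t A) = (\<Sum>\<alpha>\<in>?A. c' \<alpha> * (\<Prod>l\<in>UNIV. t l ^ \<alpha> l))"
    if "\<forall>l. 0 \<le> t l" for t
  proof -
    have "mform c t = (\<Sum>f\<in>UNIV. c f * (\<Prod>l\<in>UNIV. t l ^ ?cnt f l))"
      by (simp add: mform_def mon)
    also have "\<dots> = (\<Sum>\<alpha>\<in>?A. \<Sum>f\<in>{f\<in>UNIV. ?cnt f = \<alpha>}. c f * (\<Prod>l\<in>UNIV. t l ^ ?cnt f l))"
      by (rule sum.group[symmetric]) (use finA cntA in auto)
    also have "\<dots> = (\<Sum>\<alpha>\<in>?A. c' \<alpha> * (\<Prod>l\<in>UNIV. t l ^ \<alpha> l))"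
      unfolding c'_def sum_distrib_right by (intro sum.cong) auto
    finally show ?thesis using P that by simp
  qed
  have bijs: "?cnt f = (\<lambda>_. 1) \<longleftrightarrow> bij f" for f
  proof
    assume "?cnt f = (\<lambda>_. 1)"
    then have "card {i. f i = l} = 1" for l by metis
    then have "{i. f i = l} \<noteq> {}" for l by (metis card.empty zero_neq_one)
    then have "\<exists>i. f i = l" for l by auto
    then have "surj f" unfolding surj_def by metis
    then show "bij f" by (metis bij_def finite_UNIV_surj_inj finite_class.finite_UNIV)
  next
    assume b: "bij f"
    then have "{i. f i = l} = {inv f l}" for l
      by (auto simp: bij_is_surj bij_is_inj surj_f_inv_f inv_f_f)
    then show "?cnt f = (\<lambda>_. 1)" by simp
  qed
  have uniq: "c2 (\<lambda>_. 1) = (\<Sum>f | bij f. c f)"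
    if c2: "\<forall>t. (\<forall>l. 0 \<le> t l) \<longrightarrow> measure lborel (minkowski_comb t A) =
      (\<Sum>\<alpha>\<in>?A. c2 \<alpha> * (\<Prod>l\<in>UNIV. t l ^ \<alpha> l))" for c2 :: "('n \<Rightarrow> nat) \<Rightarrow> real"
  proof -
    have i: "(\<Prod>l\<in>UNIV. indicator S l ^ \<alpha> l) = (if {l. \<alpha> l \<noteq> 0} \<subseteq> S then 1 else (0::real))"
      for S and \<alpha> :: "'n \<Rightarrow> nat"
    proof (cases "{l. \<alpha> l \<noteq> 0} \<subseteq> S")
      case True
      have "indicator S l ^ \<alpha> l = (1::real)" for l
        using True by (cases "l \<in> S"; cases "\<alpha> l = 0") auto
      then show ?thesis using True by simp
    next
      case False
      then obtain x where "\<alpha> x \<noteq> 0" "x \<notin> S" by auto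
      then have "(\<Prod>l\<in>UNIV. indicator S l ^ \<alpha> l) = (0::real)" by (intro prod_zero bexI[of _ x]) auto
      then show ?thesis using False by simp
    qed
    \<comment> \<open>A multi-index of degree n with full support is constantly 1, so the weights
      isolate exactly the wanted monomial.\<close>
    have one: "{l. \<alpha> l \<noteq> 0} = UNIV \<longleftrightarrow> \<alpha> = (\<lambda>_. 1)" if a: "\<alpha> \<in> ?A" for \<alpha> :: "'n \<Rightarrow> nat"
    proof
      assume "{l. \<alpha> l \<noteq> 0} = UNIV"
      then have ge: "1 \<le> \<alpha> l" for l by (metis (mono_tags) One_nat_def Suc_leI UNIV_I mem_Collect_eq neq0_conv)
      have "(\<Sum>l\<in>(UNIV::'n set). 1) = (\<Sum>l\<in>UNIV. \<alpha> l)" using a by simp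
      then have "1 = \<alpha> l" for l by (rule sum_mono_inv) (use ge in auto)
      then show "\<alpha> = (\<lambda>_. 1)" by (simp add: fun_eq_iff)
    qed auto
    have eqS: "mform c (indicator S) = (\<Sum>\<alpha>\<in>?A. c2 \<alpha> * (\<Prod>l\<in>UNIV. indicator S l ^ \<alpha> l))" for S
    proof -
      have "mform c (indicator S) = measure lborel (minkowski_comb (indicator S) A)"
        by (rule P[symmetric]) simp
      also have "\<dots> = (\<Sum>\<alpha>\<in>?A. c2 \<alpha> * (\<Prod>l\<in>UNIV. indicator S l ^ \<alpha> l))"
        by (rule c2[rule_format]) simp
      finally show ?thesis .
    qed
    have "(\<Sum>f | bij f. c f) = (\<Sum>S\<in>UNIV. mweight S * mform c (indicator S))"
      by (rule polarization[symmetric])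
    also have "\<dots> = (\<Sum>S\<in>UNIV. mweight S * (\<Sum>\<alpha>\<in>?A. c2 \<alpha> * (\<Prod>l\<in>UNIV. indicator S l ^ \<alpha> l)))"
      by (simp only: eqS)
    also have "\<dots> = (\<Sum>S\<in>UNIV. \<Sum>\<alpha>\<in>?A. c2 \<alpha> * (mweight S * (if {l. \<alpha> l \<noteq> 0} \<subseteq> S then 1 else 0)))"
      by (simp only: i sum_distrib_left) (simp add: algebra_simps)
    also have "\<dots> = (\<Sum>\<alpha>\<in>?A. c2 \<alpha> * (if {l. \<alpha> l \<noteq> 0} = UNIV then 1 else 0))"
      by (subst sum.swap) (simp only: sum_distrib_left[symmetric] sum_mweight_supersets)
    also have "\<dots> = (\<Sum>\<alpha>\<in>?A. if \<alpha> = (\<lambda>_. 1) then c2 \<alpha> else 0)"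
    proof (rule sum.cong[OF refl])
      fix \<alpha> assume a: "\<alpha> \<in> ?A"
      show "c2 \<alpha> * (if {l. \<alpha> l \<noteq> 0} = UNIV then 1 else 0) = (if \<alpha> = (\<lambda>_. 1) then c2 \<alpha> else 0)"
        by (simp only: one[OF a]) simp
    qed
    also have "\<dots> = c2 (\<lambda>_. 1)"
      using finA by (subst sum.delta) auto
    finally show ?thesis by simp
  qed
  have c'1: "c' (\<lambda>_. 1) = (\<Sum>f | bij f. c f)"
    unfolding c'_def bijs ..
  show ?thesis
    unfolding mixed_volume_def
  proof (rule the_equality)
    show "\<exists>c2. (\<forall>t. (\<forall>l. 0 \<le> t l) \<longrightarrow> measure lborel (minkowski_comb t A) =
        (\<Sum>\<alpha>\<in>?A. c2 \<alpha> * (\<Prod>l\<in>UNIV. t l ^ \<alpha> l))) \<and>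
        (\<Sum>f | bij f. c f) / fact (CARD('n)) = c2 (\<lambda>_. 1) / fact (CARD('n))"
      by (rule exI[of _ c'], rule conjI) (intro allI impI, rule ex, assumption, simp only: c'1)
  next
    fix v assume "\<exists>c2. (\<forall>t. (\<forall>l. 0 \<le> t l) \<longrightarrow> measure lborel (minkowski_comb t A) =
        (\<Sum>\<alpha>\<in>?A. c2 \<alpha> * (\<Prod>l\<in>UNIV. t l ^ \<alpha> l))) \<and> v = c2 (\<lambda>_. 1) / fact (CARD('n))"
    then show "v = (\<Sum>f | bij f. c f) / fact (CARD('n))"
    proof (elim exE conjE)
      fix c2 assume c2: "\<forall>t. (\<forall>l. 0 \<le> t l) \<longrightarrow> measure lborel (minkowski_comb t A) =
        (\<Sum>\<alpha>\<in>?A. c2 \<alpha> * (\<Prod>l\<in>UNIV. t l ^ \<alpha> l))" and v: "v = c2 (\<lambda>_. 1) / fact (CARD('n))"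
      show ?thesis by (simp only: v uniq[OF c2])
    qed
  qed
qed

text \<open>The evaluations of forms at points span a finite-dimensional space of functionals, so a
  pointwise limit of forms is again a form although the coefficients need not converge.\<close>

lemma mform_limit:
  fixes c :: "nat \<Rightarrow> ('n::finite \<Rightarrow> 'l::finite) \<Rightarrow> real"
  assumes "\<And>t. t \<in> T \<Longrightarrow> (\<lambda>k. mform (c k) t) \<longlonglongrightarrow> p t"
  obtains c0 :: "('n \<Rightarrow> 'l) \<Rightarrow> real" where "\<And>t. t \<in> T \<Longrightarrow> p t = mform c0 t"
proof -
  define e :: "('l \<Rightarrow> real) \<Rightarrow> real^('n \<Rightarrow> 'l)" where "e t = (\<chi> f. \<Prod>i\<in>UNIV. t (f i))" for t
  define F :: "nat \<Rightarrow> real^('n \<Rightarrow> 'l) \<Rightarrow> real" where "F k x = (\<chi> f. c k f) \<bullet> x" for k x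
  have F: "F k (e t) = mform (c k) t" for k t
    by (simp add: F_def e_def mform_def inner_vec_def)
  obtain B where B: "B \<subseteq> e ` T" "independent B" "e ` T \<subseteq> span B"
    by (rule basis_exists)
  \<comment> \<open>The members of \<open>B\<close> are vectors \<open>e t\<close>, where
    convergence is given; off the span of \<open>B\<close> the values of \<open>G\<close> are
    arbitrary, which is why the coefficients found below need not be limits of the given
    ones.\<close>
  obtain G where G: "linear G" "\<And>x. x \<in> B \<Longrightarrow> G x = lim (\<lambda>k. F k x)"
    using linear_independent_extend[OF B(2), of "\<lambda>x. lim (\<lambda>k. F k x)"] by auto
  have lim: "(\<lambda>k. F k x) \<longlonglongrightarrow> G x" if "x \<in> span B" for x
    using that
  proof (induction rule: span_induct_alt)
    case base
    then show ?case using G(1) by (simp add: F_def linear_0)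
  next
    case (step a x y)
    then obtain t where "t \<in> T" "x = e t" using B by auto
    then have "(\<lambda>k. F k x) \<longlonglongrightarrow> p t" using assms F by simp
    then have "(\<lambda>k. F k x) \<longlonglongrightarrow> G x" using G(2)[OF step(1)] limI by force
    then have "(\<lambda>k. a * F k x + F k y) \<longlonglongrightarrow> a * G x + G y"
      by (intro tendsto_intros step)
    then show ?case using G(1)
      by (simp add: F_def inner_add_right linear_add linear_scale)
  qed
  have "p t = mform (\<lambda>f. G (axis f 1)) t" if "t \<in> T" for t
  proof -
    have "(\<lambda>k. F k (e t)) \<longlonglongrightarrow> G (e t)" using lim B that by auto
    then have "p t = G (e t)" using assms[OF that] F LIMSEQ_unique by simp
    also have "e t = (\<Sum>f\<in>UNIV. e t $ f *s axis f 1)"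
      by (simp add: basis_expansion)
    also have "G \<dots> = (\<Sum>f\<in>UNIV. G (e t $ f *\<^sub>R axis f 1))"
      using G(1) by (simp add: linear_sum scalar_mult_eq_scaleR)
    also have "\<dots> = mform (\<lambda>f. G (axis f 1)) t"
      using G(1) by (simp add: linear_scale mform_def e_def mult.commute)
    finally show ?thesis .
  qed
  then show thesis by (rule that[of "\<lambda>f. G (axis f 1)"])
qed

section \<open>Determinants of rank-one perturbations\<close>

definition outer :: "real^'n \<Rightarrow> real^'n \<Rightarrow> real^'n^'n" where
  "outer a b = (\<chi> i j. a $ i * b $ j)"

lemma outer_nth [simp]: "outer a b $ i = a $ i *\<^sub>R b" "outer a b $ i $ j = a $ i * b $ j"
  by (simp_all add: outer_def vec_eq_iff)

lemma matrix_add_rdistrib: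
  fixes A B :: "'a::semiring_1^'n^'m"
  shows "(A + B) ** C = A ** C + B ** C"
  by (vector matrix_matrix_mult_def sum.distrib[symmetric] field_simps)

lemma outer_mult_vec: "outer a b *v x = (b \<bullet> x) *\<^sub>R a"
  by (simp add: outer_def matrix_vector_mult_def vec_eq_iff inner_vec_def sum_distrib_left
      sum_distrib_right algebra_simps)

lemma matrix_mult_outer: "B ** outer a b = outer (B *v a) b"
  by (simp add: outer_def matrix_matrix_mult_def matrix_vector_mult_def vec_eq_iff
      sum_distrib_left algebra_simps)

lemma outer_matrix_mult: "outer a b ** B = outer a (b v* B)"
  by (simp add: outer_def matrix_matrix_mult_def vector_matrix_mult_def vec_eq_iff
      sum_distrib_left algebra_simps)

lemma outer_add_left: "outer (a + a') b = outer a b + outer a' b"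
  and outer_diff_left: "outer (a - a') b = outer a b - outer a' b"
  and outer_scaleR_left: "outer (c *\<^sub>R a) b = c *\<^sub>R outer a b"
  by (simp_all add: outer_def vec_eq_iff algebra_simps)

lemma outer_sum_left: "outer (\<Sum>x\<in>S. a x) b = (\<Sum>x\<in>S. outer (a x) b)"
  by (simp add: outer_def vec_eq_iff sum_distrib_right)

text \<open>An orthogonal change of basis moves \<open>u\<close> to a basis vector. The perturbation
  then touches a single column, and Cramer's rule evaluates the determinant.\<close>

lemma det_mat_1_add_outer:
  fixes u :: "real^'n"
  assumes u: "norm u = 1"
  shows "det (mat 1 + outer a u) = 1 + a \<bullet> u"
proof -
  obtain k :: 'n where "True" by auto
  obtain Q :: "real^'n^'n" where Q: "orthogonal_matrix Q" and Qk: "Q *v axis k 1 = u"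
    using orthogonal_matrix_exists_basis[OF u] by blast
  have QQ: "transpose Q ** Q = mat 1" using Q by (simp add: orthogonal_matrix)
  define a' where "a' = transpose Q *v a"
  have uQ: "u v* Q = axis k 1"
  proof -
    have "u v* Q = transpose Q *v (Q *v axis k 1)"
      by (simp add: Qk transpose_matrix_vector)
    then show ?thesis by (simp add: matrix_vector_mul_assoc QQ)
  qed
  have eq: "transpose Q ** (mat 1 + outer a u) ** Q = mat 1 + outer a' (axis k 1)"
    by (simp add: matrix_add_ldistrib matrix_add_rdistrib QQ matrix_mult_outer outer_matrix_mult
        uQ a'_def matrix_mul_rid matrix_mul_lid)
  have "det Q * det Q = 1"
    using arg_cong[OF QQ, of det] by (simp add: det_mul)
  then have "det (mat 1 + outer a u) = det (mat 1 + outer a' (axis k 1))"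
    unfolding eq[symmetric] det_mul by (simp add: algebra_simps)
  also have "\<dots> = det (transpose (mat 1 + outer a' (axis k 1)))" by simp
  also have "transpose (mat 1 + outer a' (axis k 1)) = (\<chi> i. if i = k then
      sum (\<lambda>i. (axis k 1 + a') $ i *s row i (mat 1)) UNIV else row i (mat 1))"
  proof -
    have "sum (\<lambda>i. (axis k 1 + a') $ i *s row i (mat 1)) UNIV = axis k 1 + a'"
    proof -
      have "row i (mat 1) = (axis i 1 :: real^'n)" for i :: 'n
        by (simp add: row_def mat_def axis_def vec_eq_iff)
      then show ?thesis by (simp only: basis_expansion)
    qed
    then show ?thesis
      by (auto simp: vec_eq_iff transpose_def mat_def row_def axis_def)
  qed
  also have "det \<dots> = (axis k 1 + a') $ k * det (mat 1 :: real^'n^'n)"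
    by (rule cramer_lemma_transpose)
  also have "\<dots> = 1 + a' \<bullet> axis k 1"
    by (simp add: inner_axis)
  also have "a' \<bullet> axis k 1 = a \<bullet> u"
    unfolding a'_def using Qk by (metis dot_lmul_matrix transpose_matrix_vector)
  finally show ?thesis .
qed

text \<open>Jacobi's formula in the direction of the identity: the sum is the trace of the adjugate,
  each summand a principal minor of size n - 1.\<close>

lemma DERIV_det_add_scaleR_mat_1:
  "((\<lambda>s. det (J + s *\<^sub>R mat 1)) has_field_derivative
     (\<Sum>i\<in>UNIV. det (\<chi> k. if k = i then axis i 1 else J $ k))) (at (0::real))"
proof -
  have "((\<lambda>s. \<Sum>p | p permutes UNIV. of_int (sign p) * (\<Prod>k\<in>UNIV. J $ k $ p k + s * mat 1 $ k $ p k))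
     has_field_derivative
     (\<Sum>p | p permutes UNIV. of_int (sign p) *
        (\<Sum>i\<in>UNIV. mat 1 $ i $ p i * (\<Prod>k\<in>UNIV - {i}. J $ k $ p k + 0 * mat 1 $ k $ p k)))) (at 0)"
    by (intro DERIV_sum DERIV_cmult has_field_derivative_prod) (auto intro!: derivative_eq_intros)
  also have "(\<lambda>s. \<Sum>p | p permutes UNIV. of_int (sign p) *
      (\<Prod>k\<in>UNIV. J $ k $ p k + s * mat 1 $ k $ p k)) = (\<lambda>s. det (J + s *\<^sub>R mat 1))"
    by (simp add: det_def fun_eq_iff)
  also have "(\<Sum>p | p permutes UNIV. of_int (sign p) *
        (\<Sum>i\<in>UNIV. mat 1 $ i $ p i * (\<Prod>k\<in>UNIV - {i}. J $ k $ p k + 0 * mat 1 $ k $ p k))) =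
     (\<Sum>i\<in>UNIV. det (\<chi> k. if k = i then axis i 1 else J $ k))"
  proof -
    have "(\<Prod>k\<in>UNIV. (\<chi> k. if k = i then axis i 1 else J $ k) $ k $ p k) =
        mat 1 $ i $ p i * (\<Prod>k\<in>UNIV - {i}. J $ k $ p k)" for i p
    proof -
      have "(\<Prod>k\<in>UNIV. (\<chi> k. if k = i then axis i 1 else J $ k) $ k $ p k) =
        axis i 1 $ p i * (\<Prod>k\<in>UNIV - {i}. (\<chi> k. if k = i then axis i 1 else J $ k) $ k $ p k)"
        by (subst prod.remove[of _ i]) auto
      also have "(\<Prod>k\<in>UNIV - {i}. (\<chi> k. if k = i then axis i 1 else J $ k) $ k $ p k) =
          (\<Prod>k\<in>UNIV - {i}. J $ k $ p k)"
        by (intro prod.cong) auto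
      finally show ?thesis by (simp add: mat_def axis_def)
    qed
    then show ?thesis
      unfolding det_def by (subst sum.swap) (simp add: sum_distrib_left)
  qed
  finally show ?thesis .
qed

context
  fixes J :: "real^'n^'n" and u :: "real^'n"
  assumes u: "norm u = 1" and Ju: "J *v u = 0" and uJ: "u v* J = 0"
begin

text \<open>Since \<open>u v* J = 0\<close>, multiplying J + u u^T from the left by I + (g - u) u^T
  leaves \<open>J\<close> alone and turns u u^T into g u^T.\<close>

lemma det_add_outer: "det (J + outer g u) = (g \<bullet> u) * det (J + outer u u)"
proof -
  have uu: "u \<bullet> u = 1" using u by (simp add: norm_eq_1)
  have "u v* outer u u = u"
    using uu by (simp add: vector_matrix_mult_def vec_eq_iff sum_distrib_right[symmetric]
        inner_vec_def mult.assoc[symmetric])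
  then have "u v* (J + outer u u) = u"
    using uJ by (simp add: vector_matrix_mult_def vec_eq_iff sum.distrib algebra_simps)
  then have "(mat 1 + outer (g - u) u) ** (J + outer u u) = J + outer g u"
    by (simp add: matrix_add_rdistrib outer_matrix_mult matrix_mul_lid)
       (simp add: outer_diff_left)
  then have "det (J + outer g u) = det (mat 1 + outer (g - u) u) * det (J + outer u u)"
    by (metis det_mul)
  also have "det (mat 1 + outer (g - u) u) = g \<bullet> u"
    using uu by (simp add: det_mat_1_add_outer[OF u] inner_diff_left)
  finally show ?thesis .
qed

text \<open>Both sides are the derivative of \<open>det (J + s I)\<close> at \<open>s = 0\<close>, the trace of the adjugate.\<close>

lemma det_add_outer_self:
  "det (J + outer u u) = (\<Sum>i\<in>UNIV. det (\<chi> k. if k = i then axis i 1 else J $ k))"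
proof -
  have uu: "u \<bullet> u = 1" using u by (simp add: norm_eq_1)
  have det0: "det J = 0"
    by (metis Ju u invertible_det_nz invertible_left_inverse matrix_left_invertible_ker norm_zero zero_neq_one)
  \<comment> \<open>Because (J + s I) u = s u, multiplying J + s I by I + ((1 - s) / s) u u^T adds
    exactly (1 - s) u u^T. The second factor has determinant 1 / s, which together with det J = 0
    produces the difference quotient.\<close>
  have eq: "(det (J + s *\<^sub>R mat 1) - det (J + 0 *\<^sub>R mat 1)) / s =
      det (J + s *\<^sub>R mat 1 + (1 - s) *\<^sub>R outer u u)" if "s \<noteq> 0" for s
  proof -
    have "(J + s *\<^sub>R mat 1) ** (mat 1 + outer (((1 - s) / s) *\<^sub>R u) u) =
        J + s *\<^sub>R mat 1 + (1 - s) *\<^sub>R outer u u"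
    proof -
      have "(J + s *\<^sub>R mat 1) *v u = s *\<^sub>R u"
        by (simp add: matrix_vector_mult_add_rdistrib Ju scaleR_matrix_vector_assoc[symmetric])
      then have "(J + s *\<^sub>R mat 1) ** outer (((1 - s) / s) *\<^sub>R u) u = (1 - s) *\<^sub>R outer u u"
        using that by (simp add: matrix_mult_outer outer_scaleR_left matrix_scalar_ac
            scalar_matrix_assoc[symmetric] scaleR_matrix_vector_assoc[symmetric])
      then show ?thesis by (simp add: matrix_add_ldistrib matrix_mul_rid)
    qed
    then have "det (J + s *\<^sub>R mat 1 + (1 - s) *\<^sub>R outer u u) =
        det (J + s *\<^sub>R mat 1) * det (mat 1 + outer (((1 - s) / s) *\<^sub>R u) u)"
      by (metis det_mul)
    also have "det (mat 1 + outer (((1 - s) / s) *\<^sub>R u) u) = 1 / s"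
      using that by (simp add: det_mat_1_add_outer[OF u] uu field_simps)
    finally show ?thesis using det0 by simp
  qed
  have "((\<lambda>s. (det (J + s *\<^sub>R mat 1) - det (J + 0 *\<^sub>R mat 1)) / s) \<longlongrightarrow>
     (\<Sum>i\<in>UNIV. det (\<chi> k. if k = i then axis i 1 else J $ k))) (at 0)"
    using DERIV_det_add_scaleR_mat_1[of J] by (simp add: has_field_derivative_iff)
  moreover have "((\<lambda>s. (det (J + s *\<^sub>R mat 1) - det (J + 0 *\<^sub>R mat 1)) / s) \<longlongrightarrow>
     det (J + 0 *\<^sub>R mat 1 + (1 - 0) *\<^sub>R outer u u)) (at 0)"
  proof (rule Lim_transform_eventually)
    show "((\<lambda>s. det (J + s *\<^sub>R mat 1 + (1 - s) *\<^sub>R outer u u)) \<longlongrightarrow>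
       det (J + 0 *\<^sub>R mat 1 + (1 - 0) *\<^sub>R outer u u)) (at 0)"
      unfolding det_def by (intro tendsto_intros)
    show "\<forall>\<^sub>F s in at 0. det (J + s *\<^sub>R mat 1 + (1 - s) *\<^sub>R outer u u) =
      (det (J + s *\<^sub>R mat 1) - det (J + 0 *\<^sub>R mat 1)) / s"
      using eq by (auto simp: eventually_at_filter)
  qed
  ultimately show ?thesis
    using tendsto_unique[of "at (0::real)"] by fastforce
qed

end

text \<open>The factor \<open>t l1\<close> is moved into row \<open>i\<close>, the one replaced by
  \<open>axis i 1\<close>, so that this row counts as supplied by \<open>l1\<close>. The product
  then has the full degree n, and only maps with \<open>f i = l1\<close> contribute.\<close>

lemma adjugate_trace_mform:
  fixes J :: "'n::finite \<Rightarrow> real^'n^'n"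
  shows "t l1 * (\<Sum>i\<in>UNIV. det (\<chi> k. if k = i then axis i 1 else (\<Sum>l\<in>UNIV. t l *\<^sub>R J l) $ k)) =
    mform (\<lambda>f. \<Sum>i | f i = l1. det (\<chi> k. if k = i then axis i 1 else J (f k) $ k)) t"
proof -
  have "t l1 * det (\<chi> k. if k = i then axis i 1 else (\<Sum>l\<in>UNIV. t l *\<^sub>R J l) $ k) =
    (\<Sum>f\<in>UNIV. if f i = l1 then det (\<chi> k. if k = i then axis i 1 else J (f k) $ k) * (\<Prod>k\<in>UNIV. t (f k)) else 0)"
    (is "?L = ?R") for i
  proof -
    let ?a = "\<lambda>k l. if k = i then (if l = l1 then axis i 1 else 0) else J l $ k"
    have "?L = det (\<chi> k. if k = i then t l1 *s axis i 1 else (\<chi> k. (\<Sum>l\<in>UNIV. t l *\<^sub>R J l) $ k) $ k)"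
      by (subst det_row_mul) (simp only: vec_lambda_beta)
    also have "(\<chi> k. if k = i then t l1 *s axis i 1 else (\<chi> k. (\<Sum>l\<in>UNIV. t l *\<^sub>R J l) $ k) $ k) =
       (\<chi> k. \<Sum>l\<in>UNIV. t l *s ?a k l)"
    proof (rule iffD2[OF vec_eq_iff], rule allI)
      fix k
      have "(\<Sum>l\<in>UNIV. t l *s (if l = l1 then axis i 1 else 0)) =
          (\<Sum>l\<in>UNIV. if l = l1 then t l *s axis i 1 else (0::real^'n))"
        by (intro sum.cong) auto
      also have "\<dots> = t l1 *s axis i 1" by (simp add: sum.delta)
      finally show "(\<chi> k. if k = i then t l1 *s axis i 1 else (\<chi> k. (\<Sum>l\<in>UNIV. t l *\<^sub>R J l) $ k) $ k) $ k =
          (\<chi> k. \<Sum>l\<in>UNIV. t l *s ?a k l) $ k"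
        by (cases "k = i") (simp_all add: scalar_mult_eq_scaleR)
    qed
    also have "det \<dots> = (\<Sum>f\<in>UNIV. det (\<chi> k. t (f k) *s ?a k (f k)))"
      using det_linear_rows_sum[of "UNIV :: 'n set" "\<lambda>k l. t l *s ?a k l"] by simp
    also have "\<dots> = ?R"
    proof (rule sum.cong[OF refl])
      fix f
      show "det (\<chi> k. t (f k) *s ?a k (f k)) =
        (if f i = l1 then det (\<chi> k. if k = i then axis i 1 else J (f k) $ k) * (\<Prod>k\<in>UNIV. t (f k)) else 0)"
      proof (cases "f i = l1")
        case True
        then have "(\<lambda>k. ?a k (f k)) = (\<lambda>k. if k = i then axis i 1 else J (f k) $ k)" by auto
        then show ?thesis using True by (simp add: det_rows_mul mult.commute)
      next
        case False
        then have "row i (\<chi> k. ?a k (f k)) = 0"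
          by (simp add: row_def vec_eq_iff)
        then have "det (\<chi> k. ?a k (f k)) = 0" by (rule det_zero_row)
        then show ?thesis using False by (simp add: det_rows_mul)
      qed
    qed
    finally show ?thesis .
  qed
  then have "t l1 * (\<Sum>i\<in>UNIV. det (\<chi> k. if k = i then axis i 1 else (\<Sum>l\<in>UNIV. t l *\<^sub>R J l) $ k)) =
    (\<Sum>f\<in>UNIV. \<Sum>i\<in>UNIV. if f i = l1 then det (\<chi> k. if k = i then axis i 1 else J (f k) $ k) * (\<Prod>k\<in>UNIV. t (f k)) else 0)"
    by (simp add: sum_distrib_left) (rule sum.swap)
  also have "\<dots> = mform (\<lambda>f. \<Sum>i | f i = l1. det (\<chi> k. if k = i then axis i 1 else J (f k) $ k)) t"
    by (simp add: mform_def sum.If_cases sum_distrib_right)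
  finally show ?thesis .
qed

text \<open>A bijection hits \<open>l1\<close> at exactly one \<open>i\<close>, and
  \<open>axis i 1\<close> is row \<open>i\<close> of the identity: the replaced row looks as if the
  identity stood in slot \<open>l1\<close>.\<close>

lemma adjugate_trace_mixed_discriminant:
  fixes J :: "'n::finite \<Rightarrow> real^'n^'n"
  shows "(\<Sum>f | bij f. \<Sum>i | f i = l1. det (\<chi> k. if k = i then axis i 1 else J (f k) $ k)) =
    fact (CARD('n)) * mixed_discriminant (\<lambda>l. if l = l1 then mat 1 else J l)"
proof -
  have "(\<Sum>i | f i = l1. det (\<chi> k. if k = i then axis i 1 else J (f k) $ k)) =
    det (\<chi> i. (if f i = l1 then mat 1 else J (f i)) $ i)" if f: "bij f" for f
  proof -
    have inj: "f k = l1 \<longleftrightarrow> k = inv f l1" for k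
      using f by (metis bij_inv_eq_iff)
    have "mat 1 $ i = (axis i 1 :: real^'n)" for i by (simp add: mat_def axis_def vec_eq_iff)
    then have m: "(\<chi> k. if k = inv f l1 then axis (inv f l1) 1 else J (f k) $ k) =
        (\<chi> i. (if f i = l1 then mat 1 else J (f i)) $ i)"
      by (simp add: vec_eq_iff inj)
    have s: "{i. f i = l1} = {inv f l1}" by (auto simp: inj)
    show ?thesis unfolding m[symmetric] s by simp
  qed
  then show ?thesis
    by (simp add: sum_bij_det_eq_mixed_discriminant[symmetric])
qed

section \<open>Polar coordinates\<close>

lemma borel_measurable_sgn [measurable]:
  "(sgn :: 'a::euclidean_space \<Rightarrow> 'a) \<in> borel_measurable borel"
  unfolding sgn_div_norm[abs_def] by measurable

lemma space_sphere_measure [simp]: "space (sphere_measure :: 'a::euclidean_space measure) = sphere 0 1"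
  by (simp add: sphere_measure_def space_scale_measure space_restrict_space)

lemma sets_sphere_measure [measurable_cong]:
  "sets (sphere_measure :: 'a::euclidean_space measure) = sets (restrict_space borel (sphere 0 1))"
  by (simp add: sphere_measure_def)

lemma measurable_sphere_measure:
  "f \<in> measurable borel N \<Longrightarrow> f \<in> measurable (sphere_measure :: 'a::euclidean_space measure) N"
  by (simp add: measurable_cong_sets[OF sets_sphere_measure refl] measurable_restrict_space1)

lemma nn_integral_sphere_measure:
  fixes g :: "'a::euclidean_space \<Rightarrow> ennreal"
  assumes [measurable]: "g \<in> borel_measurable borel"
  shows "(\<integral>\<^sup>+u. g u \<partial>sphere_measure) =
    ennreal (real DIM('a)) * (\<integral>\<^sup>+x. g (sgn x) * indicator (cball 0 1 - {0}) x \<partial>lborel)"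
proof -
  let ?P = "cball (0::'a) 1 - {0}"
  have m: "sgn \<in> measurable (restrict_space lborel ?P) (restrict_space borel (sphere (0::'a) 1))"
  proof (rule measurable_restrict_space2)
    show "sgn \<in> space (restrict_space lborel ?P) \<rightarrow> sphere (0::'a) 1"
      by (auto simp: space_restrict_space norm_sgn)
    show "sgn \<in> borel_measurable (restrict_space lborel ?P)"
      by (rule measurable_restrict_space1) measurable
  qed
  have g: "g \<in> borel_measurable (restrict_space borel (sphere (0::'a) 1))"
    by (rule measurable_restrict_space1) measurable
  show ?thesis
    unfolding sphere_measure_def
    by (simp add: nn_integral_scale_measure g m nn_integral_distr nn_integral_restrict_space)
qed

lemma nn_integral_lborel_scaleR:
  fixes f :: "'a::euclidean_space \<Rightarrow> ennreal"
  assumes [measurable]: "f \<in> borel_measurable borel" and c: "0 < c"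
  shows "(\<integral>\<^sup>+x. f x \<partial>lborel) = (\<integral>\<^sup>+x. ennreal (c ^ DIM('a)) * f (c *\<^sub>R x) \<partial>lborel)"
  using c by (subst lborel_affine[of c 0])
    (simp_all add: nn_integral_density nn_integral_distr)

text \<open>The last integration in the polar coordinate formula. Its value is independent of
  \<open>y\<close> and cancels the dimension factor of \<open>sphere_measure\<close>.\<close>

lemma nn_integral_power_atLeast:
  fixes y :: real and m :: nat
  assumes y: "0 < y" and m: "0 < m"
  shows "(\<integral>\<^sup>+t. ennreal (y ^ m / t ^ (m + 1)) * indicator {y..} t \<partial>lborel) = ennreal (1 / real m)"
proof -
  let ?F = "\<lambda>t. - (y ^ m) / (real m * t ^ m)"
  have "(\<integral>\<^sup>+t. ennreal (y ^ m / t ^ (m + 1)) * indicator {y..} t \<partial>lborel) = ennreal (0 - ?F y)"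
  proof (rule nn_integral_FTC_atLeast[where F = ?F and T = 0])
    show "(\<lambda>t. y ^ m / t ^ (m + 1)) \<in> borel_measurable borel" by measurable
    show "DERIV ?F t :> y ^ m / t ^ (m + 1)" if "y \<le> t" for t
    proof -
      have t: "t > 0" using that y by simp
      have *: "t ^ m = t * t ^ (m - 1)" using m by (cases m) auto
      show ?thesis
        using t m by (auto intro!: derivative_eq_intros simp: field_simps power_add *)
    qed
    show "0 \<le> y ^ m / t ^ (m + 1)" if "y \<le> t" for t using that y by simp
    have "filterlim (\<lambda>t::real. real m * t ^ m) at_top at_top"
      using m by (intro filterlim_tendsto_pos_mult_at_top[OF tendsto_const] filterlim_pow_at_top filterlim_ident) auto
    then show "(?F \<longlongrightarrow> 0) at_top"
      by (intro real_tendsto_divide_at_top[OF tendsto_const])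
  qed
  also have "0 - ?F y = 1 / real m" using y by simp
  finally show ?thesis .
qed

text \<open>\<open>sphere_measure\<close> is an image of the volume of the ball, so the right side
  is an integral over points x of the ball and radii r. The substitution r = |x| t turns r sgn x
  into t x; for fixed t the substitution y = t x frees \<open>f\<close> of t, and the remaining
  integral over t >= |y| is constant.\<close>

theorem nn_integral_polar:
  fixes f :: "'a::euclidean_space \<Rightarrow> ennreal"
  assumes [measurable]: "f \<in> borel_measurable borel"
  shows "(\<integral>\<^sup>+x. f x \<partial>lborel) =
    (\<integral>\<^sup>+u. (\<integral>\<^sup>+r. indicator {0<..} r * ennreal (r ^ (DIM('a) - 1)) * f (r *\<^sub>R u) \<partial>lborel) \<partial>sphere_measure)"
proof -
  define m where "m = DIM('a)"
  have m: "0 < m" and m1: "x ^ m = x * x ^ (m - 1)" for x :: real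
    using DIM_positive[where 'a='a] by (auto simp: m_def power_eq_if)
  let ?P = "cball (0::'a) 1 - {0}"
  let ?g = "\<lambda>r u. indicator {0<..} r * ennreal (r ^ (m - 1)) * f (r *\<^sub>R u)"
  let ?h = "\<lambda>x t. indicator {0<..} t * indicator ?P x * ennreal (norm x ^ m * t ^ (m - 1)) * f (t *\<^sub>R x)"
  let ?k = "\<lambda>y t. indicator {0<..} t * indicator {norm y..} t * indicator (-{0}) y * ennreal (norm y ^ m / t ^ (m + 1)) * f y"
  have "(\<integral>\<^sup>+u. (\<integral>\<^sup>+r. ?g r u \<partial>lborel) \<partial>sphere_measure)
    = ennreal (real m) * (\<integral>\<^sup>+x. (\<integral>\<^sup>+r. ?g r (sgn x) \<partial>lborel) * indicator ?P x \<partial>lborel)"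
    unfolding m_def by (rule nn_integral_sphere_measure) measurable
  also have "(\<integral>\<^sup>+x. (\<integral>\<^sup>+r. ?g r (sgn x) \<partial>lborel) * indicator ?P x \<partial>lborel) = (\<integral>\<^sup>+x. (\<integral>\<^sup>+t. ?h x t \<partial>lborel) \<partial>lborel)"
  proof (rule nn_integral_cong)
    fix x :: 'a
    show "(\<integral>\<^sup>+r. ?g r (sgn x) \<partial>lborel) * indicator ?P x = (\<integral>\<^sup>+t. ?h x t \<partial>lborel)"
    proof (cases "x \<in> ?P")
      case True
      then have n: "0 < norm x" by auto
      have "(\<integral>\<^sup>+r. ?g r (sgn x) \<partial>lborel) = (\<integral>\<^sup>+t. ennreal (norm x ^ DIM(real)) * ?g (norm x *\<^sub>R t) (sgn x) \<partial>lborel)"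
        by (rule nn_integral_lborel_scaleR) (use n in measurable)
      also have "\<dots> = (\<integral>\<^sup>+t. ?h x t \<partial>lborel)"
      proof (rule nn_integral_cong)
        fix t :: real
        have "(norm x * t) *\<^sub>R sgn x = t *\<^sub>R x" using n by (simp add: sgn_div_norm)
        moreover have "ennreal (norm x) * ennreal ((norm x * t) ^ (m - 1)) = ennreal (norm x ^ m * t ^ (m - 1))"
          if "0 < t" using n that by (simp add: ennreal_mult[symmetric] power_mult_distrib m1 mult.assoc)
        ultimately show "ennreal (norm x ^ DIM(real)) * ?g (norm x *\<^sub>R t) (sgn x) = ?h x t"
          using True n by (auto simp: indicator_def zero_less_mult_iff mult.assoc[symmetric])
      qed
      finally show ?thesis using True by simp
    qed simp
  qed
  also have "\<dots> = (\<integral>\<^sup>+t. (\<integral>\<^sup>+x. ?h x t \<partial>lborel) \<partial>lborel)"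
  proof (rule lborel_pair.Fubini'[symmetric])
    have [measurable]: "?P \<in> sets borel" by auto
    show "(\<lambda>(x, t). ?h x t) \<in> borel_measurable (lborel \<Otimes>\<^sub>M lborel)"
      unfolding measurable_cong_sets[OF sets_pair_measure_cong[OF sets_lborel sets_lborel] refl]
      by measurable
  qed
  also have "\<dots> = (\<integral>\<^sup>+t. (\<integral>\<^sup>+y. ?k y t \<partial>lborel) \<partial>lborel)"
  proof (rule nn_integral_cong)
    fix t :: real
    show "(\<integral>\<^sup>+x. ?h x t \<partial>lborel) = (\<integral>\<^sup>+y. ?k y t \<partial>lborel)"
    proof (cases "0 < t")
      case True
      have "(\<lambda>y::'a. indicator {norm y..} t :: ennreal) = indicator (cball 0 t)"
        by (auto simp: indicator_def)
      then have [measurable]: "(\<lambda>y::'a. indicator {norm y..} t :: ennreal) \<in> borel_measurable borel"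
        by (simp only: borel_measurable_indicator[OF borel_closed[OF closed_cball]])
      have "(\<integral>\<^sup>+y. ?k y t \<partial>lborel) = (\<integral>\<^sup>+x. ennreal (t ^ DIM('a)) * ?k (t *\<^sub>R x) t \<partial>lborel)"
        by (rule nn_integral_lborel_scaleR) (use True in measurable)
      also have "\<dots> = (\<integral>\<^sup>+x. ?h x t \<partial>lborel)"
      proof (rule nn_integral_cong)
        fix x :: 'a
        have "t ^ m * ((t * norm x) ^ m / t ^ (m + 1)) = norm x ^ m * t ^ (m - 1)"
          using True by (simp add: power_mult_distrib m1[of t])
        then have e: "ennreal (t ^ m) * ennreal ((t * norm x) ^ m / t ^ (m + 1)) = ennreal (norm x ^ m * t ^ (m - 1))"
          using True by (subst ennreal_mult[symmetric]) auto
        have "t * norm x \<le> t \<longleftrightarrow> norm x \<le> 1" using True by simp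
        then show "ennreal (t ^ DIM('a)) * ?k (t *\<^sub>R x) t = ?h x t"
          using True by (auto simp: indicator_def m_def[symmetric] e[simplified] mult.assoc[symmetric])
      qed
      finally show ?thesis by simp
    qed simp
  qed
  also have "\<dots> = (\<integral>\<^sup>+y. (\<integral>\<^sup>+t. ?k y t \<partial>lborel) \<partial>lborel)"
  proof (rule lborel_pair.Fubini')
    have [measurable]: "-{0::'a} \<in> sets borel" by auto
    have "(\<lambda>(y, t). ?k y t) =
      (\<lambda>(y, t). if norm y \<le> t then indicator {0<..} t * indicator (-{0}) y * ennreal (norm y ^ m / t ^ (m + 1)) * f y else 0)"
      by (auto simp: fun_eq_iff indicator_def)
    also have "\<dots> \<in> borel_measurable (lborel \<Otimes>\<^sub>M lborel)"
      unfolding measurable_cong_sets[OF sets_pair_measure_cong[OF sets_lborel sets_lborel] refl]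
      by measurable
    finally show "(\<lambda>(y, t). ?k y t) \<in> borel_measurable (lborel \<Otimes>\<^sub>M lborel)" .
  qed
  also have "\<dots> = (\<integral>\<^sup>+y. ennreal (1 / real m) * f y \<partial>lborel)"
  proof (rule nn_integral_cong_AE)
    have "AE y in lborel. y \<noteq> (0::'a)" by (rule AE_lborel_singleton)
    then show "AE y in lborel. (\<integral>\<^sup>+t. ?k y t \<partial>lborel) = ennreal (1 / real m) * f y"
    proof eventually_elim
      case (elim y)
      have "(\<integral>\<^sup>+t. ?k y t \<partial>lborel) = (\<integral>\<^sup>+t. (ennreal (norm y ^ m / t ^ (m + 1)) * indicator {norm y..} t) * f y \<partial>lborel)"
      proof (rule nn_integral_cong)
        fix t
        have "norm y \<le> t \<Longrightarrow> 0 < t" using elim by (meson less_le_trans zero_less_norm_iff)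
        then show "?k y t = (ennreal (norm y ^ m / t ^ (m + 1)) * indicator {norm y..} t) * f y"
          using elim by (auto simp: indicator_def)
      qed
      also have "\<dots> = ennreal (1 / real m) * f y"
        by (subst nn_integral_multc) (use elim m nn_integral_power_atLeast[of "norm y" m] in simp_all)
      finally show ?case .
    qed
  qed
  also have "\<dots> = ennreal (1 / real m) * (\<integral>\<^sup>+y. f y \<partial>lborel)"
    by (rule nn_integral_cmult) measurable
  finally show ?thesis
    using m unfolding m_def[symmetric] by (simp add: mult.assoc[symmetric] ennreal_mult[symmetric])
qed

lemma emeasure_lborel_cball: "emeasure lborel (cball x r) = ennreal (measure lborel (cball x r))"
  for x :: "'a::euclidean_space"
  by (rule emeasure_eq_ennreal_measure) (use emeasure_lborel_cball_finite[of x r] in auto)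

lemma emeasure_sphere_measure_space:
  "emeasure sphere_measure (sphere (0::'a::euclidean_space) 1) = ennreal (real DIM('a) * measure lborel (cball (0::'a) 1))"
proof -
  have "emeasure sphere_measure (sphere (0::'a) 1) = (\<integral>\<^sup>+u. 1 \<partial>(sphere_measure :: 'a measure))"
    by simp
  also have "\<dots> = ennreal (real DIM('a)) * (\<integral>\<^sup>+x. indicator (cball 0 1 - {0}) (x::'a) \<partial>lborel)"
    by (subst nn_integral_sphere_measure) auto
  also have "(\<integral>\<^sup>+x. indicator (cball 0 1 - {0}) (x::'a) \<partial>lborel) = emeasure lborel (cball (0::'a) 1)"
    by (simp add: emeasure_Diff_null_set finite_imp_null_set_lborel)
  also note emeasure_lborel_cball
  finally show ?thesis by (simp add: ennreal_mult)
qed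

interpretation sphere_measure: finite_measure "sphere_measure :: 'a::euclidean_space measure"
  by standard (simp add: emeasure_sphere_measure_space)


lemma nn_integral_power_Icc:
  assumes "0 \<le> b"
  shows "(\<integral>\<^sup>+r. ennreal (r ^ k) * indicator {0..b} r \<partial>lborel) = ennreal (b ^ (k + 1) / real (k + 1))"
proof -
  have "(\<integral>\<^sup>+r. ennreal (r ^ k) * indicator {0..b} r \<partial>lborel) =
      ennreal (b ^ (k + 1) / real (k + 1) - 0 ^ (k + 1) / real (k + 1))"
  proof (rule nn_integral_FTC_Icc[where F = "\<lambda>r. r ^ (k + 1) / real (k + 1)"])
    show "((\<lambda>r. r ^ (k + 1) / real (k + 1)) has_real_derivative x ^ k) (at x)" for x
    proof -
      have "((\<lambda>r. r ^ (k + 1) / real (k + 1)) has_real_derivative (real (k + 1) * x ^ k / real (k + 1))) (at x)"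
        by (intro DERIV_cdivide) (use DERIV_pow[of "k + 1" x UNIV] in simp)
      then show ?thesis by simp
    qed
  qed (use assms in auto)
  then show ?thesis by simp
qed

text \<open>\<open>j\<close> is the degree along rays of \<open>f\<close> combined with the polar
  density, and \<open>w\<close> is the radial function of the region; on each ray the integral of
  \<open>r ^ j\<close> up to \<open>w u\<close> remains.\<close>

lemma nn_integral_star_region:
  fixes f :: "'a::euclidean_space \<Rightarrow> ennreal" and w :: "'a \<Rightarrow> real"
  assumes [measurable]: "f \<in> borel_measurable borel" "w \<in> borel_measurable borel"
    and f: "\<And>r u. 0 < r \<Longrightarrow> norm u = 1 \<Longrightarrow> ennreal (r ^ (DIM('a) - 1)) * f (r *\<^sub>R u) = ennreal (r ^ j) * f u"
    and w: "\<And>r u. 0 < r \<Longrightarrow> norm u = 1 \<Longrightarrow> w (r *\<^sub>R u) = w u" "\<And>u. norm u = 1 \<Longrightarrow> 0 \<le> w u"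
  shows "(\<integral>\<^sup>+x. f x * indicator {x. norm x \<le> w x} x \<partial>lborel) =
    (\<integral>\<^sup>+u. ennreal (w u ^ (j + 1) / real (j + 1)) * f u \<partial>sphere_measure)"
proof -
  let ?g = "\<lambda>r u. indicator {0<..} r * ennreal (r ^ (DIM('a) - 1)) *
    (f (r *\<^sub>R u) * indicator {x. norm x \<le> w x} (r *\<^sub>R u))"
  have "(\<integral>\<^sup>+x. f x * indicator {x. norm x \<le> w x} x \<partial>lborel) = (\<integral>\<^sup>+u. (\<integral>\<^sup>+r. ?g r u \<partial>lborel) \<partial>sphere_measure)"
    by (rule nn_integral_polar) measurable
  also have "\<dots> = (\<integral>\<^sup>+u. ennreal (w u ^ (j + 1) / real (j + 1)) * f u \<partial>sphere_measure)"
  proof (rule nn_integral_cong)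
    fix u :: 'a assume "u \<in> space sphere_measure"
    then have u: "norm u = 1" by simp
    have "(\<integral>\<^sup>+r. ?g r u \<partial>lborel) = (\<integral>\<^sup>+r. ennreal (r ^ j) * indicator {0..w u} r * f u \<partial>lborel)"
    proof (rule nn_integral_cong_AE)
      have "AE r in lborel. r \<noteq> (0::real)" by (rule AE_lborel_singleton)
      then show "AE r in lborel. ?g r u = ennreal (r ^ j) * indicator {0..w u} r * f u"
      proof eventually_elim
        case (elim r)
        show ?case
        proof (cases "0 < r")
          case True
          then show ?thesis using f[OF True u] w(1)[OF True u] u by (auto simp: indicator_def)
        qed (use elim in auto)
      qed
    qed
    also have "\<dots> = ennreal (w u ^ (j + 1) / real (j + 1)) * f u"
      by (subst nn_integral_multc) (use nn_integral_power_Icc[OF w(2)[OF u], of j] in simp_all)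
    finally show "(\<integral>\<^sup>+r. ?g r u \<partial>lborel) = ennreal (w u ^ (j + 1) / real (j + 1)) * f u" .
  qed
  finally show ?thesis .
qed

text \<open>Such a map only renames coordinates, so preimages of boxes are boxes with the same side
  lengths. It serves both the identification of C^n with a product and the change of index
  type.\<close>

lemma lborel_distr_basis_bij:
  fixes g :: "'a::euclidean_space \<Rightarrow> 'b::euclidean_space"
  assumes g: "linear g" and bij: "bij_betw g Basis Basis"
  shows "distr lborel borel g = lborel"
proof (rule lborel_eqI[symmetric])
  have inj: "inj_on g Basis" and im: "g ` Basis = Basis" using bij by (auto simp: bij_betw_def)
  have gm [measurable]: "g \<in> borel_measurable borel"
    using g by (intro borel_measurable_continuous_onI linear_continuous_on linear_conv_bounded_linear[THEN iffD1])
  have inner: "g x \<bullet> g b = x \<bullet> b" if b: "b \<in> Basis" for x b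
  proof -
    have "g x = g (\<Sum>c\<in>Basis. (x \<bullet> c) *\<^sub>R c)" by (simp add: euclidean_representation)
    also have "\<dots> = (\<Sum>c\<in>Basis. (x \<bullet> c) *\<^sub>R g c)" using g by (simp add: linear_sum linear_scale)
    finally have "g x \<bullet> g b = (\<Sum>c\<in>Basis. (x \<bullet> c) * (g c \<bullet> g b))" by (simp add: inner_sum_left)
    also have "\<dots> = (\<Sum>c\<in>Basis. if c = b then x \<bullet> c else 0)"
    proof (rule sum.cong[OF refl])
      fix c :: 'a assume c: "c \<in> Basis"
      have "g c \<in> Basis" "g b \<in> Basis" using im b c by auto
      then show "(x \<bullet> c) * (g c \<bullet> g b) = (if c = b then x \<bullet> c else 0)"
        using inj b c by (auto simp: inner_Basis inj_on_def)
    qed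
    finally show ?thesis using b by simp
  qed
  show "emeasure (distr lborel borel g) (box l u) = ennreal (\<Prod>b\<in>Basis. (u - l) \<bullet> b)"
    if le: "\<And>b. b \<in> Basis \<Longrightarrow> l \<bullet> b \<le> u \<bullet> b" for l u
  proof -
    define h where "h l = (\<Sum>b\<in>Basis. (l \<bullet> g b) *\<^sub>R b)" for l
    have h: "h l \<bullet> b = l \<bullet> g b" if "b \<in> Basis" for l b
      using that by (simp add: h_def inner_sum_left inner_Basis if_distrib cong: if_cong)
    have "x \<in> g -` box l u \<longleftrightarrow> x \<in> box (h l) (h u)" for x
    proof -
      have "x \<in> g -` box l u \<longleftrightarrow> (\<forall>b\<in>g ` Basis. l \<bullet> b < g x \<bullet> b \<and> g x \<bullet> b < u \<bullet> b)"
        unfolding im by (simp add: mem_box)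
      also have "\<dots> \<longleftrightarrow> (\<forall>b\<in>Basis. l \<bullet> g b < g x \<bullet> g b \<and> g x \<bullet> g b < u \<bullet> g b)" by simp
      finally show ?thesis by (simp add: mem_box h inner)
    qed
    then have "g -` box l u = box (h l) (h u)" by blast
    then have "emeasure (distr lborel borel g) (box l u) = emeasure lborel (box (h l) (h u))"
      by (simp add: emeasure_distr)
    also have "\<dots> = ennreal (\<Prod>b\<in>Basis. (h u - h l) \<bullet> b)"
      by (rule emeasure_lborel_box) (use h le im in \<open>metis imageI\<close>)
    also have "(\<Prod>b\<in>Basis. (h u - h l) \<bullet> b) = (\<Prod>b\<in>Basis. (u - l) \<bullet> g b)"
      by (intro prod.cong) (auto simp: inner_diff_left h)
    also have "\<dots> = (\<Prod>b\<in>Basis. (u - l) \<bullet> b)"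
      using prod.reindex_bij_betw[OF bij, of "\<lambda>b. (u - l) \<bullet> b"] .
    finally show ?thesis .
  qed
qed simp

section \<open>Lebesgue measure on C^n, and spheres in C^n and R^n\<close>

definition complex_vec :: "(real^'n) \<times> (real^'n) \<Rightarrow> complex^'n" where
  "complex_vec p = (\<chi> i. Complex (fst p $ i) (snd p $ i))"

lemma linear_complex_vec: "linear complex_vec"
  by (auto intro!: linearI simp: complex_vec_def vec_eq_iff complex_eq_iff)

lemma Re_vec_complex_vec [simp]: "Re_vec (complex_vec p) = fst p"
  by (simp add: Re_vec_def complex_vec_def vec_eq_iff)

lemma norm_complex_vec: "(norm (complex_vec p))\<^sup>2 = (norm (fst p))\<^sup>2 + (norm (snd p))\<^sup>2"
proof -
  have "(norm (complex_vec p))\<^sup>2 = (\<Sum>i\<in>UNIV. (norm (complex_vec p $ i))\<^sup>2)"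
    by (simp add: norm_vec_def L2_set_def sum_nonneg)
  also have "\<dots> = (\<Sum>i\<in>UNIV. (fst p $ i)\<^sup>2 + (snd p $ i)\<^sup>2)"
    by (intro sum.cong) (simp_all add: complex_vec_def cmod_def)
  finally show ?thesis
    by (simp add: norm_vec_def L2_set_def sum_nonneg sum.distrib)
qed

lemma bij_betw_complex_vec_Basis:
  "bij_betw (complex_vec :: (real^'n) \<times> (real^'n) \<Rightarrow> complex^'n) Basis Basis"
proof -
  have e1: "complex_vec (axis i 1, 0) = axis i 1" and e2: "complex_vec (0, axis i 1) = axis i \<i>" for i :: 'n
    by (auto simp: complex_vec_def vec_eq_iff axis_def complex_eq_iff)
  have "inj_on complex_vec (Basis :: ((real^'n) \<times> (real^'n)) set)"
    by (auto simp: inj_on_def complex_vec_def vec_eq_iff)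
  moreover have "complex_vec ` (Basis :: ((real^'n) \<times> (real^'n)) set) = Basis"
    by (simp add: Basis_prod_def Basis_vec_def Basis_complex_def image_Un image_UN e1 e2) blast
  ultimately show ?thesis by (simp add: bij_betw_def)
qed

lemma borel_measurable_Re_vec [measurable]: "Re_vec \<in> borel_measurable borel"
  unfolding Re_vec_def by (intro borel_measurable_continuous_onI continuous_intros)

lemma nn_integral_lborel_complex_vec:
  fixes H :: "complex^'n \<Rightarrow> ennreal"
  assumes [measurable]: "H \<in> borel_measurable borel"
  shows "(\<integral>\<^sup>+z. H z \<partial>lborel) = (\<integral>\<^sup>+y. (\<integral>\<^sup>+x. H (complex_vec (x, y)) \<partial>lborel) \<partial>lborel)"
proof -
  have [measurable]: "complex_vec \<in> borel_measurable (borel :: ((real^'n) \<times> (real^'n)) measure)"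
    by (intro borel_measurable_continuous_onI linear_continuous_on
        linear_conv_bounded_linear[THEN iffD1] linear_complex_vec)
  have "(\<integral>\<^sup>+z. H z \<partial>lborel) = (\<integral>\<^sup>+z. H z \<partial>(distr lborel borel complex_vec))"
    by (simp only: lborel_distr_basis_bij[OF linear_complex_vec bij_betw_complex_vec_Basis])
  also have "\<dots> = (\<integral>\<^sup>+p. H (complex_vec p) \<partial>(lborel \<Otimes>\<^sub>M lborel))"
    by (simp add: nn_integral_distr lborel_prod)
  also have "\<dots> = (\<integral>\<^sup>+y. (\<integral>\<^sup>+x. H (complex_vec (x, y)) \<partial>lborel) \<partial>lborel)"
    by (rule lborel_pair.nn_integral_snd[symmetric]) (simp add: lborel_prod)
  finally show ?thesis .
qed

text \<open>Evaluates the integral of \<open>F (Re z)\<close> over the unit ball of \<open>\<complex>\<^sup>n\<close> twice: in the polar coordinates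
  of \<open>\<complex>\<^sup>n\<close>, and in those of \<open>\<real>\<^sup>n\<close> for the real part. The hypothesis says that \<open>F\<close> is homogeneous of
  degree \<open>2 - n\<close>.\<close>

lemma nn_integral_sphere_Re_vec:
  fixes F :: "real^'n \<Rightarrow> ennreal"
  assumes [measurable]: "F \<in> borel_measurable borel"
    and hom: "\<And>r x. 0 < r \<Longrightarrow> ennreal (r ^ CARD('n)) * F (r *\<^sub>R x) = ennreal (r\<^sup>2) * F x"
  shows "(\<integral>\<^sup>+u. F (Re_vec u) \<partial>(sphere_measure :: (complex^'n) measure)) =
    ennreal (measure lborel (cball (0::real^'n) 1)) * (\<integral>\<^sup>+u. F u \<partial>sphere_measure)"
proof -
  define n where "n = CARD('n)"
  have n: "0 < n" by (simp add: n_def)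
  let ?\<kappa> = "measure lborel (cball (0::real^'n) 1)"
  let ?IC = "\<integral>\<^sup>+u. F (Re_vec u) \<partial>(sphere_measure :: (complex^'n) measure)"
  let ?IR = "\<integral>\<^sup>+u. F u \<partial>sphere_measure"
  have pw: "x ^ n = x * x ^ (n - 1)" for x :: real using n by (simp add: power_eq_if)
  have homF: "ennreal (r ^ (n - 1)) * F (r *\<^sub>R x) = ennreal r * F x" if r: "0 < r" for r x
  proof -
    have "ennreal (r ^ (n - 1)) * F (r *\<^sub>R x) = ennreal (1 / r) * (ennreal (r ^ n) * F (r *\<^sub>R x))"
      using r by (simp add: mult.assoc[symmetric] ennreal_mult[symmetric] pw)
    also have "\<dots> = ennreal (1 / r) * (ennreal (r\<^sup>2) * F x)" using hom[OF r] by (simp add: n_def)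
    also have "\<dots> = ennreal r * F x"
      using r by (simp add: mult.assoc[symmetric] ennreal_mult[symmetric] power2_eq_square)
    finally show ?thesis .
  qed
  define I where "I = (\<integral>\<^sup>+z. F (Re_vec z) * indicator {z. norm z \<le> 1} z \<partial>(lborel :: (complex^'n) measure))"
  \<comment> \<open>Along rays of C^n the measure contributes degree 2n - 1 and \<open>F\<close>
    contributes 2 - n. The sum n + 1 is the \<open>j\<close> of
    \<open>nn_integral_star_region\<close>.\<close>
  have I1: "I = ennreal (1 / (n + 2)) * ?IC"
  proof -
    have "I = (\<integral>\<^sup>+u. ennreal (1 ^ (n + 1 + 1) / real (n + 1 + 1)) * F (Re_vec u) \<partial>(sphere_measure :: (complex^'n) measure))"
      unfolding I_def
    proof (rule nn_integral_star_region)
      fix r :: real and u :: "complex^'n" assume r: "0 < r"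
      have "DIM(complex^'n) - 1 = n + (n - 1)" using n by (simp add: n_def)
      then have "ennreal (r ^ (DIM(complex^'n) - 1)) * F (Re_vec (r *\<^sub>R u)) =
          ennreal (r ^ n) * (ennreal (r ^ (n - 1)) * F (r *\<^sub>R Re_vec u))"
        using r by (simp add: power_add ennreal_mult mult.assoc Re_vec_def scaleR_vec_def)
      also have "\<dots> = ennreal (r ^ n * r) * F (Re_vec u)"
        by (simp only: homF[OF r]) (use r in \<open>simp add: ennreal_mult mult.assoc\<close>)
      finally show "ennreal (r ^ (DIM(complex^'n) - 1)) * F (Re_vec (r *\<^sub>R u)) = ennreal (r ^ (n + 1)) * F (Re_vec u)"
        by (simp add: mult.commute)
    qed auto
    also have "\<dots> = ennreal (1 / (n + 2)) * ?IC"
      by (subst nn_integral_cmult) (auto intro: measurable_sphere_measure simp: algebra_simps)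
    finally show ?thesis .
  qed
  have I2: "I = ennreal (?\<kappa> / (n + 2)) * ?IR"
  proof -
    let ?w = "\<lambda>y::real^'n. ennreal ((1 - (norm y)\<^sup>2) / 2) * indicator {y. norm y \<le> 1} y"
    have "I = (\<integral>\<^sup>+y. (\<integral>\<^sup>+x. F x * indicator {z. norm z \<le> 1} (complex_vec (x, y)) \<partial>lborel) \<partial>lborel)"
      unfolding I_def by (subst nn_integral_lborel_complex_vec) (auto intro!: measurable_compose[OF borel_measurable_Re_vec])
    also have "\<dots> = (\<integral>\<^sup>+y. ?w y * ?IR \<partial>lborel)"
    proof (rule nn_integral_cong)
      fix y :: "real^'n"
      show "(\<integral>\<^sup>+x. F x * indicator {z. norm z \<le> 1} (complex_vec (x, y)) \<partial>lborel) = ?w y * ?IR"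
      proof (cases "norm y \<le> 1")
        case True
        then have y1: "(norm y)\<^sup>2 \<le> 1" by (simp add: abs_square_le_1)
        \<comment> \<open>The slice over the imaginary part \<open>y\<close> is a ball of radius
          \<open>b\<close>. On rays of R^n the degrees n - 1 and 2 - n add up to 1, hence the factor
          b^2 / 2.\<close>
        define b where "b = sqrt (1 - (norm y)\<^sup>2)"
        have b: "0 \<le> b" "b\<^sup>2 = 1 - (norm y)\<^sup>2" using y1 by (auto simp: b_def)
        have "norm (complex_vec (x, y)) \<le> 1 \<longleftrightarrow> norm x \<le> b" for x
        proof -
          have "norm (complex_vec (x, y)) \<le> 1 \<longleftrightarrow> (norm (complex_vec (x, y)))\<^sup>2 \<le> 1"
            by (simp add: abs_square_le_1)
          also have "\<dots> \<longleftrightarrow> (norm x)\<^sup>2 \<le> b\<^sup>2" by (auto simp: norm_complex_vec b(2))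
          finally show ?thesis using abs_le_square_iff[of "norm x" b] b(1) by simp
        qed
        then have "(\<integral>\<^sup>+x. F x * indicator {z. norm z \<le> 1} (complex_vec (x, y)) \<partial>lborel) =
            (\<integral>\<^sup>+x. F x * indicator {x. norm x \<le> b} x \<partial>lborel)"
          by (simp add: indicator_def)
        also have "\<dots> = (\<integral>\<^sup>+u. ennreal (b ^ (1 + 1) / real (1 + 1)) * F u \<partial>sphere_measure)"
          by (rule nn_integral_star_region) (use homF b(1) in \<open>auto simp: n_def\<close>)
        also have "\<dots> = ennreal (b\<^sup>2 / 2) * ?IR"
          by (subst nn_integral_cmult) (auto intro: measurable_sphere_measure simp: power2_eq_square)
        finally show ?thesis using True by (simp add: b(2))
      next
        case False
        have "(norm y)\<^sup>2 \<le> (norm (complex_vec (x, y)))\<^sup>2" for x by (simp add: norm_complex_vec)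
        then have "norm y \<le> norm (complex_vec (x, y))" for x using power2_le_imp_le norm_ge_zero by blast
        then have "\<not> norm (complex_vec (x, y)) \<le> 1" for x using False by (meson order_trans)
        then show ?thesis using False by (simp add: indicator_def)
      qed
    qed
    also have "\<dots> = (\<integral>\<^sup>+y. ?w y \<partial>lborel) * ?IR"
      by (rule nn_integral_multc) measurable
    \<comment> \<open>Adding the integral of |y|^2 / 2, which polar coordinates evaluate, completes
      the integrand to the constant 1/2. The finite summand is then cancelled, which avoids the
      truncated subtraction of \<open>ennreal\<close>.\<close>
    also have "(\<integral>\<^sup>+y. ?w y \<partial>lborel) = ennreal (?\<kappa> / (n + 2))"
    proof -
      have "(\<integral>\<^sup>+y. ennreal ((norm y)\<^sup>2 / 2) * indicator {y::real^'n. norm y \<le> 1} y \<partial>lborel) =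
          (\<integral>\<^sup>+u. ennreal (1 ^ (n + 1 + 1) / real (n + 1 + 1)) * ennreal ((norm u)\<^sup>2 / 2) \<partial>(sphere_measure :: (real^'n) measure))"
      proof (rule nn_integral_star_region)
        fix r :: real and u :: "real^'n" assume r: "0 < r"
        have "n - 1 + 2 = n + 1" using n by simp
        then have "r ^ (n - 1) * r\<^sup>2 = r ^ (n + 1)" by (metis power_add)
        then have "r ^ (n - 1) * ((norm (r *\<^sub>R u))\<^sup>2 / 2) = r ^ (n + 1) * ((norm u)\<^sup>2 / 2)"
          by (simp add: power_mult_distrib mult.assoc[symmetric])
        then show "ennreal (r ^ (DIM(real^'n) - 1)) * ennreal ((norm (r *\<^sub>R u))\<^sup>2 / 2) = ennreal (r ^ (n + 1)) * ennreal ((norm u)\<^sup>2 / 2)"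
          using r by (simp add: n_def ennreal_mult[symmetric] del: norm_scaleR)
      qed auto
      also have "\<dots> = (\<integral>\<^sup>+u. ennreal (1 / (2 * (real n + 2))) \<partial>(sphere_measure :: (real^'n) measure))"
        by (rule nn_integral_cong, subst ennreal_mult[symmetric]) (auto simp: field_simps)
      also have "\<dots> = ennreal (n * ?\<kappa> / (2 * (real n + 2)))"
        by (simp add: emeasure_sphere_measure_space n_def ennreal_mult[symmetric])
      finally have sq: "(\<integral>\<^sup>+y. ennreal ((norm y)\<^sup>2 / 2) * indicator {y::real^'n. norm y \<le> 1} y \<partial>lborel) =
          ennreal (n * ?\<kappa> / (2 * (real n + 2)))" .
      have "(\<integral>\<^sup>+y. ?w y \<partial>lborel) + ennreal (n * ?\<kappa> / (2 * (real n + 2))) =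
          (\<integral>\<^sup>+y. ?w y + ennreal ((norm y)\<^sup>2 / 2) * indicator {y::real^'n. norm y \<le> 1} y \<partial>lborel)"
        unfolding sq[symmetric] by (rule nn_integral_add[symmetric]) measurable
      also have "\<dots> = (\<integral>\<^sup>+y. ennreal (1 / 2) * indicator (cball 0 1) y \<partial>(lborel :: (real^'n) measure))"
      proof (rule nn_integral_cong)
        fix y :: "real^'n"
        have "ennreal ((1 - (norm y)\<^sup>2) / 2) + ennreal ((norm y)\<^sup>2 / 2) = ennreal (1 / 2)" if "norm y \<le> 1"
          using that by (subst ennreal_plus[symmetric]) (auto simp: abs_square_le_1 diff_divide_distrib)
        then show "?w y + ennreal ((norm y)\<^sup>2 / 2) * indicator {y. norm y \<le> 1} y = ennreal (1 / 2) * indicator (cball 0 1) y"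
          by (simp add: indicator_def)
      qed
      also have "\<dots> = ennreal (1 / 2) * ennreal ?\<kappa>"
        by (subst nn_integral_cmult_indicator) (auto simp: emeasure_lborel_cball)
      also have "\<dots> = ennreal (?\<kappa> / (n + 2) + n * ?\<kappa> / (2 * (real n + 2)))"
      proof -
        have "1 / 2 * k = k / a + (a - 2) * k / (2 * a)" if "0 < a" for a k :: real
          using that by (simp add: field_simps)
        from this[of "real n + 2"] have "1 / 2 * k = k / (n + 2) + n * k / (2 * (real n + 2))" for k :: real
          by (simp add: add.commute)
        then show ?thesis by (subst ennreal_mult[symmetric]) (simp_all only: measure_nonneg zero_le_divide_1_iff zero_le_numeral)
      qed
      also have "\<dots> = ennreal (?\<kappa> / (n + 2)) + ennreal (n * ?\<kappa> / (2 * (real n + 2)))"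
        by (rule ennreal_plus) auto
      finally show ?thesis
        by (simp only: add.commute[of _ "ennreal (n * ?\<kappa> / (2 * (real n + 2)))"] ennreal_add_left_cancel) simp
    qed
    finally show ?thesis .
  qed
  have e: "ennreal (real (n + 2)) * (ennreal (x / real (n + 2)) * y) = ennreal x * y" if "0 \<le> x" for x y
  proof -
    have "ennreal (real (n + 2)) * ennreal (x / real (n + 2)) = ennreal (real (n + 2) * (x / real (n + 2)))"
      using that by (intro ennreal_mult[symmetric]) auto
    then show ?thesis by (simp add: mult.assoc[symmetric])
  qed
  have "ennreal (real (n + 2)) * I = ?IC" unfolding I1 using e[of 1] by simp
  moreover have "ennreal (real (n + 2)) * I = ennreal ?\<kappa> * ?IR" unfolding I2 by (rule e) simp
  ultimately show ?thesis by simp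
qed

section \<open>Change of variables\<close>

text \<open>The change of variables theorem of HOL-Analysis requires a well-ordered index type.
  \<open>'n idx\<close> is such a copy of the index type.\<close>

typedef ('n::finite) idx = "{..<CARD('n)}"
  by (rule exI[of _ 0]) simp

instance idx :: (finite) finite
proof
  have "bij_betw Rep_idx (UNIV :: 'a idx set) {..<CARD('a)}"
    by (rule bij_betwI[where g = Abs_idx]) (auto simp: Rep_idx Rep_idx_inverse Abs_idx_inverse Rep_idx[simplified])
  then show "finite (UNIV :: 'a idx set)" using bij_betw_finite by blast
qed

instantiation idx :: (finite) wellorder
begin

definition less_eq_idx :: "'a idx \<Rightarrow> 'a idx \<Rightarrow> bool" where "less_eq_idx x y \<longleftrightarrow> Rep_idx x \<le> Rep_idx y"
definition less_idx :: "'a idx \<Rightarrow> 'a idx \<Rightarrow> bool" where "less_idx x y \<longleftrightarrow> Rep_idx x < Rep_idx y"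

instance
proof
  fix P :: "'a idx \<Rightarrow> bool" and a :: "'a idx"
  assume step: "\<And>x. (\<And>y. y < x \<Longrightarrow> P y) \<Longrightarrow> P x"
  show "P a"
  proof (induction "Rep_idx a" arbitrary: a rule: less_induct)
    case less
    show ?case by (rule step, rule less) (simp add: less_idx_def)
  qed
qed (auto simp: less_eq_idx_def less_idx_def Rep_idx_inject)

end

lemma ex_bij_idx: "\<exists>e :: 'n::finite idx \<Rightarrow> 'n. bij e"
proof -
  have "bij_betw Rep_idx (UNIV :: 'n idx set) {..<CARD('n)}"
    by (rule bij_betwI[where g = Abs_idx]) (auto simp: Rep_idx Rep_idx_inverse Abs_idx_inverse Rep_idx[simplified])
  then have "CARD('n idx) = CARD('n)" by (simp add: bij_betw_same_card)
  then show ?thesis by (intro finite_same_card_bij) auto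
qed

text \<open>Rows and columns are renamed by the same bijection, and conjugation preserves the sign
  of a permutation.\<close>

lemma det_reindex:
  fixes A :: "real^'n^'n" and e :: "'m::finite \<Rightarrow> 'n::finite"
  assumes e: "bij e"
  shows "det (\<chi> i j. A $ e i $ e j) = det A"
proof -
  have inj: "inj e" and im: "e ` UNIV = UNIV" using e by (auto simp: bij_def)
  let ?g = "\<lambda>p. map_permutation UNIV e p"
  have gp: "?g p permutes UNIV" if "p permutes UNIV" for p
    by (rule map_permutation_permutes) (use e that in auto)
  have app: "?g p (e i) = e (p i)" if "p permutes UNIV" for p i
    by (rule map_permutation_apply) (use inj in auto)
  have b: "bij_betw ?g {p. p permutes UNIV} {p. p permutes UNIV}"
  proof (rule bij_betwI[where g = "map_permutation UNIV (inv e)"])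
    show "?g \<in> {p. p permutes UNIV} \<rightarrow> {p. p permutes UNIV}" using gp by auto
    show "map_permutation UNIV (inv e) \<in> {p. p permutes UNIV} \<rightarrow> {p. p permutes UNIV}"
      by (auto intro!: map_permutation_permutes bij_imp_bij_inv e)
    show "map_permutation UNIV (inv e) (?g p) = p" if "p \<in> {p. p permutes UNIV}" for p
      using that e im by (intro map_permutation_compose_inv) (auto simp: bij_is_inj bij_imp_bij_inv)
    show "?g (map_permutation UNIV (inv e) q) = q" if "q \<in> {p. p permutes UNIV}" for q
      using that e im by (intro map_permutation_compose_inv) (auto simp: bij_is_surj surj_f_inv_f bij_imp_bij_inv)
  qed
  have "det A = (\<Sum>p | p permutes UNIV. of_int (sign (?g p)) * (\<Prod>i\<in>UNIV. A $ i $ ?g p i))"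
    unfolding det_def by (rule sum.reindex_bij_betw[OF b, symmetric])
  also have "\<dots> = (\<Sum>p | p permutes UNIV. of_int (sign p) * (\<Prod>i\<in>UNIV. A $ e i $ e (p i)))"
  proof (rule sum.cong[OF refl])
    fix p :: "'m \<Rightarrow> 'm" assume "p \<in> {p. p permutes UNIV}"
    then have p: "p permutes UNIV" by simp
    have "(\<Prod>i\<in>UNIV. A $ i $ ?g p i) = (\<Prod>i\<in>UNIV. A $ e i $ ?g p (e i))"
      using e by (intro prod.reindex_bij_betw[symmetric]) auto
    moreover have "sign (?g p) = sign p"
      using p inj by (intro sign_map_permutation) auto
    ultimately show "of_int (sign (?g p)) * (\<Prod>i\<in>UNIV. A $ i $ ?g p i) =
      of_int (sign p) * (\<Prod>i\<in>UNIV. A $ e i $ e (p i))" by (simp add: app[OF p])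
  qed
  finally show ?thesis by (simp add: det_def)
qed

lemma lebesgue_distr_basis_bij:
  fixes g :: "'a::euclidean_space \<Rightarrow> 'b::euclidean_space"
  assumes g: "linear g" and bij: "bij_betw g Basis Basis"
  shows "g \<in> lebesgue \<rightarrow>\<^sub>M lebesgue" and "distr lebesgue lebesgue g = lebesgue"
proof -
  have gb: "g \<in> borel_measurable borel"
    using g by (intro borel_measurable_continuous_onI linear_continuous_on linear_conv_bounded_linear[THEN iffD1])
  then have gl: "g \<in> lborel \<rightarrow>\<^sub>M lborel" by simp
  then have gc: "g \<in> lebesgue \<rightarrow>\<^sub>M lborel" by (rule measurable_completion)
  have "distr lborel lborel g = lborel"
    using lborel_distr_basis_bij[OF g bij] by (simp cong: distr_cong)
  then have d: "distr lebesgue lborel g = lborel"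
    by (simp add: distr_completion[OF gl])
  show "g \<in> lebesgue \<rightarrow>\<^sub>M lebesgue"
    by (rule completion.measurable_completion2[OF gc]) (simp add: d)
  show "distr lebesgue lebesgue g = lebesgue"
    using completion.completion_distr_eq[OF gc] by (simp add: d)
qed

text \<open>The theorem is applied to \<open>g\<close>, which is \<open>f\<close> conjugated by the
  coordinate relabelling \<open>P\<close> with inverse \<open>Q\<close>; the relabelling preserves
  both Lebesgue measure and the Jacobian determinant.\<close>

proposition measure_differentiable_image_lborel:
  fixes f :: "real^'n::finite \<Rightarrow> real^'n"
  assumes S: "S \<in> sets borel"
    and der: "\<And>x. x \<in> S \<Longrightarrow> (f has_derivative f' x) (at x)"
    and inj: "inj_on f S"
    and int: "set_integrable lborel S (\<lambda>x. \<bar>det (matrix (f' x))\<bar>)"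
  shows "f ` S \<in> lmeasurable"
    and "measure lebesgue (f ` S) = (LINT x:S|lborel. \<bar>det (matrix (f' x))\<bar>)"
proof -
  obtain e :: "'n idx \<Rightarrow> 'n" where e: "bij e" using ex_bij_idx by blast
  define P :: "real^'n \<Rightarrow> real^'n idx" where "P x = (\<chi> i. x $ e i)" for x
  define Q :: "real^'n idx \<Rightarrow> real^'n" where "Q y = (\<chi> j. y $ inv e j)" for y
  have ie: "inv e (e i) = i" "e (inv e j) = j" for i j
    using e by (simp_all add: bij_is_inj bij_is_surj surj_f_inv_f)
  have PQ: "P (Q y) = y" and QP: "Q (P x) = x" for x y by (simp_all add: P_def Q_def ie vec_eq_iff)
  have linP: "linear P" and linQ: "linear Q"
    by (auto intro!: linearI simp: P_def Q_def vec_eq_iff)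
  have Pa: "P (axis j c) = axis (inv e j) c" and Qa: "Q (axis i c) = axis (e i) c" for i j c
    by (auto simp: P_def Q_def axis_def vec_eq_iff ie)
  have bP: "bij_betw P Basis Basis" and bQ: "bij_betw Q Basis Basis"
    by (rule bij_betwI[where g = Q], (auto simp: Basis_vec_def Pa Qa PQ QP)[4])
       (rule bij_betwI[where g = P], (auto simp: Basis_vec_def Pa Qa PQ QP)[4])
  have cP: "continuous_on UNIV P" and cQ: "continuous_on UNIV Q"
    using linP linQ by (simp_all add: linear_continuous_on linear_conv_bounded_linear)
  have Qm: "Q \<in> borel_measurable borel" using cQ by (rule borel_measurable_continuous_onI)
  define S' where "S' = Q -` S"
  have S': "S' \<in> sets borel"
    using measurable_sets[OF Qm S] by (simp add: S'_def)
  define g where "g y = P (f (Q y))" for y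
  define g' where "g' y v = P (f' (Q y) (Q v))" for y v
  have derg: "(g has_derivative g' y) (at y within S')" if "y \<in> S'" for y
  proof -
    have "((\<lambda>y. f (Q y)) has_derivative (\<lambda>v. f' (Q y) (Q v))) (at y)"
      using diff_chain_at[OF linear_imp_has_derivative[OF linQ] der] that by (simp add: S'_def o_def)
    then have "(g has_derivative g' y) (at y)"
      using diff_chain_at[OF _ linear_imp_has_derivative[OF linP]] by (simp add: g_def[abs_def] g'_def[abs_def] o_def)
    then show ?thesis by (rule has_derivative_at_withinI)
  qed
  have injg: "inj_on g S'"
  proof (rule inj_onI)
    fix y z assume *: "y \<in> S'" "z \<in> S'" "g y = g z"
    then have "f (Q y) = f (Q z)" unfolding g_def by (metis QP)
    then have "Q y = Q z" using * inj by (auto simp: inj_on_def S'_def)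
    then show "y = z" by (metis PQ)
  qed
  have detg: "det (matrix (g' y)) = det (matrix (f' (Q y)))" for y
  proof -
    have "matrix (g' y) = (\<chi> i j. matrix (f' (Q y)) $ e i $ e j)"
      by (simp add: matrix_def g'_def P_def Qa vec_eq_iff)
    then show ?thesis by (simp add: det_reindex[OF e])
  qed
  let ?J = "\<lambda>x. \<bar>det (matrix (f' x))\<bar>"
  have dQ: "distr lborel borel Q = lborel" by (rule lborel_distr_basis_bij[OF linQ bQ])
  have im: "(\<lambda>x. indicator S x *\<^sub>R ?J x) \<in> borel_measurable borel"
    using int by (auto simp: set_integrable_def)
  have int': "set_integrable lborel S' (\<lambda>y. \<bar>det (matrix (g' y))\<bar>)"
  proof -
    have "integrable (distr lborel borel Q) (\<lambda>x. indicator S x *\<^sub>R ?J x)"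
      unfolding dQ using int by (simp add: set_integrable_def)
    then have "integrable lborel (\<lambda>y. indicator S (Q y) *\<^sub>R ?J (Q y))"
      by (subst (asm) integrable_distr_eq) (use Qm im in auto)
    then show ?thesis by (simp add: set_integrable_def detg S'_def indicator_def vimage_def)
  qed
  have eqint: "(LINT y:S'|lborel. \<bar>det (matrix (g' y))\<bar>) = (LINT x:S|lborel. ?J x)"
  proof -
    have "(LINT x:S|lborel. ?J x) = (LINT x|distr lborel borel Q. indicator S x *\<^sub>R ?J x)"
      unfolding dQ by (simp add: set_lebesgue_integral_def)
    also have "\<dots> = (LINT y|lborel. indicator S (Q y) *\<^sub>R ?J (Q y))"
      by (rule integral_distr) (use Qm im in auto)
    finally show ?thesis by (simp add: set_lebesgue_integral_def detg S'_def indicator_def vimage_def)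
  qed
  have "((\<lambda>y. \<bar>det (matrix (g' y))\<bar>) has_integral (LINT x:S|lborel. ?J x)) S'"
    using set_borel_integral_eq_integral[OF int'] eqint by (simp add: has_integral_iff)
  then have T: "g ` S' \<in> lmeasurable" "measure lebesgue (g ` S') = (LINT x:S|lborel. ?J x)"
    using has_measure_differentiable_image[OF _ derg injg] S' by auto
  have fS: "f ` S = P -` (g ` S')"
  proof -
    have "P -` (g ` S') = Q ` (g ` S')" using PQ QP by (auto simp: image_iff) metis+
    also have "\<dots> = f ` (Q ` S')" by (simp add: g_def QP image_image)
    also have "Q ` S' = S" using PQ QP by (auto simp: S'_def image_iff) metis
    finally show ?thesis by simp
  qed
  have e: "emeasure lebesgue (f ` S) = emeasure lebesgue (g ` S')"
  proof -
    have "emeasure lebesgue (g ` S') = emeasure (distr lebesgue lebesgue P) (g ` S')"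
      by (simp only: lebesgue_distr_basis_bij(2)[OF linP bP])
    also have "\<dots> = emeasure lebesgue (P -` (g ` S') \<inter> space lebesgue)"
      using T(1) by (intro emeasure_distr lebesgue_distr_basis_bij(1)[OF linP bP]) (auto simp: fmeasurable_def)
    finally show ?thesis by (simp add: fS)
  qed
  have "f ` S \<in> sets lebesgue"
    using measurable_sets[OF lebesgue_distr_basis_bij(1)[OF linP bP], of "g ` S'"] T(1)
    by (auto simp: fS fmeasurable_def)
  then show "f ` S \<in> lmeasurable" using T(1) unfolding fmeasurable_def mem_Collect_eq e by blast
  show "measure lebesgue (f ` S) = (LINT x:S|lborel. ?J x)"
    using T(2) unfolding measure_def e .
qed

lemma borel_measurable_continuous_on_punctured:
  fixes f :: "'a::euclidean_space \<Rightarrow> 'b::euclidean_space"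
  assumes "continuous_on (-{0}) f"
  shows "f \<in> borel_measurable borel"
proof -
  have "(\<lambda>x. indicator (-{0}) x *\<^sub>R f x) \<in> borel_measurable borel"
    by (rule borel_measurable_continuous_on_indicator[OF _ assms]) auto
  moreover have "(\<lambda>x::'a. indicator {0} x *\<^sub>R f 0) \<in> borel_measurable borel"
    by (intro borel_measurable_scaleR borel_measurable_indicator borel_measurable_const) auto
  ultimately have "(\<lambda>x. indicator (-{0}) x *\<^sub>R f x + indicator {0} x *\<^sub>R f 0) \<in> borel_measurable borel"
    by (rule borel_measurable_add)
  also have "(\<lambda>x. indicator (-{0}) x *\<^sub>R f x + indicator {0} x *\<^sub>R f 0) = f"
    by (auto simp: indicator_def fun_eq_iff)
  finally show ?thesis .
qed

lemma integrable_sphere_measure: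
  fixes f :: "'a::euclidean_space \<Rightarrow> real"
  assumes c: "continuous_on (-{0}) f"
  shows "integrable sphere_measure f"
proof -
  have "compact (f ` sphere 0 1)"
    by (intro compact_continuous_image continuous_on_subset[OF c]) auto
  then obtain B where "\<forall>y\<in>f ` sphere 0 1. norm y \<le> B"
    using compact_imp_bounded bounded_iff by blast
  then have B: "norm (f x) \<le> B" if "x \<in> sphere 0 1" for x
    using that by blast
  show ?thesis
    by (rule sphere_measure.integrable_const_bound[of _ B])
       (auto intro!: AE_I2 measurable_sphere_measure borel_measurable_continuous_on_punctured c B[simplified])
qed

text \<open>\<open>D\<close> and \<open>w\<close> are constant along rays, so the radial degree is
  that of the volume element alone. \<open>D\<close> will be the Jacobian of the polar map, and the
  integral the volume of the image of \<open>U\<close>.\<close>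

lemma set_integral_star_region:
  fixes D w :: "'a::euclidean_space \<Rightarrow> real"
  assumes D: "continuous_on (-{0}) D" "\<And>x. x \<noteq> 0 \<Longrightarrow> D (sgn x) = D x" "\<And>x. x \<noteq> 0 \<Longrightarrow> 0 \<le> D x"
    and w: "continuous_on (-{0}) w" "\<And>x. x \<noteq> 0 \<Longrightarrow> w (sgn x) = w x" "\<And>x. x \<noteq> 0 \<Longrightarrow> 0 < w x"
  defines "U \<equiv> {x. x \<noteq> 0 \<and> norm x \<le> w x}"
  shows "U \<in> sets borel" and "set_integrable lborel U D"
    and "(LINT x:U|lborel. D x) = (LINT u|sphere_measure. w u ^ DIM('a) * D u) / DIM('a)"
proof -
  note [measurable] = borel_measurable_continuous_on_punctured[OF D(1)]
    borel_measurable_continuous_on_punctured[OF w(1)]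
  define m where "m = DIM('a)"
  have m: "0 < m" by (simp add: m_def)
  show U [measurable]: "U \<in> sets borel"
    unfolding U_def by measurable
  have hom: "D (r *\<^sub>R u) = D u \<and> w (r *\<^sub>R u) = w u" if "0 < r" "norm u = 1" for r u
  proof -
    have "sgn (r *\<^sub>R u) = u" "r *\<^sub>R u \<noteq> 0" using that by (auto simp: sgn_div_norm)
    then show ?thesis using D(2)[of "r *\<^sub>R u"] w(2)[of "r *\<^sub>R u"] by simp
  qed
  have "(\<integral>\<^sup>+x. ennreal (indicator U x *\<^sub>R D x) \<partial>lborel) = (\<integral>\<^sup>+x. ennreal (D x) * indicator {x. norm x \<le> w x} x \<partial>lborel)"
    by (rule nn_integral_cong_AE, rule eventually_mono[OF AE_lborel_singleton[of 0]])
       (auto simp: U_def indicator_def)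
  also have "\<dots> = (\<integral>\<^sup>+u. ennreal (w u ^ (m - 1 + 1) / real (m - 1 + 1)) * ennreal (D u) \<partial>sphere_measure)"
  proof (rule nn_integral_star_region)
    show "0 \<le> w u" if "norm u = 1" for u using w(3)[of u] that by force
  qed (use hom in \<open>auto simp: m_def\<close>)
  also have "\<dots> = (\<integral>\<^sup>+u. ennreal (w u ^ m * D u / m) \<partial>sphere_measure)"
  proof (rule nn_integral_cong)
    fix u :: 'a assume "u \<in> space sphere_measure"
    then have "u \<noteq> 0" by auto
    then show "ennreal (w u ^ (m - 1 + 1) / real (m - 1 + 1)) * ennreal (D u) = ennreal (w u ^ m * D u / m)"
      using m w(3)[of u] D(3)[of u] by (subst ennreal_mult[symmetric]) auto
  qed
  also have "\<dots> = ennreal (LINT u|sphere_measure. w u ^ m * D u / m)"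
  proof (rule nn_integral_eq_integral)
    show "integrable sphere_measure (\<lambda>u. w u ^ m * D u / m)"
      by (intro integrable_sphere_measure continuous_intros D w) (use m in auto)
    show "AE u in sphere_measure. 0 \<le> w u ^ m * D u / m"
    proof (rule AE_I2)
      fix u :: 'a assume "u \<in> space sphere_measure"
      then have "u \<noteq> 0" by auto
      then show "0 \<le> w u ^ m * D u / m" using w(3)[of u] D(3)[of u] by simp
    qed
  qed
  finally have e: "(\<integral>\<^sup>+x. ennreal (indicator U x *\<^sub>R D x) \<partial>lborel) =
    ennreal (LINT u|sphere_measure. w u ^ m * D u / m)" .
  have nn: "0 \<le> indicator U x *\<^sub>R D x" for x
    using D(3)[of x] by (auto simp: U_def indicator_def)
  show si: "set_integrable lborel U D"
    unfolding set_integrable_def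
    by (rule integrableI_nonneg) (use nn e in auto)
  have "(LINT x|lborel. indicator U x *\<^sub>R D x) = enn2real (\<integral>\<^sup>+x. ennreal (indicator U x *\<^sub>R D x) \<partial>lborel)"
    by (rule integral_eq_nn_integral) (use nn in auto)
  also have "\<dots> = (LINT u|sphere_measure. w u ^ m * D u / m)"
    unfolding e
  proof (rule enn2real_ennreal, rule integral_nonneg_AE, rule AE_I2)
    fix u :: 'a assume "u \<in> space sphere_measure"
    then have "u \<noteq> 0" by auto
    then show "0 \<le> w u ^ m * D u / m" using w(3)[of u] D(3)[of u] by simp
  qed
  finally show "(LINT x:U|lborel. D x) = (LINT u|sphere_measure. w u ^ DIM('a) * D u) / DIM('a)"
    by (simp add: set_lebesgue_integral_def m_def)
qed

text \<open>Absolute value, positive part and negative part commute with positive factors, so each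
  of them inherits the scaling law of \<open>F\<close> and the nonnegative case applies. The first
  gives integrability, the other two the value.\<close>

lemma integral_sphere_Re_vec:
  fixes F :: "real^'n \<Rightarrow> real"
  assumes c: "continuous_on (-{0}) F"
    and hom: "\<And>r x. 0 < r \<Longrightarrow> r ^ CARD('n) * F (r *\<^sub>R x) = r\<^sup>2 * F x"
  shows "(LINT u|(sphere_measure :: (complex^'n) measure). F (Re_vec u)) =
    measure lborel (cball (0::real^'n) 1) * (LINT u|sphere_measure. F u)"
proof -
  let ?\<kappa> = "measure lborel (cball (0::real^'n) 1)"
  note Fm [measurable] = borel_measurable_continuous_on_punctured[OF c]
  have nn: "(\<integral>\<^sup>+u. ennreal (g (F (Re_vec u))) \<partial>(sphere_measure :: (complex^'n) measure)) =
    ennreal ?\<kappa> * (\<integral>\<^sup>+u. ennreal (g (F u)) \<partial>sphere_measure)"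
    if [measurable]: "g \<in> borel_measurable borel" and g: "\<And>a x. 0 < a \<Longrightarrow> g (a * x) = a * g x" "\<And>x. 0 \<le> g x"
    for g :: "real \<Rightarrow> real"
  proof (rule nn_integral_sphere_Re_vec)
    show "ennreal (r ^ CARD('n)) * ennreal (g (F (r *\<^sub>R x))) = ennreal (r\<^sup>2) * ennreal (g (F x))"
      if r: "0 < r" for r x
    proof -
      have "r ^ CARD('n) * g (F (r *\<^sub>R x)) = g (r ^ CARD('n) * F (r *\<^sub>R x))" using r g(1) by simp
      also have "\<dots> = r\<^sup>2 * g (F x)" using r g(1) hom[OF r] by simp
      finally show ?thesis using r g(2) by (simp add: ennreal_mult[symmetric])
    qed
  qed measurable
  have iR: "integrable sphere_measure F" by (rule integrable_sphere_measure[OF c])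
  have iC: "integrable (sphere_measure :: (complex^'n) measure) (\<lambda>u. F (Re_vec u))"
  proof (rule integrableI_bounded)
    show "(\<lambda>u. F (Re_vec u)) \<in> borel_measurable (sphere_measure :: (complex^'n) measure)"
      by (rule measurable_sphere_measure) measurable
    have "(\<integral>\<^sup>+u. ennreal \<bar>F (Re_vec u)\<bar> \<partial>(sphere_measure :: (complex^'n) measure)) =
      ennreal ?\<kappa> * (\<integral>\<^sup>+u. ennreal \<bar>F u\<bar> \<partial>sphere_measure)"
      by (rule nn) (auto simp: abs_mult)
    also have "\<dots> < \<infinity>"
      using iR by (auto simp: integrable_iff_bounded ennreal_mult_less_top)
    finally show "(\<integral>\<^sup>+u. ennreal (norm (F (Re_vec u))) \<partial>(sphere_measure :: (complex^'n) measure)) < \<infinity>" by simp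
  qed
  have "(LINT u|(sphere_measure :: (complex^'n) measure). F (Re_vec u)) =
    enn2real (\<integral>\<^sup>+u. ennreal (max 0 (F (Re_vec u))) \<partial>(sphere_measure :: (complex^'n) measure)) -
    enn2real (\<integral>\<^sup>+u. ennreal (max 0 (- F (Re_vec u))) \<partial>(sphere_measure :: (complex^'n) measure))"
    unfolding real_lebesgue_integral_def[OF iC] by (simp add: ennreal_max_0)
  also have "\<dots> = enn2real (ennreal ?\<kappa> * (\<integral>\<^sup>+u. ennreal (max 0 (F u)) \<partial>sphere_measure)) -
    enn2real (ennreal ?\<kappa> * (\<integral>\<^sup>+u. ennreal (max 0 (- F u)) \<partial>sphere_measure))"
  proof -
    have mx: "max 0 (a * x) = a * max 0 x" if "0 < a" for a x :: real
      using that by (auto simp: max_def zero_le_mult_iff mult_le_0_iff)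
    have mx': "max 0 (- (a * x)) = a * max 0 (- x)" if "0 < a" for a x :: real
      using mx[OF that, of "- x"] by simp
    have 1: "(\<integral>\<^sup>+u. ennreal (max 0 (F (Re_vec u))) \<partial>(sphere_measure :: (complex^'n) measure)) =
      ennreal ?\<kappa> * (\<integral>\<^sup>+u. ennreal (max 0 (F u)) \<partial>sphere_measure)"
      by (rule nn[of "\<lambda>x. max 0 x"]) (simp_all add: mx)
    have 2: "(\<integral>\<^sup>+u. ennreal (max 0 (- F (Re_vec u))) \<partial>(sphere_measure :: (complex^'n) measure)) =
      ennreal ?\<kappa> * (\<integral>\<^sup>+u. ennreal (max 0 (- F u)) \<partial>sphere_measure)"
      by (rule nn[of "\<lambda>x. max 0 (- x)"]) (simp_all add: mx')
    show ?thesis by (simp only: 1 2)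
  qed
  also have "\<dots> = ?\<kappa> * (LINT u|sphere_measure. F u)"
    unfolding real_lebesgue_integral_def[OF iR] by (simp add: ennreal_max_0 enn2real_mult right_diff_distrib)
  finally show ?thesis .
qed

section \<open>Support functions\<close>

lemma inner_le_support_fun:
  assumes "compact A" "v \<in> A"
  shows "x \<bullet> v \<le> support_fun A x"
  unfolding support_fun_def
proof (rule cSUP_upper[OF assms(2)])
  have "bounded ((\<lambda>v. x \<bullet> v) ` A)"
    by (intro compact_imp_bounded compact_continuous_image continuous_intros assms)
  then show "bdd_above ((\<lambda>v. x \<bullet> v) ` A)" by (rule bounded_imp_bdd_above)
qed

lemma support_fun_attained:
  assumes "compact A" "A \<noteq> {}"
  obtains v where "v \<in> A" "support_fun A x = x \<bullet> v"
proof -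
  obtain v where v: "v \<in> A" "\<And>y. y \<in> A \<Longrightarrow> x \<bullet> y \<le> x \<bullet> v"
    using continuous_attains_sup[OF assms, of "\<lambda>v. x \<bullet> v"] by (force intro: continuous_intros)
  then have "support_fun A x = x \<bullet> v"
    unfolding support_fun_def by (intro cSup_eq_maximum) auto
  with v that show thesis by blast
qed

lemma support_fun_unique:
  assumes A: "compact A" "A \<noteq> {}" and "\<And>v. v \<in> A \<Longrightarrow> x \<bullet> v \<le> s" and "v \<in> A" "x \<bullet> v = s"
  shows "support_fun A x = s"
  using support_fun_attained[OF A, of x] inner_le_support_fun[OF A(1), of v x] assms(3-5)
  by (metis order_antisym)

section \<open>Sublinear functions and the bodies they define\<close>

definition sublinear :: "('a::real_vector \<Rightarrow> real) \<Rightarrow> bool" where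
  "sublinear h \<longleftrightarrow> (\<forall>x y. h (x + y) \<le> h x + h y) \<and> (\<forall>c x. 0 \<le> c \<longrightarrow> h (c *\<^sub>R x) = c * h x)"

lemma sublinearD:
  assumes "sublinear h"
  shows "h (x + y) \<le> h x + h y" and "0 \<le> c \<Longrightarrow> h (c *\<^sub>R x) = c * h x" and "h 0 = 0"
proof -
  have s: "h (x + y) \<le> h x + h y" and m: "0 \<le> c \<Longrightarrow> h (c *\<^sub>R x) = c * h x" for c x y
    using assms by (auto simp: sublinear_def)
  show "h (x + y) \<le> h x + h y" "0 \<le> c \<Longrightarrow> h (c *\<^sub>R x) = c * h x" by (rule s, rule m)
  show "h 0 = 0" using m[of 0 0] by simp
qed

lemma sublinear_support_fun:
  assumes A: "compact A" "A \<noteq> {}"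
  shows "sublinear (support_fun A)"
proof -
  have "support_fun A (x + y) \<le> support_fun A x + support_fun A y" for x y
  proof -
    obtain v where v: "v \<in> A" "support_fun A (x + y) = (x + y) \<bullet> v"
      using support_fun_attained[OF A] by metis
    then show ?thesis
      using inner_le_support_fun[OF A(1) v(1), of x] inner_le_support_fun[OF A(1) v(1), of y]
      by (simp add: inner_add_left)
  qed
  moreover have "support_fun A (c *\<^sub>R x) = c * support_fun A x" if "0 \<le> c" for c x
  proof -
    obtain v where v: "v \<in> A" "support_fun A x = x \<bullet> v"
      using support_fun_attained[OF A] by metis
    show ?thesis
      by (rule support_fun_unique[OF A _ v(1)])
         (use v inner_le_support_fun[OF A(1), of _ x] that in \<open>auto intro: mult_left_mono\<close>)
  qed
  ultimately show ?thesis by (simp add: sublinear_def)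
qed

lemma continuous_on_support_fun:
  assumes A: "compact A" "A \<noteq> {}"
  shows "continuous_on X (support_fun A)"
proof -
  note S = sublinear_support_fun[OF A]
  have "convex_on UNIV (support_fun A)"
  proof (rule convex_onI)
    fix r x y assume "0 < r" "r < (1::real)"
    then show "support_fun A ((1 - r) *\<^sub>R x + r *\<^sub>R y) \<le> (1 - r) * support_fun A x + r * support_fun A y"
      using sublinearD(1)[OF S, of "(1 - r) *\<^sub>R x" "r *\<^sub>R y"]
        sublinearD(2)[OF S, of "1 - r" x] sublinearD(2)[OF S, of r y] by simp
  qed simp
  then show ?thesis using convex_on_continuous[OF open_UNIV] continuous_on_subset by blast
qed

lemma sublinear_norm: "sublinear norm"
  by (simp add: sublinear_def norm_triangle_ineq)

lemma sublinear_add: "sublinear h \<Longrightarrow> sublinear k \<Longrightarrow> sublinear (\<lambda>x. h x + k x)"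
  unfolding sublinear_def by (auto simp: algebra_simps) (smt (verit))

lemma sublinear_cmult: "sublinear h \<Longrightarrow> 0 \<le> c \<Longrightarrow> sublinear (\<lambda>x. c * h x)"
  unfolding sublinear_def by (auto simp: distrib_left[symmetric] intro: mult_left_mono)

text \<open>The Wulff shape of \<open>h\<close>. It recovers a convex body from its support
  function, and by \<open>support_fun_body_of\<close> no information on a smooth sublinear
  \<open>h\<close> is lost in it.\<close>

definition body_of :: "('a::euclidean_space \<Rightarrow> real) \<Rightarrow> 'a set" where
  "body_of h = {y. \<forall>x. x \<bullet> y \<le> h x}"

lemma convex_body_of: "convex (body_of h)"
proof -
  have "body_of h = (\<Inter>x. {y. x \<bullet> y \<le> h x})" by (auto simp: body_of_def)
  then show ?thesis by (simp add: convex_INT convex_halfspace_le)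
qed

lemma compact_body_of: "compact (body_of h)"
proof -
  have "body_of h = (\<Inter>x. {y. x \<bullet> y \<le> h x})" by (auto simp: body_of_def)
  then have "closed (body_of h)" by (simp add: closed_INT closed_halfspace_le)
  moreover have "bounded (body_of h)"
  proof (rule boundedI)
    fix y assume y: "y \<in> body_of h"
    have "norm y \<le> (\<Sum>b\<in>Basis. \<bar>y \<bullet> b\<bar>)" by (rule norm_le_l1)
    also have "\<dots> \<le> (\<Sum>b\<in>Basis. \<bar>h b\<bar> + \<bar>h (- b)\<bar>)"
    proof (rule sum_mono)
      fix b
      have "b \<bullet> y \<le> h b" "(- b) \<bullet> y \<le> h (- b)" using y by (auto simp only: body_of_def mem_Collect_eq)
      then show "\<bar>y \<bullet> b\<bar> \<le> \<bar>h b\<bar> + \<bar>h (- b)\<bar>" by (simp add: inner_commute)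
    qed
    finally show "norm y \<le> (\<Sum>b\<in>Basis. \<bar>h b\<bar> + \<bar>h (- b)\<bar>)" .
  qed
  ultimately show ?thesis by (simp add: compact_eq_bounded_closed)
qed

text \<open>A point outside \<open>A\<close> is strictly separated from \<open>A\<close> by some
  \<open>a\<close> and then violates the defining inequality in the direction
  \<open>- a\<close>.\<close>

lemma body_of_support_fun:
  assumes A: "compact A" "A \<noteq> {}" "convex A"
  shows "body_of (support_fun A) = A"
proof
  show "A \<subseteq> body_of (support_fun A)"
    using inner_le_support_fun[OF A(1)] by (auto simp: body_of_def)
  show "body_of (support_fun A) \<subseteq> A"
  proof
    fix y assume y: "y \<in> body_of (support_fun A)"
    show "y \<in> A"
    proof (rule ccontr)
      assume "y \<notin> A"
      then obtain a b where ab: "a \<bullet> y < b" "\<forall>x\<in>A. b < a \<bullet> x"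
        using separating_hyperplane_closed_point[of A y] A compact_imp_closed by blast
      obtain v where v: "v \<in> A" "support_fun A (- a) = (- a) \<bullet> v"
        using support_fun_attained[OF A(1,2)] by metis
      have "(- a) \<bullet> y \<le> support_fun A (- a)" using y by (simp only: body_of_def mem_Collect_eq)
      then show False using ab v by fastforce
    qed
  qed
qed

lemma
  fixes A :: "'n::finite \<Rightarrow> (real^'n) set"
  assumes A: "\<And>l. compact (A l)" "\<And>l. A l \<noteq> {}" "\<And>l. convex (A l)" and t: "\<And>l. 0 \<le> t l"
  shows compact_minkowski_comb: "compact (minkowski_comb t A)"
    and minkowski_comb_nonempty: "minkowski_comb t A \<noteq> {}"
    and convex_minkowski_comb: "convex (minkowski_comb t A)"
    and support_fun_minkowski_comb:
      "support_fun (minkowski_comb t A) = (\<lambda>x. \<Sum>l\<in>UNIV. t l * support_fun (A l) x)"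
proof -
  \<comment> \<open>A tuple of points is packed into one vector of vectors, so the combination is a
    continuous image of a compact product.\<close>
  let ?X = "{X :: (real^'n)^'n. \<forall>l. X $ l \<in> A l}"
  have eq: "minkowski_comb t A = (\<lambda>X. \<Sum>l\<in>UNIV. t l *\<^sub>R X $ l) ` ?X"
  proof -
    have "(\<Sum>l\<in>UNIV. t l *\<^sub>R x l) \<in> (\<lambda>X. \<Sum>l\<in>UNIV. t l *\<^sub>R X $ l) ` ?X" if "\<forall>l. x l \<in> A l" for x
      by (rule image_eqI[of _ _ "\<chi> l. x l"]) (use that in auto)
    then show ?thesis by (auto simp: minkowski_comb_def)
  qed
  have "compact ?X"
  proof -
    have "closed (\<Inter>l. (\<lambda>X :: (real^'n)^'n. X $ l) -` A l)"
      by (intro closed_INT ballI closed_vimage compact_imp_closed A continuous_intros)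
    moreover have "(\<Inter>l. (\<lambda>X :: (real^'n)^'n. X $ l) -` A l) = ?X" by auto
    moreover have "bounded ?X"
    proof -
      have "\<exists>B. \<forall>v\<in>A l. norm v \<le> B" for l
        using A(1)[of l] compact_imp_bounded bounded_iff by metis
      then obtain B where B: "\<And>l v. v \<in> A l \<Longrightarrow> norm v \<le> B l" by metis
      show ?thesis
      proof (rule boundedI)
        fix X assume X: "X \<in> ?X"
        have "norm X \<le> (\<Sum>l\<in>UNIV. norm (X $ l))"
          by (simp add: norm_vec_def L2_set_le_sum)
        also have "\<dots> \<le> (\<Sum>l\<in>UNIV. B l)" using X B by (intro sum_mono) auto
        finally show "norm X \<le> (\<Sum>l\<in>UNIV. B l)" .
      qed
    qed
    ultimately show ?thesis by (simp add: compact_eq_bounded_closed)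
  qed
  then show c: "compact (minkowski_comb t A)"
    unfolding eq by (intro compact_continuous_image continuous_intros)
  have "\<exists>v. \<forall>l. v l \<in> A l" using A(2) by (meson equals0I)
  then show ne: "minkowski_comb t A \<noteq> {}" by (auto simp: minkowski_comb_def)
  show "convex (minkowski_comb t A)"
  proof (rule convexI)
    fix x y and u v :: real
    assume "x \<in> minkowski_comb t A" "y \<in> minkowski_comb t A" and uv: "0 \<le> u" "0 \<le> v" "u + v = 1"
    then obtain X Y where XY: "x = (\<Sum>l\<in>UNIV. t l *\<^sub>R X l)" "y = (\<Sum>l\<in>UNIV. t l *\<^sub>R Y l)"
      "\<And>l. X l \<in> A l" "\<And>l. Y l \<in> A l"
      by (auto simp: minkowski_comb_def)
    have "u *\<^sub>R x + v *\<^sub>R y = (\<Sum>l\<in>UNIV. t l *\<^sub>R (u *\<^sub>R X l + v *\<^sub>R Y l))"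
      by (simp add: XY scaleR_sum_right sum.distrib scaleR_add_right mult.commute)
    moreover have "u *\<^sub>R X l + v *\<^sub>R Y l \<in> A l" for l
      using convexD[OF A(3) XY(3) XY(4)] uv by blast
    ultimately show "u *\<^sub>R x + v *\<^sub>R y \<in> minkowski_comb t A"
      unfolding minkowski_comb_def mem_Collect_eq
      by (intro exI[of _ "\<lambda>l. u *\<^sub>R X l + v *\<^sub>R Y l"]) simp
  qed
  show "support_fun (minkowski_comb t A) = (\<lambda>x. \<Sum>l\<in>UNIV. t l * support_fun (A l) x)"
  proof
    fix x
    have "\<exists>v. v \<in> A l \<and> support_fun (A l) x = x \<bullet> v" for l
      using support_fun_attained[OF A(1,2)] by metis
    then obtain v where v: "\<And>l. v l \<in> A l" "\<And>l. support_fun (A l) x = x \<bullet> v l" by metis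
    show "support_fun (minkowski_comb t A) x = (\<Sum>l\<in>UNIV. t l * support_fun (A l) x)"
    proof (rule support_fun_unique[OF c ne])
      show "(\<Sum>l\<in>UNIV. t l *\<^sub>R v l) \<in> minkowski_comb t A"
        using v(1) by (auto simp: minkowski_comb_def)
      show "x \<bullet> (\<Sum>l\<in>UNIV. t l *\<^sub>R v l) = (\<Sum>l\<in>UNIV. t l * support_fun (A l) x)"
        by (simp add: inner_sum_right v(2))
      fix y assume "y \<in> minkowski_comb t A"
      then obtain Y where Y: "y = (\<Sum>l\<in>UNIV. t l *\<^sub>R Y l)" "\<And>l. Y l \<in> A l"
        by (auto simp: minkowski_comb_def)
      then show "x \<bullet> y \<le> (\<Sum>l\<in>UNIV. t l * support_fun (A l) x)"
        by (auto simp: inner_sum_right intro!: sum_mono mult_left_mono t inner_le_support_fun A)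
    qed
  qed
qed

section \<open>Gradients and Hessians of support functions\<close>

lemma directional_derivative:
  fixes f :: "'a::real_normed_vector \<Rightarrow> real"
  assumes "(f has_derivative f') (at x)"
  shows "((\<lambda>t. (f (x + t *\<^sub>R v) - f x) / t) \<longlongrightarrow> f' v) (at 0)"
proof -
  have "((\<lambda>t. x + t *\<^sub>R v) has_derivative (\<lambda>t. t *\<^sub>R v)) (at 0)"
    by (auto intro!: derivative_eq_intros)
  moreover have "(f has_derivative f') (at (x + 0 *\<^sub>R v))" using assms by simp
  ultimately have "((\<lambda>t. f (x + t *\<^sub>R v)) has_derivative (\<lambda>t. f' (t *\<^sub>R v))) (at 0)"
    by (rule diff_chain_at[unfolded o_def])
  moreover have "f' (t *\<^sub>R v) = f' v * t" for t
    using has_derivative_bounded_linear[OF assms]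
    by (simp add: bounded_linear.linear linear_scale)
  ultimately have "((\<lambda>t. f (x + t *\<^sub>R v)) has_field_derivative f' v) (at 0)"
    by (simp add: has_field_derivative_def)
  then show ?thesis by (simp add: has_field_derivative_iff)
qed

text \<open>\<open>G\<close> and \<open>J\<close> are the gradient and the Jacobian matrix of the gradient of \<open>h\<close> away from the origin.\<close>

definition C2_data :: "(real^'n \<Rightarrow> real) \<Rightarrow> (real^'n \<Rightarrow> real^'n) \<Rightarrow> (real^'n \<Rightarrow> real^'n^'n) \<Rightarrow> bool" where
  "C2_data h G J \<longleftrightarrow> (\<forall>x. x \<noteq> 0 \<longrightarrow> (h has_derivative (\<lambda>y. G x \<bullet> y)) (at x) \<and>
     (G has_derivative (\<lambda>y. J x *v y)) (at x)) \<and> continuous_on (-{0}) J"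

lemma C2_dataD:
  assumes "C2_data h G J"
  shows "x \<noteq> 0 \<Longrightarrow> (h has_derivative (\<lambda>y. G x \<bullet> y)) (at x)"
    and "x \<noteq> 0 \<Longrightarrow> (G has_derivative (\<lambda>y. J x *v y)) (at x)"
    and "continuous_on (-{0}) h" "continuous_on (-{0}) G" "continuous_on (-{0}) J"
proof -
  have d: "\<And>x. x \<noteq> 0 \<Longrightarrow> (h has_derivative (\<lambda>y. G x \<bullet> y)) (at x)"
    "\<And>x. x \<noteq> 0 \<Longrightarrow> (G has_derivative (\<lambda>y. J x *v y)) (at x)"
    and c: "continuous_on (-{0}) J" using assms by (auto simp: C2_data_def)
  show "x \<noteq> 0 \<Longrightarrow> (h has_derivative (\<lambda>y. G x \<bullet> y)) (at x)"
    and "x \<noteq> 0 \<Longrightarrow> (G has_derivative (\<lambda>y. J x *v y)) (at x)"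
    and "continuous_on (-{0}) J" using d c by auto
  show "continuous_on (-{0}) h" "continuous_on (-{0}) G"
    by (rule has_derivative_continuous_on, rule has_derivative_at_withinI, rule d, simp)+
qed

lemma C2_data_add:
  "C2_data h G J \<Longrightarrow> C2_data h' G' J' \<Longrightarrow>
    C2_data (\<lambda>x. h x + h' x) (\<lambda>x. G x + G' x) (\<lambda>x. J x + J' x)"
  unfolding C2_data_def
  by (auto intro!: derivative_eq_intros continuous_intros simp: inner_add_left matrix_vector_mult_add_rdistrib)

lemma C2_data_cmult:
  "C2_data h G J \<Longrightarrow> C2_data (\<lambda>x. c * h x) (\<lambda>x. c *\<^sub>R G x) (\<lambda>x. c *\<^sub>R J x)"
  unfolding C2_data_def
  by (auto intro!: derivative_eq_intros continuous_intros simp: scaleR_matrix_vector_assoc[symmetric])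

lemma C2_data_cong:
  assumes "C2_data h G J" "\<And>x. h' x = h x"
  shows "C2_data h' G J"
proof -
  have "h' = h" using assms(2) by auto
  then show ?thesis using assms(1) by simp
qed

text \<open>The Hessian of the norm: the orthogonal projection along \<open>x\<close>, divided by
  |x|.\<close>

definition norm_hess :: "real^'n \<Rightarrow> real^'n^'n" where
  "norm_hess x = (1 / norm x) *\<^sub>R (mat 1 - outer (sgn x) (sgn x))"

lemma has_derivative_sgn:
  fixes x :: "real^'n"
  assumes x: "x \<noteq> 0"
  shows "(sgn has_derivative (\<lambda>y. norm_hess x *v y)) (at x)"
proof -
  have "((\<lambda>x. inverse (norm x) *\<^sub>R x) has_derivative
     (\<lambda>y. inverse (norm x) *\<^sub>R y + (- (inverse (norm x) * (y \<bullet> sgn x) * inverse (norm x))) *\<^sub>R x)) (at x)"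
    using x by (auto intro!: derivative_eq_intros has_derivative_norm)
  moreover have "inverse (norm x) *\<^sub>R y + (- (inverse (norm x) * (y \<bullet> sgn x) * inverse (norm x))) *\<^sub>R x = norm_hess x *v y" for y
    using x by (simp add: norm_hess_def scaleR_matrix_vector_assoc[symmetric] matrix_vector_mult_diff_rdistrib
        outer_mult_vec scaleR_diff_right sgn_div_norm inner_commute divide_inverse)
  ultimately show ?thesis unfolding sgn_div_norm[abs_def] by (simp add: sgn_div_norm)
qed

lemma C2_data_norm: "C2_data norm sgn (norm_hess :: real^'n \<Rightarrow> real^'n^'n)"
proof -
  have s: "continuous_on (-{0}) (sgn :: real^'n \<Rightarrow> real^'n)"
    by (intro continuous_on_sgn continuous_intros) auto
  have "continuous_on (-{0}) (\<lambda>x :: real^'n. (1 / norm x) *\<^sub>R (mat 1 - outer (sgn x) (sgn x)))"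
    unfolding outer_def by (intro continuous_intros continuous_on_vec_lambda s) auto
  moreover have "(norm has_derivative (\<lambda>y. sgn x \<bullet> y)) (at x)" if "x \<noteq> 0" for x :: "real^'n"
    using has_derivative_norm[OF that] by (simp add: inner_commute)
  ultimately show ?thesis
    unfolding C2_data_def norm_hess_def[abs_def] using has_derivative_sgn[unfolded norm_hess_def] by blast
qed

text \<open>\<open>h\<close> minus the linear function of \<open>p\<close> has a minimum at
  \<open>x\<close>, so its derivative vanishes there. Geometrically, the gradient is the only
  contact point of the body with its supporting hyperplane of normal \<open>x\<close>.\<close>

lemma subgradient_unique:
  assumes C: "C2_data h G J" and x: "x \<noteq> 0" and le: "\<And>z. p \<bullet> z \<le> h z" and eq: "p \<bullet> x = h x"
  shows "p = G x"
proof -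
  have "((\<lambda>z. h z - p \<bullet> z) has_derivative (\<lambda>y. G x \<bullet> y - p \<bullet> y)) (at x)"
    by (auto intro!: derivative_eq_intros C2_dataD(1)[OF C x])
  then have "(\<lambda>y. G x \<bullet> y - p \<bullet> y) = (\<lambda>y. 0)"
    by (intro differential_zero_maxmin[of x UNIV]) (use le eq in auto)
  then have "(G x - p) \<bullet> (G x - p) = 0" by (simp add: inner_diff_left fun_eq_iff)
  then show ?thesis by simp
qed

context
  fixes h :: "real^'n \<Rightarrow> real" and G J
  assumes sub: "sublinear h" and C: "C2_data h G J"
begin

text \<open>Euler's identity in degree 1: along the ray through \<open>x\<close> the difference
  quotient is constant.\<close>

lemma gradient_inner_self:
  assumes x: "x \<noteq> 0"
  shows "G x \<bullet> x = h x"
proof -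
  have "((\<lambda>t. (h (x + t *\<^sub>R x) - h x) / t) \<longlongrightarrow> G x \<bullet> x) (at 0)"
    by (rule directional_derivative[OF C2_dataD(1)[OF C x]])
  moreover have "((\<lambda>t. (h (x + t *\<^sub>R x) - h x) / t) \<longlongrightarrow> h x) (at 0)"
  proof (rule tendsto_eventually)
    have "\<forall>\<^sub>F t in at (0::real). -1 < t"
      by (rule order_tendstoD(1)[OF tendsto_ident_at]) simp
    then show "\<forall>\<^sub>F t in at 0. (h (x + t *\<^sub>R x) - h x) / t = h x"
      unfolding eventually_at_filter
    proof eventually_elim
      case (elim t)
      have "x + t *\<^sub>R x = (1 + t) *\<^sub>R x" by (simp add: algebra_simps)
      then show ?case using elim sublinearD(2)[OF sub, of "1 + t" x] by (auto simp: field_simps)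
    qed
  qed
  ultimately show ?thesis by (rule tendsto_unique[rotated]) simp
qed

text \<open>Subadditivity bounds every forward difference quotient by \<open>h y\<close>. Hence
  gradients are points of the body.\<close>

lemma gradient_inner_le:
  assumes x: "x \<noteq> 0"
  shows "G x \<bullet> y \<le> h y"
proof (rule tendsto_upperbound)
  show "((\<lambda>t. (h (x + t *\<^sub>R y) - h x) / t) \<longlongrightarrow> G x \<bullet> y) (at_right 0)"
    by (rule tendsto_within_subset[OF directional_derivative[OF C2_dataD(1)[OF C x]]]) simp
  show "\<forall>\<^sub>F t in at_right 0. (h (x + t *\<^sub>R y) - h x) / t \<le> h y"
  proof (rule eventually_at_rightI[of 0 1])
    fix t :: real assume t: "t \<in> {0<..<1}"
    have "h (x + t *\<^sub>R y) \<le> h x + t * h y"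
      using sublinearD(1)[OF sub, of x "t *\<^sub>R y"] sublinearD(2)[OF sub, of t y] t by simp
    then show "(h (x + t *\<^sub>R y) - h x) / t \<le> h y" using t by (simp add: field_simps)
  qed simp
qed simp

text \<open>Both gradients attain the value of \<open>h\<close> in direction \<open>x\<close>, where
  the contact point is unique.\<close>

lemma gradient_scaleR:
  assumes c: "0 < c" and x: "x \<noteq> 0"
  shows "G (c *\<^sub>R x) = G x"
proof (rule subgradient_unique[OF C x])
  show "G (c *\<^sub>R x) \<bullet> z \<le> h z" for z using c x by (intro gradient_inner_le) auto
  have "c * (G (c *\<^sub>R x) \<bullet> x) = c * h x"
    using gradient_inner_self[of "c *\<^sub>R x"] sublinearD(2)[OF sub, of c x] c x by simp
  then show "G (c *\<^sub>R x) \<bullet> x = h x" using c by simp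
qed

lemma hessian_scaleR:
  assumes c: "0 < c" and x: "x \<noteq> 0"
  shows "J (c *\<^sub>R x) = (1 / c) *\<^sub>R J x"
proof -
  have "((\<lambda>z. G (c *\<^sub>R z)) has_derivative (\<lambda>y. J (c *\<^sub>R x) *v (c *\<^sub>R y))) (at x)"
  proof -
    have a: "((\<lambda>z. c *\<^sub>R z) has_derivative (\<lambda>y. c *\<^sub>R y)) (at x)" by (auto intro!: derivative_eq_intros)
    have b: "(G has_derivative (\<lambda>y. J (c *\<^sub>R x) *v y)) (at (c *\<^sub>R x))" using C2_dataD(2)[OF C] c x by simp
    show ?thesis using diff_chain_at[OF a b] by (simp add: o_def)
  qed
  then have "(G has_derivative (\<lambda>y. J (c *\<^sub>R x) *v (c *\<^sub>R y))) (at x)"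
    by (rule has_derivative_transform_within_open[where s = "-{0}"]) (use x c gradient_scaleR in auto)
  then have eq: "(\<lambda>y. J (c *\<^sub>R x) *v (c *\<^sub>R y)) = (\<lambda>y. J x *v y)"
    by (rule has_derivative_unique[OF _ C2_dataD(2)[OF C x]])
  have "(c *\<^sub>R J (c *\<^sub>R x)) *v y = J x *v y" for y
    using fun_cong[OF eq, of y] by (simp add: matrix_vector_mult_scaleR scaleR_matrix_vector_assoc)
  then have eqm: "c *\<^sub>R J (c *\<^sub>R x) = J x" by (simp add: matrix_eq)
  have "(1 / c) *\<^sub>R (c *\<^sub>R J (c *\<^sub>R x)) = J (c *\<^sub>R x)" using c by simp
  then show ?thesis unfolding eqm by simp
qed

text \<open>Differentiating Euler's identity produces the gradient twice; what is left over must
  vanish.\<close>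

lemma vec_mult_hessian: "x \<noteq> 0 \<Longrightarrow> x v* J x = 0"
proof -
  assume x: "x \<noteq> 0"
  have "((\<lambda>z. G z \<bullet> z) has_derivative (\<lambda>y. G x \<bullet> y + (J x *v y) \<bullet> x)) (at x)"
    by (auto intro!: derivative_eq_intros C2_dataD(2)[OF C x])
  then have "(h has_derivative (\<lambda>y. G x \<bullet> y + (J x *v y) \<bullet> x)) (at x)"
    by (rule has_derivative_transform_within_open[where s = "-{0}"]) (use x gradient_inner_self in auto)
  then have eq: "(\<lambda>y. G x \<bullet> y + (J x *v y) \<bullet> x) = (\<lambda>y. G x \<bullet> y)"
    by (rule has_derivative_unique[OF _ C2_dataD(1)[OF C x]])
  have "(x v* J x) \<bullet> y = 0" for y
  proof -
    have "x \<bullet> (J x *v y) = 0" using fun_cong[OF eq, of y] by (simp add: inner_commute)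
    then show ?thesis by (simp only: dot_lmul_matrix)
  qed
  from this[of "x v* J x"] show ?thesis by simp
qed

text \<open>The gradient is constant along rays. \<open>C2_data\<close> does not state that
  \<open>J\<close> is symmetric, so this is argued separately from
  \<open>vec_mult_hessian\<close>.\<close>

lemma hessian_mult_vec: "x \<noteq> 0 \<Longrightarrow> J x *v x = 0"
proof -
  assume x: "x \<noteq> 0"
  have "(J x *v x) \<bullet> w = 0" for w
  proof -
    have "((\<lambda>z. G z \<bullet> w) has_derivative (\<lambda>y. (J x *v y) \<bullet> w)) (at x)"
      by (auto intro!: derivative_eq_intros C2_dataD(2)[OF C x])
    then have "((\<lambda>t. (G (x + t *\<^sub>R x) \<bullet> w - G x \<bullet> w) / t) \<longlongrightarrow> (J x *v x) \<bullet> w) (at_right 0)"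
      by (intro tendsto_within_subset[OF directional_derivative]) auto
    moreover have "((\<lambda>t. (G (x + t *\<^sub>R x) \<bullet> w - G x \<bullet> w) / t) \<longlongrightarrow> 0) (at_right 0)"
    proof (rule tendsto_eventually, rule eventually_at_rightI[of 0 1])
      fix t :: real assume t: "t \<in> {0<..<1}"
      have "x + t *\<^sub>R x = (1 + t) *\<^sub>R x" by (simp add: algebra_simps)
      then show "(G (x + t *\<^sub>R x) \<bullet> w - G x \<bullet> w) / t = 0"
        using gradient_scaleR[of "1 + t" x] x t by simp
    qed simp
    ultimately show ?thesis by (rule tendsto_unique[rotated]) simp
  qed
  from this[of "J x *v x"] show ?thesis by simp
qed

lemma gradient_monotone:
  "x \<noteq> 0 \<Longrightarrow> y \<noteq> 0 \<Longrightarrow> 0 \<le> (G x - G y) \<bullet> (x - y)"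
  using gradient_inner_le[of x y] gradient_inner_le[of y x] gradient_inner_self[of x] gradient_inner_self[of y]
  by (simp add: inner_diff_left inner_diff_right)

lemma gradient_in_body_of: "x \<noteq> 0 \<Longrightarrow> G x \<in> body_of h"
  using gradient_inner_le by (auto simp: body_of_def inner_commute)

lemma body_of_nonempty: "body_of h \<noteq> {}"
proof -
  have "axis undefined 1 \<noteq> (0 :: real^'n)" by simp
  then show ?thesis using gradient_in_body_of by blast
qed

text \<open>The gradient at \<open>x\<close> lies in the body and attains the bound
  \<open>h x\<close>.\<close>

lemma support_fun_body_of: "support_fun (body_of h) = h"
proof
  fix x
  show "support_fun (body_of h) x = h x"
  proof (cases "x = 0")
    case True
    then show ?thesis
      using body_of_nonempty sublinearD(3)[OF sub] by (simp add: support_fun_def)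
  next
    case False
    show ?thesis
      by (rule support_fun_unique[OF compact_body_of body_of_nonempty _ gradient_in_body_of[OF False]])
         (use gradient_inner_self[OF False] in \<open>auto simp: body_of_def inner_commute\<close>)
  qed
qed

end

section \<open>Volume of a body with positive curvature\<close>

text \<open>The last two conditions say that \<open>h - e \<bar>x\<bar>\<close> is nonnegative with monotone gradient; they hold if \<open>h\<close>
  is the support function of \<open>K + e B\<close> for a smooth body \<open>K\<close> containing the origin.\<close>

definition rounded :: "real \<Rightarrow> (real^'n \<Rightarrow> real) \<Rightarrow> (real^'n \<Rightarrow> real^'n) \<Rightarrow> (real^'n \<Rightarrow> real^'n^'n) \<Rightarrow> bool" where
  "rounded e h G J \<longleftrightarrow> sublinear h \<and> C2_data h G J \<and> (\<forall>x. e * norm x \<le> h x) \<and>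
     (\<forall>x y. x \<noteq> 0 \<longrightarrow> y \<noteq> 0 \<longrightarrow> e * ((sgn x - sgn y) \<bullet> (x - y)) \<le> (G x - G y) \<bullet> (x - y))"

lemma rounded_pos: "rounded e h G J \<Longrightarrow> 0 < e \<Longrightarrow> x \<noteq> 0 \<Longrightarrow> 0 < h x"
  unfolding rounded_def by (meson less_le_trans mult_pos_pos zero_less_norm_iff)

lemma rounded_0:
  assumes "sublinear h" "C2_data h G J" "\<And>x. 0 \<le> h x"
  shows "rounded 0 h G J"
  using assms gradient_monotone[OF assms(1,2)] by (auto simp: rounded_def)

lemma rounded_norm: "rounded 1 norm sgn norm_hess"
  using sublinear_norm C2_data_norm by (auto simp: rounded_def)

lemma rounded_add:
  assumes "rounded e h G J" "rounded e' h' G' J'"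
  shows "rounded (e + e') (\<lambda>x. h x + h' x) (\<lambda>x. G x + G' x) (\<lambda>x. J x + J' x)"
  unfolding rounded_def
proof (intro conjI allI impI)
  show "sublinear (\<lambda>x. h x + h' x)" "C2_data (\<lambda>x. h x + h' x) (\<lambda>x. G x + G' x) (\<lambda>x. J x + J' x)"
    using assms by (auto simp: rounded_def intro: sublinear_add C2_data_add)
  show "(e + e') * norm x \<le> h x + h' x" for x
    using assms by (auto simp: rounded_def distrib_right intro: add_mono)
  fix x y :: "real^'a" assume "x \<noteq> 0" "y \<noteq> 0"
  then have "e * ((sgn x - sgn y) \<bullet> (x - y)) \<le> (G x - G y) \<bullet> (x - y)"
    "e' * ((sgn x - sgn y) \<bullet> (x - y)) \<le> (G' x - G' y) \<bullet> (x - y)"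
    using assms unfolding rounded_def by blast+
  then have "(e + e') * ((sgn x - sgn y) \<bullet> (x - y)) \<le> (G x - G y) \<bullet> (x - y) + (G' x - G' y) \<bullet> (x - y)"
    unfolding distrib_right by (rule add_mono)
  also have "\<dots> = (G x + G' x - (G y + G' y)) \<bullet> (x - y)"
    by (simp add: inner_diff_left inner_add_left)
  finally show "(e + e') * ((sgn x - sgn y) \<bullet> (x - y)) \<le> (G x + G' x - (G y + G' y)) \<bullet> (x - y)" .
qed

lemma rounded_cmult:
  assumes "rounded e h G J" and c: "0 \<le> c"
  shows "rounded (c * e) (\<lambda>x. c * h x) (\<lambda>x. c *\<^sub>R G x) (\<lambda>x. c *\<^sub>R J x)"
  unfolding rounded_def
proof (intro conjI allI impI)
  show "sublinear (\<lambda>x. c * h x)" "C2_data (\<lambda>x. c * h x) (\<lambda>x. c *\<^sub>R G x) (\<lambda>x. c *\<^sub>R J x)"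
    using assms by (auto simp: rounded_def intro: sublinear_cmult C2_data_cmult)
  show "c * e * norm x \<le> c * h x" for x
    using assms by (auto simp: rounded_def mult.assoc intro: mult_left_mono)
  fix x y :: "real^'a" assume "x \<noteq> 0" "y \<noteq> 0"
  then have "e * ((sgn x - sgn y) \<bullet> (x - y)) \<le> (G x - G y) \<bullet> (x - y)"
    using assms unfolding rounded_def by blast
  from mult_left_mono[OF this c]
  show "c * e * ((sgn x - sgn y) \<bullet> (x - y)) \<le> (c *\<^sub>R G x - c *\<^sub>R G y) \<bullet> (x - y)"
    by (simp add: mult.assoc scaleR_diff_right[symmetric])
qed

lemma rounded_sum:
  assumes "finite L" "\<And>l. l \<in> L \<Longrightarrow> rounded (e l) (h l) (G l) (J l)" and t: "\<And>l. l \<in> L \<Longrightarrow> 0 \<le> t l"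
  shows "rounded (\<Sum>l\<in>L. t l * e l) (\<lambda>x. \<Sum>l\<in>L. t l * h l x) (\<lambda>x. \<Sum>l\<in>L. t l *\<^sub>R G l x)
    (\<lambda>x. \<Sum>l\<in>L. t l *\<^sub>R J l x)"
  using assms
proof (induction L rule: finite_induct)
  case empty
  have "sublinear (\<lambda>x :: real^'b. 0)" "C2_data (\<lambda>x :: real^'b. 0) (\<lambda>x. 0) (\<lambda>x. 0)"
    by (auto simp: sublinear_def C2_data_def)
  then show ?case by (auto simp: rounded_def)
next
  case (insert a L)
  have "rounded (t a * e a + (\<Sum>l\<in>L. t l * e l)) (\<lambda>x. t a * h a x + (\<Sum>l\<in>L. t l * h l x))
    (\<lambda>x. t a *\<^sub>R G a x + (\<Sum>l\<in>L. t l *\<^sub>R G l x)) (\<lambda>x. t a *\<^sub>R J a x + (\<Sum>l\<in>L. t l *\<^sub>R J l x))"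
    by (intro rounded_add rounded_cmult insert.IH insert.prems) auto
  then show ?case using insert by simp
qed

text \<open>The Jacobian matrix of \<open>x \<mapsto> \<bar>x\<bar> G x\<close>.\<close>

definition polar_jac :: "(real^'n \<Rightarrow> real^'n) \<Rightarrow> (real^'n \<Rightarrow> real^'n^'n) \<Rightarrow> real^'n \<Rightarrow> real^'n^'n" where
  "polar_jac G J x = norm x *\<^sub>R J x + outer (G x) (sgn x)"

lemma polar_jac_sum:
  "polar_jac (\<lambda>x. \<Sum>l\<in>L. t l *\<^sub>R G l x) (\<lambda>x. \<Sum>l\<in>L. t l *\<^sub>R J l x) x =
    (\<Sum>l\<in>L. t l *\<^sub>R polar_jac (G l) (J l) x)"
  by (simp add: polar_jac_def scaleR_sum_right outer_sum_left outer_scaleR_left scaleR_add_right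
      sum.distrib mult.commute)

lemma continuous_on_polar_jac:
  assumes "C2_data h G J"
  shows "continuous_on (-{0}) (polar_jac G J)"
proof -
  have "continuous_on (-{0}) (sgn :: real^'a \<Rightarrow> real^'a)"
    by (intro continuous_on_sgn continuous_intros) auto
  then show ?thesis
    unfolding polar_jac_def[abs_def] outer_def
    by (intro continuous_intros continuous_on_vec_lambda C2_dataD[OF assms]) auto
qed

text \<open>Splitting off \<open>h u\<close> leaves an expression in the Hessian alone. This is what
  later cancels the denominator of the ratio between one support function and their sum.\<close>

lemma det_polar_jac:
  assumes "sublinear h" "C2_data h G J" and u: "norm u = 1"
  shows "det (polar_jac G J u) = h u * (\<Sum>i\<in>UNIV. det (\<chi> k. if k = i then axis i 1 else J u $ k))"
proof -
  have u0: "u \<noteq> 0" and su: "sgn u = u" using u by (auto simp: sgn_div_norm)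
  have "det (polar_jac G J u) = det (J u + outer (G u) u)" by (simp add: polar_jac_def u su)
  also have "\<dots> = (G u \<bullet> u) * det (J u + outer u u)"
    by (rule det_add_outer[OF u hessian_mult_vec[OF assms(1,2) u0] vec_mult_hessian[OF assms(1,2) u0]])
  also have "det (J u + outer u u) = (\<Sum>i\<in>UNIV. det (\<chi> k. if k = i then axis i 1 else J u $ k))"
    by (rule det_add_outer_self[OF u hessian_mult_vec[OF assms(1,2) u0] vec_mult_hessian[OF assms(1,2) u0]])
  finally show ?thesis by (simp add: gradient_inner_self[OF assms(1,2) u0])
qed

lemma polar_jac_sgn:
  assumes "sublinear h" "C2_data h G J" "x \<noteq> 0"
  shows "polar_jac G J (sgn x) = polar_jac G J x"
proof -
  have "1 / inverse (norm x) = norm x" by (simp add: divide_inverse)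
  then show ?thesis
    using gradient_scaleR[OF assms(1,2) _ assms(3), of "inverse (norm x)"]
      hessian_scaleR[OF assms(1,2) _ assms(3), of "inverse (norm x)"] assms(3)
    by (simp add: polar_jac_def sgn_div_norm)
qed

text \<open>The monotonicity condition is differentiated at \<open>u\<close> along the tangent
  vector \<open>w\<close>, on which the Hessian of the norm acts as the identity.\<close>

lemma rounded_hessian_inner:
  assumes R: "rounded e h G J" and u: "norm u = 1" and w: "u \<bullet> w = 0"
  shows "e * (w \<bullet> w) \<le> (J u *v w) \<bullet> w"
proof -
  have u0: "u \<noteq> 0" using u by auto
  have C: "C2_data h G J" using R by (simp add: rounded_def)
  have d1: "((\<lambda>z. G z \<bullet> w) has_derivative (\<lambda>y. (J u *v y) \<bullet> w)) (at u)"
    by (auto intro!: derivative_eq_intros C2_dataD(2)[OF C u0])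
  have d2: "((\<lambda>z. e * (sgn z \<bullet> w)) has_derivative (\<lambda>y. e * ((norm_hess u *v y) \<bullet> w))) (at u)"
    by (auto intro!: derivative_eq_intros has_derivative_sgn u0)
  have l1: "((\<lambda>t. (G (u + t *\<^sub>R w) \<bullet> w - G u \<bullet> w) / t) \<longlongrightarrow> (J u *v w) \<bullet> w) (at_right 0)"
    using directional_derivative[OF d1] by (rule tendsto_within_subset) simp
  have l2: "((\<lambda>t. (e * (sgn (u + t *\<^sub>R w) \<bullet> w) - e * (sgn u \<bullet> w)) / t) \<longlongrightarrow> e * ((norm_hess u *v w) \<bullet> w)) (at_right 0)"
    using directional_derivative[OF d2] by (rule tendsto_within_subset) simp
  have "e * ((norm_hess u *v w) \<bullet> w) \<le> (J u *v w) \<bullet> w"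
  proof (rule tendsto_le[OF _ l1 l2])
    have nz: "u + t *\<^sub>R w \<noteq> 0" for t
    proof
      assume "u + t *\<^sub>R w = 0"
      then have "u \<bullet> (u + t *\<^sub>R w) = 0" by simp
      then show False using u w by (simp add: inner_add_right norm_eq_1)
    qed
    show "\<forall>\<^sub>F t in at_right 0. (e * (sgn (u + t *\<^sub>R w) \<bullet> w) - e * (sgn u \<bullet> w)) / t \<le>
        (G (u + t *\<^sub>R w) \<bullet> w - G u \<bullet> w) / t"
    proof (rule eventually_at_rightI[of 0 1])
      fix t :: real assume t: "t \<in> {0<..<1}"
      have "e * ((sgn (u + t *\<^sub>R w) - sgn u) \<bullet> (u + t *\<^sub>R w - u)) \<le> (G (u + t *\<^sub>R w) - G u) \<bullet> (u + t *\<^sub>R w - u)"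
        using R nz[of t] u0 unfolding rounded_def by blast
      then have "t * (e * ((sgn (u + t *\<^sub>R w) - sgn u) \<bullet> w)) \<le> t * ((G (u + t *\<^sub>R w) - G u) \<bullet> w)"
        by (simp add: algebra_simps)
      then have "e * ((sgn (u + t *\<^sub>R w) - sgn u) \<bullet> w) \<le> (G (u + t *\<^sub>R w) - G u) \<bullet> w"
        using t by simp
      then show "(e * (sgn (u + t *\<^sub>R w) \<bullet> w) - e * (sgn u \<bullet> w)) / t \<le> (G (u + t *\<^sub>R w) \<bullet> w - G u \<bullet> w) / t"
        using t by (simp add: divide_right_mono inner_diff_left right_diff_distrib)
    qed simp
  qed simp
  moreover have "(norm_hess u *v w) \<bullet> w = w \<bullet> w"
    using u w by (simp add: norm_hess_def matrix_vector_mult_diff_rdistrib outer_mult_vec sgn_div_norm)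
  ultimately show ?thesis by simp
qed

text \<open>Pairing a kernel vector \<open>w\<close> with \<open>u\<close> removes the Hessian and
  leaves (u . w) h(u) = 0. So \<open>w\<close> is tangential, is annihilated by \<open>J u\<close>,
  and the curvature bound makes it 0.\<close>

lemma det_polar_jac_nonzero:
  assumes R: "rounded e h G J" and e: "0 < e" and u: "norm u = 1"
  shows "det (polar_jac G J u) \<noteq> 0"
proof -
  have u0: "u \<noteq> 0" and su: "sgn u = u" using u by (auto simp: sgn_div_norm)
  have S: "sublinear h" and C: "C2_data h G J" using R by (auto simp: rounded_def)
  have hu: "0 < h u" by (rule rounded_pos[OF R e u0])
  have "w = 0" if "polar_jac G J u *v w = 0" for w
  proof -
    have z: "J u *v w + (u \<bullet> w) *\<^sub>R G u = 0"
      using that by (simp add: polar_jac_def u su matrix_vector_mult_add_rdistrib outer_mult_vec)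
    have "u \<bullet> (J u *v w) = 0"
      using vec_mult_hessian[OF S C u0] by (metis dot_lmul_matrix inner_zero_left)
    then have "(u \<bullet> w) * (u \<bullet> G u) = 0"
      using arg_cong[OF z, of "\<lambda>v. u \<bullet> v"] by (simp add: inner_add_right)
    then have uw: "u \<bullet> w = 0"
      using gradient_inner_self[OF S C u0] hu by (simp add: inner_commute)
    then have "(J u *v w) \<bullet> w = 0" using z by simp
    then have "e * (w \<bullet> w) \<le> 0" using rounded_hessian_inner[OF R u uw] by simp
    then have "w \<bullet> w \<le> 0" using e by (simp add: mult_le_0_iff)
    then show "w = 0" by (metis inner_ge_zero inner_eq_zero_iff order_antisym)
  qed
  then show ?thesis
    by (metis invertible_det_nz invertible_left_inverse matrix_left_invertible_ker)
qed

text \<open>The Jacobian does not vanish along the segment from the unit ball to the body, and is \<open>1\<close> for the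
  ball.\<close>

lemma det_polar_jac_pos:
  assumes R: "rounded e h G J" and e: "0 < e" and x: "x \<noteq> 0"
  shows "0 < det (polar_jac G J x)"
proof -
  define u where "u = sgn x"
  have u: "norm u = 1" using x by (simp add: u_def norm_sgn)
  then have u0: "u \<noteq> 0" and su: "sgn u = u" by (auto simp: sgn_div_norm)
  have S: "sublinear h" and C: "C2_data h G J" using R by (auto simp: rounded_def)
  \<comment> \<open>\<open>M s\<close> is the polar Jacobian at \<open>u\<close> of (1 - s) |x| + s
    h, which is again rounded, with constant (1 - s) + s e > 0.\<close>
  define M where "M s = (1 - s) *\<^sub>R mat 1 + s *\<^sub>R polar_jac G J u" for s :: real
  have nz: "det (M s) \<noteq> 0" if s: "0 \<le> s" "s \<le> 1" for s
  proof -
    have R': "rounded ((1 - s) * 1 + s * e) (\<lambda>x. (1 - s) * norm x + s * h x)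
      (\<lambda>x. (1 - s) *\<^sub>R sgn x + s *\<^sub>R G x) (\<lambda>x. (1 - s) *\<^sub>R norm_hess x + s *\<^sub>R J x)"
      using s by (intro rounded_add rounded_cmult rounded_norm R) auto
    have "0 < (1 - s) * 1 + s * e"
      using s e by (cases "s = 0") (auto intro: add_nonneg_pos)
    from det_polar_jac_nonzero[OF R' this u]
    have "det (polar_jac (\<lambda>x. (1 - s) *\<^sub>R sgn x + s *\<^sub>R G x) (\<lambda>x. (1 - s) *\<^sub>R norm_hess x + s *\<^sub>R J x) u) \<noteq> 0" .
    moreover have "polar_jac (\<lambda>x. (1 - s) *\<^sub>R sgn x + s *\<^sub>R G x) (\<lambda>x. (1 - s) *\<^sub>R norm_hess x + s *\<^sub>R J x) u = M s"
      by (simp add: M_def polar_jac_def u su norm_hess_def outer_add_left outer_diff_left outer_scaleR_left algebra_simps)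
    ultimately show ?thesis by simp
  qed
  have "0 < det (M 1)"
  proof (rule ccontr)
    assume "\<not> 0 < det (M 1)"
    moreover have "continuous_on {0..1} (\<lambda>s. det (M s))"
      unfolding det_def M_def by (intro continuous_intros)
    moreover have "det (M 0) = 1" by (simp add: M_def)
    ultimately obtain s where "0 \<le> s" "s \<le> 1" "det (M s) = 0"
      using IVT2'[of "\<lambda>s. det (M s)" 1 0 0] by auto
    then show False using nz by blast
  qed
  then show ?thesis using polar_jac_sgn[OF S C x] by (simp add: M_def u_def)
qed

section \<open>The polar map from x to |x| grad h(x)\<close>

lemma has_derivative_norm_scaleR_gradient:
  assumes "C2_data h G J" "x \<noteq> 0"
  shows "((\<lambda>x. norm x *\<^sub>R G x) has_derivative (\<lambda>y. polar_jac G J x *v y)) (at x)"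
proof -
  have "((\<lambda>x. norm x *\<^sub>R G x) has_derivative (\<lambda>y. norm x *\<^sub>R (J x *v y) + (y \<bullet> sgn x) *\<^sub>R G x)) (at x)"
    by (intro has_derivative_scaleR has_derivative_norm C2_dataD(2)[OF assms(1)] assms(2))
  moreover have "norm x *\<^sub>R (J x *v y) + (y \<bullet> sgn x) *\<^sub>R G x = polar_jac G J x *v y" for y
    by (simp add: polar_jac_def matrix_vector_mult_add_rdistrib outer_mult_vec inner_commute
        scaleR_matrix_vector_assoc)
  ultimately show ?thesis by simp
qed

text \<open>Pairing equal images with \<open>x\<close> and using grad h(y) . x <= h(x) compares the
  norms; by symmetry these agree, hence so do the gradients. For vectors of equal norm the
  monotonicity condition then bounds a positive multiple of |x - y|^2 by 0.\<close>

lemma rounded_inj_on: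
  assumes R: "rounded e h G J" and e: "0 < e"
  shows "inj_on (\<lambda>x. norm x *\<^sub>R G x) (-{0})"
proof (rule inj_onI)
  fix x y :: "real^'a"
  assume "x \<in> -{0}" "y \<in> -{0}" and eq: "norm x *\<^sub>R G x = norm y *\<^sub>R G y"
  then have x: "x \<noteq> 0" and y: "y \<noteq> 0" by auto
  have S: "sublinear h" and C: "C2_data h G J" using R by (auto simp: rounded_def)
  note hpos = rounded_pos[OF R e]
  have le: "norm x \<le> norm y" if x: "x \<noteq> 0" and y: "y \<noteq> 0" and eq: "norm x *\<^sub>R G x = norm y *\<^sub>R G y" for x y
  proof -
    have "norm x * h x = norm y * (G y \<bullet> x)"
      using arg_cong[OF eq, of "\<lambda>v. v \<bullet> x"] gradient_inner_self[OF S C x] by simp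
    also have "\<dots> \<le> norm y * h x"
      by (intro mult_left_mono gradient_inner_le[OF S C y]) auto
    finally show ?thesis using hpos[OF x] by simp
  qed
  have n: "norm x = norm y" using le[OF x y eq] le[OF y x eq[symmetric]] by simp
  then have GG: "G x = G y" using eq x y by simp
  have "e * ((sgn x - sgn y) \<bullet> (x - y)) \<le> 0"
    using R x y GG unfolding rounded_def by (metis cancel_comm_monoid_add_class.diff_cancel inner_zero_left)
  moreover have "sgn x - sgn y = (1 / norm x) *\<^sub>R (x - y)"
    using n by (simp add: sgn_div_norm scaleR_diff_right divide_inverse)
  ultimately have "e * (1 / norm x) * ((x - y) \<bullet> (x - y)) \<le> 0" by (simp add: mult.assoc)
  moreover have "0 < e * (1 / norm x)" using e x by simp
  ultimately have "(x - y) \<bullet> (x - y) \<le> 0" by (metis mult_le_cancel_left_pos mult_zero_right)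
  then have "(x - y) \<bullet> (x - y) = 0" using inner_ge_zero[of "x - y"] by linarith
  then show "x = y" by simp
qed

text \<open>\<open>r\<close> is the gauge of \<open>y\<close>, found as the maximum of (y . u) /
  h(u) over the sphere. A maximizing \<open>u\<close> is a normal of the body at y / r, so y / r is
  the contact point \<open>G u\<close>.\<close>

lemma rounded_polar_surj:
  assumes R: "rounded e h G J" and e: "0 < e" and y: "y \<noteq> 0"
  obtains r u where "0 < r" "norm u = 1" "y = r *\<^sub>R G u"
proof -
  have S: "sublinear h" and C: "C2_data h G J" using R by (auto simp: rounded_def)
  note hpos = rounded_pos[OF R e]
  have "continuous_on (sphere 0 1) (\<lambda>u. (y \<bullet> u) / h u)"
  proof (intro continuous_intros continuous_on_subset[OF C2_dataD(3)[OF C]] ballI)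
    show "h u \<noteq> 0" if "u \<in> sphere 0 1" for u using hpos[of u] that by force
  qed auto
  moreover have ny: "sgn y \<in> sphere 0 1" using y by (simp add: norm_sgn)
  ultimately obtain u where u: "u \<in> sphere 0 1"
    and mx: "\<And>v. v \<in> sphere 0 1 \<Longrightarrow> (y \<bullet> v) / h v \<le> (y \<bullet> u) / h u"
    using continuous_attains_sup[OF compact_sphere, of 0 1 "\<lambda>u. (y \<bullet> u) / h u"] by blast
  define r where "r = (y \<bullet> u) / h u"
  have u0: "u \<noteq> 0" using u by auto
  have "0 < (y \<bullet> sgn y) / h (sgn y)"
    using y hpos[of "sgn y"] by (simp add: sgn_div_norm sgn_zero_iff)
  then have r: "0 < r" using mx[OF ny] by (simp add: r_def)
  have "y \<bullet> z \<le> r * h z" for z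
  proof (cases "z = 0")
    case True
    then show ?thesis using sublinearD(3)[OF S] by simp
  next
    case False
    then have "(y \<bullet> sgn z) / h (sgn z) \<le> r" using mx[of "sgn z"] by (simp add: r_def norm_sgn)
    moreover have "0 < h (sgn z)" using hpos[of "sgn z"] False by (simp add: sgn_zero_iff)
    ultimately have "y \<bullet> sgn z \<le> r * h (sgn z)" by (simp add: field_simps)
    then have "norm z * (y \<bullet> sgn z) \<le> norm z * (r * h (sgn z))" by (simp add: mult_left_mono)
    moreover have "norm z * h (sgn z) = h z"
      using sublinearD(2)[OF S, of "norm z" "sgn z"] False by (simp add: sgn_div_norm)
    moreover have "norm z * (y \<bullet> sgn z) = y \<bullet> z" using False by (simp add: sgn_div_norm)
    ultimately show ?thesis by (simp add: algebra_simps)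
  qed
  then have "((1 / r) *\<^sub>R y) \<bullet> z \<le> h z" for z using r by (simp add: field_simps)
  moreover have "((1 / r) *\<^sub>R y) \<bullet> u = h u"
  proof -
    have "y \<bullet> u = r * h u" using hpos[OF u0] by (simp add: r_def)
    then show ?thesis using r by simp
  qed
  ultimately have "(1 / r) *\<^sub>R y = G u" by (rule subgradient_unique[OF C u0])
  then have "y = r *\<^sub>R G u" using r by (metis divide_self_if less_irrefl scaleR_one scaleR_scaleR mult.commute times_divide_eq_left mult_1_left)
  then show thesis using r u by (intro that[of r u]) auto
qed

context
  fixes e :: real and h :: "real^'n \<Rightarrow> real" and G J
  assumes R: "rounded e h G J" and e: "0 < e"
begin

lemma measure_polar_image:
  assumes w: "continuous_on (-{0}) w" "\<And>x. x \<noteq> 0 \<Longrightarrow> w (sgn x) = w x" "\<And>x. x \<noteq> 0 \<Longrightarrow> 0 < w x"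
  defines "U \<equiv> {x. x \<noteq> 0 \<and> norm x \<le> w x}"
  shows "(\<lambda>x. norm x *\<^sub>R G x) ` U \<in> lmeasurable"
    and "measure lebesgue ((\<lambda>x. norm x *\<^sub>R G x) ` U) =
      (LINT u|sphere_measure. w u ^ CARD('n) * det (polar_jac G J u)) / CARD('n)"
proof -
  have S: "sublinear h" and C: "C2_data h G J" using R by (auto simp: rounded_def)
  let ?D = "\<lambda>x. det (polar_jac G J x)"
  have D: "continuous_on (-{0}) ?D" "\<And>x. x \<noteq> 0 \<Longrightarrow> ?D (sgn x) = ?D x" "\<And>x. x \<noteq> 0 \<Longrightarrow> 0 \<le> ?D x"
  proof -
    show "continuous_on (-{0}) ?D"
      unfolding det_def by (intro continuous_intros continuous_on_polar_jac[OF C])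
  qed (use polar_jac_sgn[OF S C] det_polar_jac_pos[OF R e] in \<open>auto intro: less_imp_le\<close>)
  note star = set_integral_star_region[OF D w, folded U_def]
  have J: "\<bar>det (matrix (\<lambda>y. polar_jac G J x *v y))\<bar> = ?D x" if "x \<in> U" for x
    using det_polar_jac_pos[OF R e, of x] that by (simp add: U_def)
  have int: "set_integrable lborel U (\<lambda>x. \<bar>det (matrix (\<lambda>y. polar_jac G J x *v y))\<bar>)"
    using star(2) by (rule set_integrable_cong[THEN iffD1, rotated -1]) (use J in auto)
  have 1: "\<And>x. x \<in> U \<Longrightarrow> ((\<lambda>x. norm x *\<^sub>R G x) has_derivative (\<lambda>y. polar_jac G J x *v y)) (at x)"
    using has_derivative_norm_scaleR_gradient[OF C] by (simp add: U_def)
  have 2: "inj_on (\<lambda>x. norm x *\<^sub>R G x) U"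
    by (rule inj_on_subset[OF rounded_inj_on[OF R e]]) (auto simp: U_def)
  show "(\<lambda>x. norm x *\<^sub>R G x) ` U \<in> lmeasurable"
    by (rule measure_differentiable_image_lborel(1)[OF star(1) 1 2 int])
  have "measure lebesgue ((\<lambda>x. norm x *\<^sub>R G x) ` U) =
      (LINT x:U|lborel. \<bar>det (matrix (\<lambda>y. polar_jac G J x *v y))\<bar>)"
    by (rule measure_differentiable_image_lborel(2)[OF star(1) 1 2 int])
  also have "\<dots> = (LINT x:U|lborel. ?D x)"
    by (rule set_lebesgue_integral_cong) (use star(1) J in auto)
  finally show "measure lebesgue ((\<lambda>x. norm x *\<^sub>R G x) ` U) =
      (LINT u|sphere_measure. w u ^ CARD('n) * ?D u) / CARD('n)"
    using star(3) by simp
qed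

text \<open>A nonzero \<open>y\<close> in \<open>L\<close> has the form r grad h(u). The hypothesis
  is used only in this direction \<open>u\<close>, where it reads r h(u) <= w(u) h(u) and places r u
  in the star region. The image of the region may exceed \<open>L\<close>, so only an inequality
  results.\<close>

lemma measure_le_polar:
  assumes w: "continuous_on (-{0}) w" "\<And>x. x \<noteq> 0 \<Longrightarrow> w (sgn x) = w x" "\<And>x. x \<noteq> 0 \<Longrightarrow> 0 < w x"
    and L: "compact L" "\<And>y u. y \<in> L \<Longrightarrow> norm u = 1 \<Longrightarrow> u \<bullet> y \<le> w u * h u"
  shows "measure lborel L \<le> (LINT u|sphere_measure. w u ^ CARD('n) * det (polar_jac G J u)) / CARD('n)"
proof -
  have S: "sublinear h" and C: "C2_data h G J" using R by (auto simp: rounded_def)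
  define U where "U = {x. x \<noteq> 0 \<and> norm x \<le> w x}"
  note im = measure_polar_image[OF w, folded U_def]
  have sub: "L \<subseteq> insert 0 ((\<lambda>x. norm x *\<^sub>R G x) ` U)"
  proof
    fix y assume y: "y \<in> L"
    show "y \<in> insert 0 ((\<lambda>x. norm x *\<^sub>R G x) ` U)"
    proof (cases "y = 0")
      case False
      then obtain r u where ru: "0 < r" "norm u = 1" "y = r *\<^sub>R G u"
        using rounded_polar_surj[OF R e] by metis
      then have u0: "u \<noteq> 0" by auto
      have hu: "0 < h u" by (rule rounded_pos[OF R e u0])
      have "r * h u = u \<bullet> y" using ru gradient_inner_self[OF S C u0] by (simp add: inner_commute)
      also have "\<dots> \<le> w u * h u" by (rule L(2)[OF y ru(2)])
      finally have rw: "r \<le> w u" using hu by simp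
      have "sgn (r *\<^sub>R u) = u" using ru by (simp add: sgn_div_norm)
      then have "w (r *\<^sub>R u) = w u" using w(2)[of "r *\<^sub>R u"] ru u0 by simp
      then have "r *\<^sub>R u \<in> U" using rw ru u0 by (simp add: U_def)
      moreover have "y = norm (r *\<^sub>R u) *\<^sub>R G (r *\<^sub>R u)"
        using ru gradient_scaleR[OF S C ru(1) u0] by simp
      ultimately show ?thesis by blast
    qed simp
  qed
  have "{0} \<union> (\<lambda>x. norm x *\<^sub>R G x) ` U \<in> lmeasurable"
    by (rule fmeasurable.Un[OF lmeasurable_compact[of "{0}"] im(1)]) simp
  then have ins: "insert 0 ((\<lambda>x. norm x *\<^sub>R G x) ` U) \<in> lmeasurable" by simp
  have "measure lborel L = measure lebesgue L"
    using L(1) by (simp add: borel_compact)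
  also have "\<dots> \<le> measure lebesgue (insert 0 ((\<lambda>x. norm x *\<^sub>R G x) ` U))"
    by (rule measure_mono_fmeasurable[OF sub _ ins]) (use L(1) in \<open>simp add: borel_compact\<close>)
  also have "\<dots> = measure lebesgue ((\<lambda>x. norm x *\<^sub>R G x) ` U)"
    by (rule measure_negligible_symdiff[symmetric])
       (use ins in \<open>auto intro: negligible_subset[of "{0}"]\<close>)
  finally show ?thesis by (simp add: im(2))
qed

text \<open>For the radial function 1 the opposite inclusion holds too: shrinking a gradient by |x|
  <= 1 keeps it in the body, because \<open>h\<close> is nonnegative.\<close>

lemma measure_body_of_rounded:
  "measure lborel (body_of h) = (LINT u|sphere_measure. det (polar_jac G J u)) / CARD('n)"
proof (rule order_antisym)
  have S: "sublinear h" and C: "C2_data h G J" using R by (auto simp: rounded_def)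
  show "measure lborel (body_of h) \<le> (LINT u|sphere_measure. det (polar_jac G J u)) / CARD('n)"
    using measure_le_polar[of "\<lambda>_. 1" "body_of h"] compact_body_of by (auto simp: body_of_def)
  let ?U = "{x::real^'n. x \<noteq> 0 \<and> norm x \<le> 1}"
  have "(\<lambda>x. norm x *\<^sub>R G x) ` ?U \<subseteq> body_of h"
  proof
    fix y assume "y \<in> (\<lambda>x. norm x *\<^sub>R G x) ` ?U"
    then obtain x where x: "x \<noteq> 0" "norm x \<le> 1" "y = norm x *\<^sub>R G x" by auto
    show "y \<in> body_of h"
      unfolding body_of_def mem_Collect_eq
    proof
      fix z
      have hz: "0 \<le> h z"
      proof -
        have "e * norm z \<le> h z" using R by (simp add: rounded_def)
        moreover have "0 \<le> e * norm z" using e by simp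
        ultimately show ?thesis by linarith
      qed
      have "z \<bullet> y = norm x * (G x \<bullet> z)" using x by (simp add: inner_commute)
      also have "\<dots> \<le> norm x * h z" by (intro mult_left_mono gradient_inner_le[OF S C x(1)]) auto
      also have "\<dots> \<le> 1 * h z" by (intro mult_right_mono x hz)
      finally show "z \<bullet> y \<le> h z" by simp
    qed
  qed
  then have "measure lebesgue ((\<lambda>x. norm x *\<^sub>R G x) ` ?U) \<le> measure lebesgue (body_of h)"
    using measure_polar_image(1)[of "\<lambda>_. 1"] compact_body_of[of h]
    by (intro measure_mono_fmeasurable) (auto intro: lmeasurable_compact)
  then show "(LINT u|sphere_measure. det (polar_jac G J u)) / CARD('n) \<le> measure lborel (body_of h)"
    using measure_polar_image(2)[of "\<lambda>_. 1"] compact_body_of[of h] by (simp add: borel_compact)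
qed

end

section \<open>Mixed volumes of bodies with positive curvature\<close>

text \<open>The quadratic remainder has a constant independent of x, so the bound can be integrated
  over the sphere before differentiating at 0.\<close>

lemma one_plus_power_le:
  obtains C where "0 \<le> C" "\<And>x::real. 0 \<le> x \<Longrightarrow> x \<le> 1 \<Longrightarrow> (1 + x) ^ n \<le> 1 + real n * x + C * x\<^sup>2"
proof -
  have "\<exists>C\<ge>0. \<forall>x::real. 0 \<le> x \<longrightarrow> x \<le> 1 \<longrightarrow> (1 + x) ^ n \<le> 1 + real n * x + C * x\<^sup>2"
  proof (induction n)
    case 0
    show ?case by (intro exI[of _ 0]) auto
  next
    case (Suc n)
    then obtain C where C: "0 \<le> C" "\<And>x::real. 0 \<le> x \<Longrightarrow> x \<le> 1 \<Longrightarrow> (1 + x) ^ n \<le> 1 + real n * x + C * x\<^sup>2"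
      by blast
    have "(1 + x) ^ Suc n \<le> 1 + real (Suc n) * x + (real n + 2 * C) * x\<^sup>2" if x: "0 \<le> x" "x \<le> 1" for x :: real
    proof -
      have "(1 + x) ^ Suc n \<le> (1 + x) * (1 + real n * x + C * x\<^sup>2)"
        using C(2)[OF x] x by (simp add: mult_left_mono)
      also have "\<dots> = 1 + real (Suc n) * x + (real n + C) * x\<^sup>2 + C * x\<^sup>2 * x"
        by (simp add: algebra_simps power2_eq_square)
      also have "C * x\<^sup>2 * x \<le> C * x\<^sup>2" using C(1) x by (intro mult_left_le) auto
      finally show ?thesis by (simp add: algebra_simps)
    qed
    then show ?case using C(1) by (intro exI[of _ "real n + 2 * C"]) auto
  qed
  then show thesis using that by blast
qed

text \<open>Enlarging \<open>t l\<close> by a factor, and not by a summand, makes the derivative at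
  d = 0 equal to \<open>t l\<close> times the partial derivative, where each monomial is weighted by
  its degree in \<open>t l\<close>.\<close>

lemma mform_scale_coord:
  fixes c :: "('n::finite \<Rightarrow> 'l::finite) \<Rightarrow> real"
  shows "mform c (t(l := (1 + d) * t l)) = mform (\<lambda>f. c f * (1 + d) ^ card {i. f i = l}) t"
proof -
  have "(\<Prod>i\<in>UNIV. (t(l := (1 + d) * t l)) (f i)) = (1 + d) ^ card {i. f i = l} * (\<Prod>i\<in>UNIV. t (f i))"
    for f :: "'n \<Rightarrow> 'l"
  proof -
    have "(\<Prod>i\<in>UNIV. (t(l := (1 + d) * t l)) (f i)) = (\<Prod>i\<in>UNIV. (if f i = l then 1 + d else 1) * t (f i))"
      by (intro prod.cong) auto
    moreover have "(\<Prod>i\<in>UNIV. if f i = l then 1 + d else 1) = (1 + d) ^ card {i. f i = l}"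
      by (simp add: prod.If_cases)
    ultimately show ?thesis by (simp only: prod.distrib)
  qed
  then show ?thesis by (simp add: mform_def mult.assoc)
qed

lemma sum_card_fibers: "(\<Sum>l\<in>UNIV. card {i. f i = l}) = CARD('n)"
  for f :: "'n::finite \<Rightarrow> 'l::finite"
proof -
  have "(\<Sum>l\<in>UNIV. card {i. f i = l}) = card (\<Union>l\<in>UNIV. {i. f i = l})"
    by (subst card_UN_disjoint) auto
  also have "(\<Union>l\<in>UNIV. {i. f i = l}) = UNIV" by auto
  finally show ?thesis .
qed

text \<open>By continuity. The comparison argument works with all \<open>t l\<close> positive, while
  polarization evaluates on the boundary of the orthant.\<close>

lemma mform_eq_nonneg:
  assumes "\<And>t. (\<And>l. 0 < t l) \<Longrightarrow> mform c t = mform d t" and t: "\<And>l. 0 \<le> t l"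
  shows "mform c t = mform d t"
proof -
  have lim: "((\<lambda>s. mform b (\<lambda>l. t l + s)) \<longlongrightarrow> mform b (\<lambda>l. t l + 0)) (at_right 0)" for b
    unfolding mform_def by (intro tendsto_intros)
  have "\<forall>\<^sub>F s in at_right (0::real). mform c (\<lambda>l. t l + s) = mform d (\<lambda>l. t l + s)"
    by (rule eventually_at_rightI[of 0 1]) (use t in \<open>auto intro!: assms(1) add_nonneg_pos\<close>)
  then have "((\<lambda>s. mform d (\<lambda>l. t l + s)) \<longlongrightarrow> mform c (\<lambda>l. t l + 0)) (at_right 0)"
    using lim[of c] by (rule Lim_transform_eventually[rotated])
  then show ?thesis using tendsto_unique[OF _ _ lim[of d]] by (simp add: trivial_limit_at_right_real)
qed

lemma integral_mform:
  assumes "\<And>f. integrable M (\<lambda>u. c f u)"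
  shows "integrable M (\<lambda>u. mform (\<lambda>f. c f u) t)"
    and "(LINT u|M. mform (\<lambda>f. c f u) t) = mform (\<lambda>f. LINT u|M. c f u) t"
  using assms by (simp_all add: mform_def)

lemma mform_divide: "mform (\<lambda>f. c f / a) t = mform c t / a"
  by (simp add: mform_def sum_divide_distrib)

lemma mform_cmult: "mform (\<lambda>f. a * c f) t = a * mform c t"
  by (simp add: mform_def sum_distrib_left mult.assoc)

section \<open>The one-sided comparison and its equality case\<close>

context
  fixes e :: "'n::finite \<Rightarrow> real" and h :: "'n \<Rightarrow> real^'n \<Rightarrow> real"
    and G :: "'n \<Rightarrow> real^'n \<Rightarrow> real^'n" and J :: "'n \<Rightarrow> real^'n \<Rightarrow> real^'n^'n"
  assumes R: "\<And>l. rounded (e l) (h l) (G l) (J l)" and e: "\<And>l. 0 < e l"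
begin

private lemma S: "sublinear (h l)" and C: "C2_data (h l) (G l) (J l)"
  using R[of l] by (auto simp: rounded_def)

private lemma hpos: "x \<noteq> 0 \<Longrightarrow> 0 < h l x"
  by (rule rounded_pos[OF R e])

private definition A where "A l = body_of (h l)"
private definition ht where "ht t x = (\<Sum>l\<in>UNIV. t l * h l x)"
text \<open>By \<open>det_D\<close> this is the polar Jacobian of \<open>ht t\<close>, expanded as a
  form in \<open>t\<close>.\<close>

private definition D where "D t x = mform (\<lambda>f. det (\<chi> i. polar_jac (G (f i)) (J (f i)) x $ i)) t"
private definition c where
  "c f = (LINT u|sphere_measure. det (\<chi> i. polar_jac (G (f i)) (J (f i)) u $ i)) / CARD('n)"

private lemma A: "compact (A l)" "A l \<noteq> {}" "convex (A l)" "support_fun (A l) = h l"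
  unfolding A_def
  by (simp_all add: compact_body_of body_of_nonempty[OF S C] convex_body_of support_fun_body_of[OF S C])

private lemma Rt: "(\<And>l. 0 \<le> t l) \<Longrightarrow> rounded (\<Sum>l\<in>UNIV. t l * e l) (ht t) (\<lambda>x. \<Sum>l\<in>UNIV. t l *\<^sub>R G l x)
    (\<lambda>x. \<Sum>l\<in>UNIV. t l *\<^sub>R J l x)"
  unfolding ht_def[abs_def] by (rule rounded_sum) (use R in auto)

private lemma et: "(\<And>l. 0 \<le> t l) \<Longrightarrow> t l0 \<noteq> 0 \<Longrightarrow> 0 < (\<Sum>l\<in>UNIV. t l * e l)"
  by (rule sum_pos2[of _ l0]) (use e in \<open>auto simp: less_le\<close>)

private lemma det_D: "det (polar_jac (\<lambda>x. \<Sum>l\<in>UNIV. t l *\<^sub>R G l x) (\<lambda>x. \<Sum>l\<in>UNIV. t l *\<^sub>R J l x) x) = D t x"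
  by (simp add: polar_jac_sum det_sum_scaleR D_def)

private lemma cont_det: "continuous_on (-{0}) (\<lambda>x. det (\<chi> i. polar_jac (G (f i)) (J (f i)) x $ i))"
  unfolding det_def vec_lambda_beta by (intro continuous_intros continuous_on_polar_jac[OF C])

private lemma int_det: "integrable sphere_measure (\<lambda>x. det (\<chi> i. polar_jac (G (f i)) (J (f i)) x $ i))"
  by (rule integrable_sphere_measure[OF cont_det])

private lemma cont_D: "continuous_on (-{0}) (D t)"
  unfolding D_def mform_def by (intro continuous_intros cont_det)

private lemma int_D: "(LINT u|sphere_measure. D t u) / CARD('n) = mform c t"
  unfolding D_def integral_mform(2)[OF int_det] c_def[abs_def] mform_divide ..

private lemma vol:
  assumes t: "\<And>l. 0 \<le> t l"
  shows "measure lborel (minkowski_comb t A) = mform c t"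
proof (cases "\<exists>l0. t l0 \<noteq> 0")
  case True
  then obtain l0 where l0: "t l0 \<noteq> 0" by blast
  have "minkowski_comb t A = body_of (support_fun (minkowski_comb t A))"
    using compact_minkowski_comb[OF A(1-3) t] minkowski_comb_nonempty[OF A(1-3) t] convex_minkowski_comb[OF A(1-3) t]
    by (simp add: body_of_support_fun)
  also have "support_fun (minkowski_comb t A) = ht t"
    using support_fun_minkowski_comb[OF A(1-3) t] by (simp add: A(4) ht_def[abs_def])
  finally have "measure lborel (minkowski_comb t A) = measure lborel (body_of (ht t))" by simp
  also have "\<dots> = (LINT u|sphere_measure. D t u) / CARD('n)"
    using measure_body_of_rounded[OF Rt[of t, OF t] et[of t l0, OF t l0]] by (simp add: det_D)
  finally show ?thesis by (simp add: int_D)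
next
  \<comment> \<open>At t = 0 the rounding constant vanishes and the polar map degenerates, but a
    form of positive degree and the volume of a point are both 0.\<close>
  case False
  then have "minkowski_comb t A = {0}"
    using minkowski_comb_nonempty[OF A(1-3) t] by (auto simp: minkowski_comb_def)
  moreover have "mform c t = 0" using False by (simp add: mform_def power_0_left)
  ultimately show ?thesis by simp
qed

text \<open>The left side is \<open>t l\<close> times the partial derivative of the volume. With
  \<open>q\<close> the share of body \<open>l\<close> in \<open>ht t\<close>, multiplying
  \<open>t l\<close> by 1 + d multiplies the support function by 1 + d q, so
  \<open>measure_le_polar\<close> applies with this radial function; its n-th power contributes n d
  q to first order.\<close>

private lemma ineq:
  assumes t: "\<And>l. 0 < t l"
  shows "mform (\<lambda>f. c f * card {i. f i = l}) t \<le> (LINT u|sphere_measure. t l * h l u / ht t u * D t u)"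
proof -
  have t0: "0 \<le> t l" for l using t[of l] by simp
  define q where "q x = t l * h l x / ht t x" for x
  have htpos: "0 < ht t x" if "x \<noteq> 0" for x
    unfolding ht_def by (intro sum_pos) (use t hpos that in auto)
  have q: "0 < q x" "q x \<le> 1" if "x \<noteq> 0" for x
  proof -
    show "0 < q x" using htpos[OF that] t hpos[OF that] by (simp add: q_def)
    have "t l * h l x \<le> ht t x"
      unfolding ht_def by (rule member_le_sum) (auto intro!: mult_nonneg_nonneg t0 less_imp_le[OF hpos[OF that]])
    then show "q x \<le> 1" using htpos[OF that] by (simp add: q_def)
  qed
  have qs: "q (sgn x) = q x" if "x \<noteq> 0" for x
  proof -
    have "h k (sgn x) = inverse (norm x) * h k x" for k
      using sublinearD(2)[OF S, of "inverse (norm x)" k x] by (simp add: sgn_div_norm)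
    then have "t l * h l (sgn x) = inverse (norm x) * (t l * h l x)" "ht t (sgn x) = inverse (norm x) * ht t x"
      by (simp_all add: ht_def sum_distrib_left mult.left_commute)
    then show ?thesis
      unfolding q_def by (simp only:) (use that in \<open>auto intro!: mult_divide_mult_cancel_left\<close>)
  qed
  have cq: "continuous_on (-{0}) q"
    unfolding q_def
  proof (intro continuous_intros ballI C2_dataD(3)[OF C])
    show "continuous_on (-{0}) (ht t)"
      unfolding ht_def by (intro continuous_intros C2_dataD(3)[OF C])
    show "ht t x \<noteq> 0" if "x \<in> -{0}" for x using htpos[of x] that by auto
  qed
  have Dpos: "0 < D t x" if "x \<noteq> 0" for x
    using det_polar_jac_pos[OF Rt[of t, OF t0] et[of t l, OF t0] that] t[of l] by (simp add: det_D)
  have iq: "integrable sphere_measure (\<lambda>u. q u * D t u)" and iD: "integrable sphere_measure (D t)"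
    by (intro integrable_sphere_measure continuous_intros cq cont_D)+
  obtain B where B: "0 \<le> B" "\<And>x::real. 0 \<le> x \<Longrightarrow> x \<le> 1 \<Longrightarrow> (1 + x) ^ CARD('n) \<le> 1 + CARD('n) * x + B * x\<^sup>2"
    using one_plus_power_le by metis
  define P where "P d = mform (\<lambda>f. c f * (1 + d) ^ card {i. f i = l}) t" for d
  have bound: "P d - P 0 \<le> d * (LINT u|sphere_measure. q u * D t u) + d\<^sup>2 * (B * mform c t)"
    if d: "0 \<le> d" "d \<le> 1" for d
  proof -
    let ?t = "t(l := (1 + d) * t l)"
    have t': "0 \<le> ?t k" for k using t0 d by simp
    have "P d = measure lborel (minkowski_comb ?t A)"
      using vol[of ?t] t' by (simp add: P_def mform_scale_coord)
    also have "\<dots> \<le> (LINT u|sphere_measure. (1 + d * q u) ^ CARD('n) * D t u) / CARD('n)"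
      unfolding det_D[symmetric]
    proof (rule measure_le_polar[OF Rt[of t, OF t0] et[of t l, OF t0]])
      show "t l \<noteq> 0" using t[of l] by simp
      show "continuous_on (-{0}) (\<lambda>x. 1 + d * q x)" by (intro continuous_intros cq)
      show "1 + d * q (sgn x) = 1 + d * q x" if "x \<noteq> 0" for x using qs[OF that] by simp
      show "0 < 1 + d * q x" if "x \<noteq> 0" for x using q[OF that] d by (intro add_pos_nonneg) auto
      show "compact (minkowski_comb ?t A)" by (rule compact_minkowski_comb[OF A(1-3) t'])
      fix y u :: "real^'n" assume y: "y \<in> minkowski_comb ?t A" and u: "norm u = 1"
      then have u0: "u \<noteq> 0" by auto
      have "u \<bullet> y \<le> support_fun (minkowski_comb ?t A) u"
        by (rule inner_le_support_fun[OF compact_minkowski_comb[OF A(1-3) t'] y])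
      also have "\<dots> = (\<Sum>k\<in>UNIV. ?t k * h k u)"
        unfolding support_fun_minkowski_comb[OF A(1-3) t'] A(4) ..
      also have "\<dots> = (\<Sum>k\<in>UNIV. t k * h k u + (if k = l then d * t l * h l u else 0))"
        by (intro sum.cong) (auto simp: algebra_simps)
      also have "\<dots> = ht t u + d * (t l * h l u)"
        by (simp add: sum.distrib ht_def)
      also have "\<dots> = (1 + d * q u) * ht t u"
        using htpos[OF u0] by (simp add: q_def field_simps)
      finally show "u \<bullet> y \<le> (1 + d * q u) * ht t u" .
    qed
    also have "\<dots> \<le> (LINT u|sphere_measure. D t u + CARD('n) * d * (q u * D t u) + B * d\<^sup>2 * D t u) / CARD('n)"
    proof (rule divide_right_mono, rule integral_mono)
      show "integrable sphere_measure (\<lambda>u. (1 + d * q u) ^ CARD('n) * D t u)"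
        by (intro integrable_sphere_measure continuous_intros cq cont_D)
      show "integrable sphere_measure (\<lambda>u. D t u + CARD('n) * d * (q u * D t u) + B * d\<^sup>2 * D t u)"
        by (intro integrable_sphere_measure continuous_intros cq cont_D)
      fix u :: "real^'n" assume "u \<in> space sphere_measure"
      then have u0: "u \<noteq> 0" by auto
      have dq: "0 \<le> d * q u" "d * q u \<le> d" using q[OF u0] d by (auto intro: mult_left_le)
      have "(1 + d * q u) ^ CARD('n) \<le> 1 + CARD('n) * (d * q u) + B * (d * q u)\<^sup>2"
        by (rule B(2)) (use dq d in auto)
      also have "\<dots> \<le> 1 + CARD('n) * (d * q u) + B * d\<^sup>2"
        using dq B(1) by (intro add_mono mult_left_mono power_mono order_refl) auto
      finally have "(1 + d * q u) ^ CARD('n) * D t u \<le> (1 + CARD('n) * (d * q u) + B * d\<^sup>2) * D t u"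
        using Dpos[OF u0] by (intro mult_right_mono) auto
      then show "(1 + d * q u) ^ CARD('n) * D t u \<le> D t u + CARD('n) * d * (q u * D t u) + B * d\<^sup>2 * D t u"
        by (simp add: algebra_simps)
    qed simp
    also have "\<dots> = ((LINT u|sphere_measure. D t u) + CARD('n) * d * (LINT u|sphere_measure. q u * D t u) +
        B * d\<^sup>2 * (LINT u|sphere_measure. D t u)) / CARD('n)"
      using iq iD by simp
    also have "\<dots> = mform c t + d * (LINT u|sphere_measure. q u * D t u) + d\<^sup>2 * (B * mform c t)"
      unfolding int_D[symmetric] by (simp add: add_divide_distrib)
    finally show ?thesis by (simp add: P_def)
  qed
  have "(P has_field_derivative mform (\<lambda>f. c f * card {i. f i = l}) t) (at 0)"
    unfolding P_def mform_def
    by (rule DERIV_sum, rule DERIV_cmult_right) (auto intro!: derivative_eq_intros)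
  then have "((\<lambda>d. (P d - P 0) / d) \<longlongrightarrow> mform (\<lambda>f. c f * card {i. f i = l}) t) (at_right 0)"
    unfolding has_field_derivative_iff by (auto intro: tendsto_within_subset)
  moreover have "((\<lambda>d. (LINT u|sphere_measure. q u * D t u) + d * (B * mform c t)) \<longlongrightarrow>
      (LINT u|sphere_measure. q u * D t u) + 0 * (B * mform c t)) (at_right 0)"
    by (intro tendsto_intros)
  moreover have "\<forall>\<^sub>F d in at_right 0. (P d - P 0) / d \<le> (LINT u|sphere_measure. q u * D t u) + d * (B * mform c t)"
  proof (rule eventually_at_rightI[of 0 1])
    fix d :: real assume d: "d \<in> {0<..<1}"
    have "P d - P 0 \<le> d * ((LINT u|sphere_measure. q u * D t u) + d * (B * mform c t))"
      using bound[of d] d by (simp add: algebra_simps power2_eq_square)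
    then show "(P d - P 0) / d \<le> (LINT u|sphere_measure. q u * D t u) + d * (B * mform c t)"
      using d by (simp add: pos_divide_le_eq mult.commute)
  qed simp
  ultimately have "mform (\<lambda>f. c f * card {i. f i = l}) t \<le> (LINT u|sphere_measure. q u * D t u) + 0 * (B * mform c t)"
    by (intro tendsto_le[OF trivial_limit_at_right_real])
  then show ?thesis by (simp add: q_def)
qed

text \<open>Summed over \<open>l\<close>, both sides of the inequality equal \<open>n\<close> times the volume (Euler's identity), so
  each of the inequalities is an equality.\<close>

private lemma eq:
  assumes t: "\<And>l. 0 < t l"
  shows "mform (\<lambda>f. c f * card {i. f i = l}) t = (LINT u|sphere_measure. t l * h l u / ht t u * D t u)"
proof -
  let ?a = "\<lambda>l. mform (\<lambda>f. c f * card {i. f i = l}) t"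
  let ?b = "\<lambda>l. LINT u|sphere_measure. t l * h l u / ht t u * D t u"
  have htpos: "0 < ht t x" if "x \<noteq> 0" for x
    unfolding ht_def by (intro sum_pos) (use t hpos that in auto)
  have int: "integrable sphere_measure (\<lambda>u. t l * h l u / ht t u * D t u)" for l
  proof (intro integrable_sphere_measure continuous_intros ballI C2_dataD(3)[OF C] cont_D)
    show "continuous_on (-{0}) (ht t)"
      unfolding ht_def by (intro continuous_intros C2_dataD(3)[OF C])
    show "ht t x \<noteq> 0" if "x \<in> -{0}" for x using htpos[of x] that by auto
  qed
  have "(\<Sum>l\<in>UNIV. ?a l) = (\<Sum>f\<in>UNIV. c f * (\<Prod>i\<in>UNIV. t (f i)) * real (\<Sum>l\<in>UNIV. card {i. f i = l}))"
    unfolding mform_def by (subst sum.swap) (simp add: sum_distrib_left mult.assoc mult.left_commute mult.commute)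
  also have "\<dots> = CARD('n) * mform c t"
    by (simp only: sum_card_fibers) (simp add: mform_def sum_distrib_left mult.commute)
  also have "\<dots> = (LINT u|sphere_measure. D t u)"
    by (simp add: int_D[symmetric])
  also have "\<dots> = (LINT u|sphere_measure. (\<Sum>l\<in>UNIV. t l * h l u / ht t u * D t u))"
  proof (rule Bochner_Integration.integral_cong[OF refl])
    fix u :: "real^'n" assume "u \<in> space sphere_measure"
    then have "u \<noteq> 0" by auto
    then have "0 < ht t u" by (rule htpos)
    then show "D t u = (\<Sum>l\<in>UNIV. t l * h l u / ht t u * D t u)"
      by (simp add: sum_distrib_right[symmetric] sum_divide_distrib[symmetric] ht_def)
  qed
  also have "\<dots> = (\<Sum>l\<in>UNIV. ?b l)" by (rule Bochner_Integration.integral_sum) (rule int)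
  finally show ?thesis
    by (rule sum_mono_inv) (use ineq[OF t] in auto)
qed

text \<open>By \<open>det_polar_jac\<close> the integrand of \<open>eq\<close> is
  \<open>h l1\<close> times \<open>t l1\<close> times an adjugate trace, again a form in
  \<open>t\<close>. Its coefficients over bijections sum to the mixed discriminant, while on the
  volume side a bijection uses \<open>l1\<close> exactly once, so the degree weight is 1.\<close>

lemma rounded_mixed_volume:
  obtains c :: "('n \<Rightarrow> 'n) \<Rightarrow> real" where
    "\<And>t. (\<And>l. 0 \<le> t l) \<Longrightarrow> measure lborel (minkowski_comb t (\<lambda>l. body_of (h l))) = mform c t"
    and "(\<Sum>f | bij f. c f) = fact (CARD('n)) *
      (LINT u|sphere_measure. h l1 u * mixed_discriminant (\<lambda>l. if l = l1 then mat 1 else J l u))"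
proof
  show "measure lborel (minkowski_comb t (\<lambda>l. body_of (h l))) = mform c t" if "\<And>l. 0 \<le> t l" for t
    using vol[OF that] by (simp add: A_def[abs_def])
  define g where "g f u = (\<Sum>i | f i = l1. det (\<chi> k. if k = i then axis i 1 else J (f k) u $ k))"
    for f :: "'n \<Rightarrow> 'n" and u
  have cg: "continuous_on (-{0}) (g f)" for f
  proof -
    have "continuous_on (-{0}) (\<lambda>u. (if k = i then axis i 1 else J (f k) u $ k) $ j)" for k i j
      by (cases "k = i") (auto intro!: continuous_intros C2_dataD(5)[OF C])
    then show ?thesis
      unfolding g_def det_def vec_lambda_beta
      by (intro continuous_on_sum continuous_on_mult continuous_on_const continuous_on_prod)
  qed
  have ig: "integrable sphere_measure (\<lambda>u. h l1 u * g f u)" for f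
    by (intro integrable_sphere_measure continuous_intros cg C2_dataD(3)[OF C])
  define d where "d f = (LINT u|sphere_measure. h l1 u * g f u)" for f
  have pos: "mform (\<lambda>f. c f * card {i. f i = l1}) t = mform d t" if t: "\<And>l. 0 < t l" for t
  proof -
    have "mform (\<lambda>f. c f * card {i. f i = l1}) t = (LINT u|sphere_measure. t l1 * h l1 u / ht t u * D t u)"
      by (rule eq[OF t])
    also have "\<dots> = (LINT u|sphere_measure. mform (\<lambda>f. h l1 u * g f u) t)"
    proof (rule Bochner_Integration.integral_cong[OF refl])
      fix u :: "real^'n" assume "u \<in> space sphere_measure"
      then have u: "norm u = 1" by simp
      then have u0: "u \<noteq> 0" by auto
      have htpos: "0 < ht t u"
        unfolding ht_def by (intro sum_pos) (use t hpos u0 in auto)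
      have t0: "0 \<le> t l" for l using t[of l] by simp
      have "D t u = ht t u * (\<Sum>i\<in>UNIV. det (\<chi> k. if k = i then axis i 1 else (\<Sum>l\<in>UNIV. t l *\<^sub>R J l u) $ k))"
        using Rt[of t, OF t0] unfolding det_D[symmetric] by (intro det_polar_jac[OF _ _ u]) (auto simp: rounded_def)
      then have "t l1 * h l1 u / ht t u * D t u =
          h l1 u * (t l1 * (\<Sum>i\<in>UNIV. det (\<chi> k. if k = i then axis i 1 else (\<Sum>l\<in>UNIV. t l *\<^sub>R J l u) $ k)))"
        using htpos by simp
      also have "\<dots> = h l1 u * mform (\<lambda>f. g f u) t"
        by (simp only: g_def adjugate_trace_mform[of t l1 "\<lambda>l. J l u"])
      finally show "t l1 * h l1 u / ht t u * D t u = mform (\<lambda>f. h l1 u * g f u) t"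
        by (simp add: mform_cmult)
    qed
    also have "\<dots> = mform d t"
      unfolding d_def by (rule integral_mform(2)[OF ig])
    finally show ?thesis .
  qed
  have "mform (\<lambda>f. c f * card {i. f i = l1}) (indicator S) = mform d (indicator S)" for S
    by (rule mform_eq_nonneg[OF pos]) auto
  then have "(\<Sum>f | bij f. c f * card {i. f i = l1}) = (\<Sum>f | bij f. d f)"
    unfolding polarization[symmetric] by simp
  moreover have "card {i. f i = l1} = 1" if "bij f" for f :: "'n \<Rightarrow> 'n"
  proof -
    have "{i. f i = l1} = {inv f l1}"
      using that by (auto simp: bij_is_surj bij_is_inj surj_f_inv_f inv_f_f)
    then show ?thesis by simp
  qed
  ultimately have "(\<Sum>f | bij f. c f) = (\<Sum>f | bij f. d f)" by simp
  also have "\<dots> = (LINT u|sphere_measure. (\<Sum>f | bij f. h l1 u * g f u))"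
    unfolding d_def by (rule Bochner_Integration.integral_sum[symmetric]) (rule ig)
  also have "\<dots> = (LINT u|sphere_measure. fact (CARD('n)) *
      (h l1 u * mixed_discriminant (\<lambda>l. if l = l1 then mat 1 else J l u)))"
  proof -
    have "(\<Sum>f | bij f. g f u) = fact (CARD('n)) * mixed_discriminant (\<lambda>l. if l = l1 then mat 1 else J l u)" for u
      unfolding g_def by (rule adjugate_trace_mixed_discriminant)
    then show ?thesis by (simp add: sum_distrib_left[symmetric] mult.left_commute)
  qed
  finally show "(\<Sum>f | bij f. c f) = fact (CARD('n)) *
      (LINT u|sphere_measure. h l1 u * mixed_discriminant (\<lambda>l. if l = l1 then mat 1 else J l u))"
    by simp
qed

end

section \<open>Approximation by smooth bodies\<close>

text \<open>At 0 the difference quotient is at most |h|^(p - 1), which tends to 0 for p >=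
  2.\<close>

lemma DERIV_max_0_power:
  assumes p: "2 \<le> p"
  shows "((\<lambda>s::real. max 0 s ^ p) has_real_derivative real p * max 0 s ^ (p - 1)) (at s)"
proof -
  consider "s < 0" | "s = 0" | "0 < s" by linarith
  then show ?thesis
  proof cases
    case 1
    have "((\<lambda>s::real. 0) has_real_derivative 0) (at s)" by simp
    then have "((\<lambda>s::real. max 0 s ^ p) has_real_derivative 0) (at s)"
      by (rule has_field_derivative_transform_within_open[where S = "{..<0}"]) (use 1 p in auto)
    then show ?thesis using 1 p by (simp add: power_0_left)
  next
    case 2
    have "((\<lambda>h. max 0 h ^ p / h) \<longlongrightarrow> 0) (at (0::real))"
    proof (rule Lim_null_comparison)
      show "((\<lambda>h. \<bar>h\<bar> ^ (p - 1)) \<longlongrightarrow> 0) (at (0::real))"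
        using p by (auto intro!: tendsto_eq_intros)
      have "norm (max 0 h ^ p / h) \<le> \<bar>h\<bar> ^ (p - 1)" for h :: real
      proof (cases "0 < h")
        case True
        then show ?thesis using p by (simp add: power_diff)
      qed (use p in \<open>auto simp: power_0_left\<close>)
      then show "\<forall>\<^sub>F h in at (0::real). norm (max 0 h ^ p / h) \<le> \<bar>h\<bar> ^ (p - 1)" by simp
    qed
    then show ?thesis using 2 p by (simp add: has_field_derivative_iff power_0_left)
  next
    case 3
    have "((\<lambda>s::real. s ^ p) has_real_derivative real p * s ^ (p - 1)) (at s)"
      using DERIV_pow[of p s UNIV] by simp
    then have "((\<lambda>s::real. max 0 s ^ p) has_real_derivative real p * s ^ (p - 1)) (at s)"
      by (rule has_field_derivative_transform_within_open[where S = "{0<..}"]) (use 3 in auto)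
    then show ?thesis using 3 by simp
  qed
qed

text \<open>The \<open>p\<close>-norm analogue of \<open>max v\<in>V. x \<bullet> v\<close>, the support function of the convex hull of \<open>V\<close>.\<close>

context
  fixes V :: "(real^'n) set" and p :: nat
  assumes finV: "finite V" and p: "3 \<le> p" and V: "\<And>x. x \<noteq> 0 \<Longrightarrow> \<exists>v\<in>V. 0 < x \<bullet> v"
begin

text \<open>Positive parts discard the points of \<open>V\<close> on the far side. The assumption on
  \<open>V\<close> puts the origin inside its convex hull and keeps \<open>S\<close> positive off 0,
  so that the root is smooth; p >= 3 makes the second derivatives continuous.\<close>

private definition S where "S x = (\<Sum>v\<in>V. max 0 (x \<bullet> v) ^ p)"
private definition T where "T x = (\<Sum>v\<in>V. max 0 (x \<bullet> v) ^ (p - 1) *\<^sub>R v)"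

private lemma Spos: "x \<noteq> 0 \<Longrightarrow> 0 < S x"
  unfolding S_def using V[of x] finV p by (auto intro!: sum_pos2)

private lemma S0: "0 \<le> S x"
  unfolding S_def by (intro sum_nonneg) simp

private lemma dS: "(S has_derivative (\<lambda>y. real p * (T x \<bullet> y))) (at x)"
proof -
  have "((\<lambda>x. max 0 (x \<bullet> v) ^ p) has_derivative (\<lambda>y. (y \<bullet> v) * (real p * max 0 (x \<bullet> v) ^ (p - 1)))) (at x)" for v
  proof -
    have "((\<lambda>x. x \<bullet> v) has_derivative (\<lambda>y. y \<bullet> v)) (at x)" by (auto intro!: derivative_eq_intros)
    from has_derivative_compose[OF this DERIV_max_0_power[of p "x \<bullet> v", unfolded has_field_derivative_def]]
    show ?thesis using p by (simp add: mult.commute)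
  qed
  then have "(S has_derivative (\<lambda>y. \<Sum>v\<in>V. (y \<bullet> v) * (real p * max 0 (x \<bullet> v) ^ (p - 1)))) (at x)"
    unfolding S_def[abs_def] by (rule has_derivative_sum)
  moreover have "(\<Sum>v\<in>V. (y \<bullet> v) * (real p * max 0 (x \<bullet> v) ^ (p - 1))) = real p * (T x \<bullet> y)" for y
    unfolding T_def inner_sum_left sum_distrib_left
    by (intro sum.cong refl) (simp add: inner_commute[of y] mult_ac)
  ultimately show ?thesis by simp
qed

private lemma dT: "(T has_derivative (\<lambda>y. \<Sum>v\<in>V. ((y \<bullet> v) * (real (p - 1) * max 0 (x \<bullet> v) ^ (p - 2))) *\<^sub>R v)) (at x)"
proof -
  have "((\<lambda>x. max 0 (x \<bullet> v) ^ (p - 1)) has_derivative (\<lambda>y. (y \<bullet> v) * (real (p - 1) * max 0 (x \<bullet> v) ^ (p - 2)))) (at x)" for v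
  proof -
    have "((\<lambda>x. x \<bullet> v) has_derivative (\<lambda>y. y \<bullet> v)) (at x)" by (auto intro!: derivative_eq_intros)
    from has_derivative_compose[OF this DERIV_max_0_power[of "p - 1" "x \<bullet> v", unfolded has_field_derivative_def]]
    show ?thesis using p by (simp add: mult.commute numeral_2_eq_2 diff_diff_left)
  qed
  then show ?thesis unfolding T_def[abs_def]
    by (intro has_derivative_sum has_derivative_scaleR_left)
qed

private definition g where "g x = S x powr (1 / p)"
private definition Gg where "Gg x = S x powr (1 / p - 1) *\<^sub>R T x"
private definition Jg where "Jg x = S x powr (1 / p - 1) *\<^sub>R (\<Sum>v\<in>V. (real (p - 1) * max 0 (x \<bullet> v) ^ (p - 2)) *\<^sub>R outer v v) +
  ((1 / p - 1) * S x powr (1 / p - 2) * p) *\<^sub>R outer (T x) (T x)"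

private lemma dpowr:
  assumes x: "x \<noteq> 0"
  shows "((\<lambda>x. S x powr a) has_derivative (\<lambda>y. a * S x powr (a - 1) * (real p * (T x \<bullet> y)))) (at x)"
proof -
  have "((\<lambda>s. s powr a) has_real_derivative (a * S x powr (a - 1))) (at (S x))"
    by (rule has_real_derivative_powr) (rule Spos[OF x])
  from has_derivative_compose[OF dS this[unfolded has_field_derivative_def]]
  show ?thesis by (simp add: mult.commute)
qed

private lemma C2_g: "C2_data g Gg Jg"
  unfolding C2_data_def
proof (intro conjI allI impI)
  fix x :: "real^'n" assume x: "x \<noteq> 0"
  have "(1 / p) * S x powr (1 / p - 1) * (real p * (T x \<bullet> y)) = Gg x \<bullet> y" for y
    using p by (simp add: Gg_def)
  then show "(g has_derivative (\<lambda>y. Gg x \<bullet> y)) (at x)"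
    using dpowr[OF x, of "1 / p"] by (simp add: g_def[abs_def])
  have "(Gg has_derivative (\<lambda>y. S x powr (1 / p - 1) *\<^sub>R (\<Sum>v\<in>V. ((y \<bullet> v) * (real (p - 1) * max 0 (x \<bullet> v) ^ (p - 2))) *\<^sub>R v) +
     ((1 / p - 1) * S x powr (1 / p - 1 - 1) * (real p * (T x \<bullet> y))) *\<^sub>R T x)) (at x)"
    unfolding Gg_def[abs_def] by (rule has_derivative_scaleR[OF dpowr[OF x] dT])
  moreover have "S x powr (1 / p - 1) *\<^sub>R (\<Sum>v\<in>V. ((y \<bullet> v) * (real (p - 1) * max 0 (x \<bullet> v) ^ (p - 2))) *\<^sub>R v) +
     ((1 / p - 1) * S x powr (1 / p - 1 - 1) * (real p * (T x \<bullet> y))) *\<^sub>R T x = Jg x *v y" for y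
  proof -
    have "(\<Sum>v\<in>V. (real (p - 1) * max 0 (x \<bullet> v) ^ (p - 2)) *\<^sub>R outer v v) *v y =
      (\<Sum>v\<in>V. ((y \<bullet> v) * (real (p - 1) * max 0 (x \<bullet> v) ^ (p - 2))) *\<^sub>R v)"
    proof -
      have "(\<Sum>v\<in>W. c v *\<^sub>R outer v v) *v y = (\<Sum>v\<in>W. (y \<bullet> v * c v) *\<^sub>R v)" if "finite W" for W and c :: "real^'n \<Rightarrow> real"
        using that
        by (induction W rule: finite_induct)
           (auto simp: matrix_vector_mult_add_rdistrib scaleR_matrix_vector_assoc[symmetric] outer_mult_vec inner_commute mult.commute)
      from this[OF finV] show ?thesis .
    qed
    then show ?thesis
      by (simp add: Jg_def matrix_vector_mult_add_rdistrib scaleR_matrix_vector_assoc[symmetric] outer_mult_vec mult.assoc)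
  qed
  ultimately show "(Gg has_derivative (\<lambda>y. Jg x *v y)) (at x)" by simp
next
  have cS: "continuous_on (-{0}) S" and cT: "continuous_on (-{0}) T"
    unfolding S_def[abs_def] T_def[abs_def] by (intro continuous_intros)+
  then show "continuous_on (-{0}) Jg"
    unfolding Jg_def outer_def
    by (intro continuous_intros continuous_on_vec_lambda) (use Spos in \<open>auto simp: less_le\<close>)
qed

private lemma g_le: "0 \<le> b \<Longrightarrow> S x \<le> b ^ p \<Longrightarrow> g x \<le> b"
proof -
  assume b: "0 \<le> b" and le: "S x \<le> b ^ p"
  have "S x powr (1 / p) \<le> (b ^ p) powr (1 / p)"
    by (intro powr_mono2 S0 le) auto
  also have "\<dots> = b" using b p by (cases "b = 0") (auto simp: powr_realpow[symmetric] powr_powr)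
  finally show ?thesis by (simp add: g_def)
qed

private lemma g_power: "g x ^ p = S x"
proof (cases "x = 0")
  case True
  have "S 0 = 0" using p by (simp add: S_def power_0_left)
  then show ?thesis using True p by (simp add: g_def power_0_left)
next
  case False
  then have "0 < g x" using Spos[OF False] by (simp add: g_def)
  then have "g x ^ p = g x powr p" by (simp add: powr_realpow)
  also have "\<dots> = S x" using Spos[OF False] p by (simp add: g_def powr_powr)
  finally show ?thesis .
qed

private lemma g0: "0 \<le> g x" by (simp add: g_def)

text \<open>Subadditivity is Minkowski's inequality for the p-norm. With a = g x and b = g y,
  convexity of the p-th power is applied with weights a / (a + b) and b / (a + b) to the arguments
  divided by \<open>a\<close> and \<open>b\<close>, whose p-th powers sum to 1 over
  \<open>V\<close>.\<close>

private lemma sub_g: "sublinear g"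
proof -
  have hom: "g (c *\<^sub>R x) = c * g x" if c: "0 \<le> c" for c x
  proof -
    have "S (c *\<^sub>R x) = c ^ p * S x"
    proof -
      have "max 0 (c * s) = c * max 0 s" for s using c by (auto simp: max_def zero_le_mult_iff mult_le_0_iff)
      then show ?thesis by (simp add: S_def power_mult_distrib sum_distrib_left)
    qed
    then have "g (c *\<^sub>R x) ^ p = (c * g x) ^ p" by (simp add: g_power power_mult_distrib)
    then show ?thesis by (rule power_eq_imp_eq_base) (use c g0 p in simp_all)
  qed
  have tri: "g (x + y) \<le> g x + g y" for x y
  proof (cases "x = 0 \<or> y = 0")
    case True
    then show ?thesis using g0 by auto
  next
    case False
    define a b where "a = g x" and "b = g y"
    have ab: "0 < a" "0 < b" using False Spos[of x] Spos[of y] by (auto simp: a_def b_def g_def)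
    have cv: "max 0 (s + t) ^ p \<le> (a + b) ^ p * (a / (a + b) * (max 0 s / a) ^ p + b / (a + b) * (max 0 t / b) ^ p)" for s t
    proof -
      have "((a / (a + b)) * (max 0 s / a) + (b / (a + b)) * (max 0 t / b)) ^ p \<le>
        a / (a + b) * (max 0 s / a) ^ p + b / (a + b) * (max 0 t / b) ^ p"
      proof -
        have "convex_on {0..} (\<lambda>x::real. x ^ p)"
          using convex_power_odd[of p] convex_on_subset[OF convex_power_even[of p]] by (cases "even p") auto
        from convex_onD[OF this, of "b / (a + b)" "max 0 s / a" "max 0 t / b"] ab
        have "((1 - b / (a + b)) * (max 0 s / a) + (b / (a + b)) * (max 0 t / b)) ^ p \<le>
          (1 - b / (a + b)) * (max 0 s / a) ^ p + b / (a + b) * (max 0 t / b) ^ p" by simp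
        moreover have "1 - b / (a + b) = a / (a + b)" using ab by (simp add: field_simps)
        ultimately show ?thesis by simp
      qed
      moreover have "(a / (a + b)) * (max 0 s / a) + (b / (a + b)) * (max 0 t / b) = (max 0 s + max 0 t) / (a + b)"
        using ab by (simp add: add_divide_distrib)
      ultimately have "((max 0 s + max 0 t) / (a + b)) ^ p \<le> a / (a + b) * (max 0 s / a) ^ p + b / (a + b) * (max 0 t / b) ^ p"
        by simp
      then have "(max 0 s + max 0 t) ^ p \<le> (a + b) ^ p * (a / (a + b) * (max 0 s / a) ^ p + b / (a + b) * (max 0 t / b) ^ p)"
        using ab by (simp add: power_divide divide_le_eq mult.commute)
      moreover have "max 0 (s + t) ^ p \<le> (max 0 s + max 0 t) ^ p" by (intro power_mono) auto
      ultimately show ?thesis by linarith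
    qed
    have "S (x + y) \<le> (\<Sum>v\<in>V. (a + b) ^ p * (a / (a + b) * (max 0 (x \<bullet> v) / a) ^ p + b / (a + b) * (max 0 (y \<bullet> v) / b) ^ p))"
      unfolding S_def inner_add_left by (intro sum_mono cv)
    also have "\<dots> = (a + b) ^ p * (a / (a + b) * (S x / a ^ p) + b / (a + b) * (S y / b ^ p))"
      by (simp add: S_def sum_distrib_left[symmetric] sum.distrib power_divide sum_divide_distrib[symmetric])
    also have "\<dots> = (a + b) ^ p"
      using ab by (simp add: g_power[symmetric] a_def[symmetric] b_def[symmetric] add_divide_distrib[symmetric])
    finally show ?thesis using ab by (intro g_le) (auto simp: a_def b_def)
  qed
  show ?thesis using hom tri by (simp add: sublinear_def)
qed

text \<open>One term bounds the sum from below, \<open>card V\<close> equal terms bound it from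
  above; the factor between the bounds tends to 1 as p grows.\<close>

lemma smooth_max_inner:
  obtains g G J where "sublinear g" "C2_data g G J"
    "\<And>x v. v \<in> V \<Longrightarrow> x \<bullet> v \<le> g x"
    "\<And>x b. 0 \<le> b \<Longrightarrow> (\<And>v. v \<in> V \<Longrightarrow> x \<bullet> v \<le> b) \<Longrightarrow> g x \<le> root p (card V) * b"
proof (rule that[OF sub_g C2_g])
  show "x \<bullet> v \<le> g x" if "v \<in> V" for x v
  proof (rule ccontr)
    assume "\<not> x \<bullet> v \<le> g x"
    then have "g x ^ p < (x \<bullet> v) ^ p" using g0 p by (intro power_strict_mono) auto
    also have "(x \<bullet> v) ^ p = max 0 (x \<bullet> v) ^ p" using \<open>\<not> x \<bullet> v \<le> g x\<close> g0[of x] by simp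
    also have "\<dots> \<le> S x" unfolding S_def using finV that by (intro member_le_sum) auto
    finally show False by (simp add: g_power)
  qed
  show "g x \<le> root p (card V) * b" if b: "0 \<le> b" and le: "\<And>v. v \<in> V \<Longrightarrow> x \<bullet> v \<le> b" for x b
  proof (rule g_le)
    show "0 \<le> root p (card V) * b" using b p by simp
    have "S x \<le> (\<Sum>v\<in>V. b ^ p)" unfolding S_def using le b by (intro sum_mono power_mono) auto
    then show "S x \<le> (root p (card V) * b) ^ p" using p by (simp add: power_mult_distrib real_root_pow_pos2)
  qed
qed

end

lemma smooth_outer_approximation:
  fixes A :: "(real^'n) set"
  assumes A: "compact A" "0 \<in> A" and d: "0 < d"
  obtains g G J where "sublinear g" "C2_data g G J"
    "\<And>x. support_fun A x \<le> g x" "\<And>x. g x \<le> support_fun A x + d * norm x"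
proof -
  let ?h = "support_fun A"
  have h0: "0 \<le> ?h x" for x using inner_le_support_fun[OF A, of x] by simp
  have ne: "A \<noteq> {}" using A by auto
  obtain B where B: "0 < B" "\<And>a. a \<in> A \<Longrightarrow> norm a \<le> B"
    using compact_imp_bounded[OF A(1)] bounded_pos by metis
  have hB: "?h x \<le> B * norm x" for x
  proof -
    obtain a where a: "a \<in> A" "?h x = x \<bullet> a" using support_fun_attained[OF A(1) ne] by metis
    have "x \<bullet> a \<le> norm x * norm a" by (rule norm_cauchy_schwarz)
    also have "\<dots> \<le> norm x * B" by (intro mult_left_mono B a) auto
    finally show ?thesis using a by (simp add: mult.commute)
  qed
  \<comment> \<open>Thickening by d / 2 and a net of mesh d / 4 leave a margin of d / 4: with h the
    support function of \<open>A\<close>, the maximum of x . v over \<open>V\<close> lies between h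
    + (d / 4) |x| and h + (d / 2) |x|. The margin makes \<open>V\<close> admissible for
    \<open>smooth_max_inner\<close>.\<close>
  define C where "C = {a + b | a b. a \<in> A \<and> b \<in> cball 0 (d / 2)}"
  have "compact C" unfolding C_def by (rule compact_sums[OF A(1) compact_cball])
  then obtain V where V: "V \<subseteq> C" "finite V" "C \<subseteq> (\<Union>v\<in>V. ball v (d / 4))"
  proof (rule compactE_image)
    show "C \<subseteq> (\<Union>v\<in>C. ball v (d / 4))" using d by (auto intro: bexI centre_in_ball[THEN iffD2])
  qed auto
  have up: "x \<bullet> v \<le> ?h x + d / 2 * norm x" if "v \<in> V" for x v
  proof -
    have "v \<in> C" using that V(1) by blast
    then obtain a b where ab: "v = a + b" "a \<in> A" "norm b \<le> d / 2" unfolding C_def by auto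
    have "x \<bullet> b \<le> norm x * norm b" by (rule norm_cauchy_schwarz)
    also have "\<dots> \<le> norm x * (d / 2)" by (intro mult_left_mono ab) auto
    finally show ?thesis
      using inner_le_support_fun[OF A(1) ab(2), of x] by (simp add: ab(1) inner_add_right mult.commute)
  qed
  have low: "\<exists>v\<in>V. ?h x + d / 4 * norm x \<le> x \<bullet> v" for x
  proof -
    obtain a where a: "a \<in> A" "?h x = x \<bullet> a" using support_fun_attained[OF A(1) ne] by metis
    have "a + (d / 2) *\<^sub>R sgn x \<in> C"
      unfolding C_def mem_Collect_eq
      by (intro exI[of _ a] exI[of _ "(d / 2) *\<^sub>R sgn x"]) (use a d in \<open>simp add: norm_sgn\<close>)
    then obtain v where v: "v \<in> V" "dist v (a + (d / 2) *\<^sub>R sgn x) < d / 4" using V(3) by auto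
    have "x \<bullet> (a + (d / 2) *\<^sub>R sgn x - v) \<le> norm x * norm (a + (d / 2) *\<^sub>R sgn x - v)"
      by (rule norm_cauchy_schwarz)
    also have "\<dots> \<le> norm x * (d / 4)"
      using v(2) by (intro mult_left_mono) (auto simp: dist_norm norm_minus_commute)
    finally have "x \<bullet> a + d / 2 * (x \<bullet> sgn x) - x \<bullet> v \<le> norm x * (d / 4)"
      by (simp add: inner_diff_right inner_add_right)
    moreover have "x \<bullet> sgn x = norm x"
      by (cases "x = 0") (simp_all add: sgn_div_norm power2_norm_eq_inner[symmetric] power2_eq_square)
    ultimately show ?thesis using v(1) a(2) by (intro bexI[of _ v]) (auto simp: algebra_simps)
  qed
  have Vpos: "\<exists>v\<in>V. 0 < x \<bullet> v" if "x \<noteq> 0" for x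
  proof -
    obtain v where "v \<in> V" "?h x + d / 4 * norm x \<le> x \<bullet> v" using low by blast
    moreover have "0 < d / 4 * norm x" using d that by simp
    ultimately show ?thesis using h0[of x] by (intro bexI[of _ v]) linarith
  qed
  have cV: "0 < card V" using V(2) low[of 0] by (auto simp: card_gt_0_iff)
  \<comment> \<open>The function to be multiplied by the root is at most (B + d / 2) |x|, so this
    relative error costs at most (d / 2) |x|, the second half of \<open>d\<close>.\<close>
  have "(\<lambda>p. root p (card V)) \<longlonglongrightarrow> 1" using cV by (intro LIMSEQ_root_const) simp
  moreover have "(1::real) < 1 + d / 2 / (B + d / 2)" using d B(1) by simp
  ultimately have "\<forall>\<^sub>F p in sequentially. root p (card V) < 1 + d / 2 / (B + d / 2)"
    by (rule order_tendstoD(2))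
  then have "\<forall>\<^sub>F p in sequentially. 3 \<le> p \<and> root p (card V) < 1 + d / 2 / (B + d / 2)"
    using eventually_ge_at_top[of 3] by eventually_elim auto
  then obtain p where p: "3 \<le> p" "root p (card V) < 1 + d / 2 / (B + d / 2)"
    using eventually_happens'[OF sequentially_bot] by blast
  obtain g G J where g: "sublinear g" "C2_data g G J" "\<And>x v. v \<in> V \<Longrightarrow> x \<bullet> v \<le> g x"
    "\<And>x b. 0 \<le> b \<Longrightarrow> (\<And>v. v \<in> V \<Longrightarrow> x \<bullet> v \<le> b) \<Longrightarrow> g x \<le> root p (card V) * b"
    using smooth_max_inner[OF V(2) p(1) Vpos] by metis
  show thesis
  proof (rule that[OF g(1,2)])
    fix x
    obtain v where v: "v \<in> V" "?h x + d / 4 * norm x \<le> x \<bullet> v" using low by blast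
    moreover have "0 \<le> d / 4 * norm x" using d by simp
    ultimately show "?h x \<le> g x" using g(3)[OF v(1), of x] by linarith
    let ?b = "?h x + d / 2 * norm x"
    have b: "0 \<le> ?b" using h0 d by simp
    have "g x \<le> root p (card V) * ?b" by (rule g(4)[OF b up])
    also have "\<dots> \<le> (1 + d / 2 / (B + d / 2)) * ?b" using p(2) b by (intro mult_right_mono) auto
    also have "\<dots> = ?b + d / 2 / (B + d / 2) * ?b" by (simp add: algebra_simps)
    also have "d / 2 / (B + d / 2) * ?b \<le> d / 2 / (B + d / 2) * ((B + d / 2) * norm x)"
      using hB[of x] d B(1) by (intro mult_left_mono) (auto simp: algebra_simps)
    also have "\<dots> = d / 2 * norm x"
    proof -
      have "a / c * (c * z) = a * z" if "c \<noteq> 0" for a c z :: real using that by simp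
      from this[of "B + d / 2"] show ?thesis using d B(1) by (simp only:)
    qed
    finally show "g x \<le> ?h x + d * norm x" by simp
  qed
qed

text \<open>Continuity of measure from above: the compact sets \<open>D j\<close> decrease to
  \<open>body_of h\<close>, and each of them contains all but finitely many \<open>L k\<close>. The
  lower bound is the inclusion of \<open>body_of h\<close> in \<open>L k\<close>.\<close>

lemma measure_body_of_outer_limit:
  fixes L :: "nat \<Rightarrow> 'a::euclidean_space set"
  assumes L: "\<And>k. compact (L k)" "\<And>k. body_of h \<subseteq> L k"
    "\<And>k x y. y \<in> L k \<Longrightarrow> x \<bullet> y \<le> h x + s k * norm x" and s: "s \<longlonglongrightarrow> 0"
  shows "(\<lambda>k. measure lborel (L k)) \<longlonglongrightarrow> measure lborel (body_of h)"
proof -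
  define D where "D j = body_of (\<lambda>x. h x + (1 / Suc j) * norm x)" for j
  have Dm: "D j \<in> fmeasurable lborel" for j
    using compact_body_of[of "\<lambda>x. h x + (1 / Suc j) * norm x"] by (simp add: D_def fmeasurable_compact)
  have int: "(\<Inter>j. D j) = body_of h"
  proof
    show "body_of h \<subseteq> (\<Inter>j. D j)"
      by (auto simp: D_def body_of_def intro: order_trans)
    show "(\<Inter>j. D j) \<subseteq> body_of h"
    proof
      fix y assume y: "y \<in> (\<Inter>j. D j)"
      show "y \<in> body_of h"
        unfolding body_of_def mem_Collect_eq
      proof
        fix x
        have "(\<lambda>j. h x + (1 / Suc j) * norm x) \<longlonglongrightarrow> h x + 0 * norm x"
          by (intro tendsto_intros LIMSEQ_Suc[OF lim_1_over_n])
        then have "(\<lambda>j. h x + (1 / Suc j) * norm x) \<longlonglongrightarrow> h x" by simp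
        then show "x \<bullet> y \<le> h x"
          by (rule LIMSEQ_le_const) (use y in \<open>auto simp: D_def body_of_def\<close>)
      qed
    qed
  qed
  have "(\<lambda>j. measure lborel (D j)) \<longlonglongrightarrow> measure lborel (\<Inter>j. D j)"
  proof (rule Lim_measure_decseq)
    show "range D \<subseteq> sets lborel" using Dm by (auto simp: fmeasurable_def)
    show "decseq D"
    proof (rule decseq_SucI)
      fix j
      have "(1 / Suc (Suc j)) * norm x \<le> (1 / Suc j) * norm x" for x :: 'a
        by (intro mult_right_mono) (auto simp: field_simps)
      then show "D (Suc j) \<subseteq> D j" unfolding D_def body_of_def by (auto intro: order_trans add_left_mono)
    qed
    show "emeasure lborel (D j) \<noteq> \<infinity>" for j using Dm[of j] by (auto simp: fmeasurable_def)
  qed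
  then have lim: "(\<lambda>j. measure lborel (D j)) \<longlonglongrightarrow> measure lborel (body_of h)" by (simp add: int)
  show ?thesis
  proof (rule order_tendstoI)
    fix a assume a: "a < measure lborel (body_of h)"
    have "measure lborel (body_of h) \<le> measure lborel (L k)" for k
      by (rule measure_mono_fmeasurable[OF L(2)])
         (use L(1)[of k] compact_body_of[of h] in \<open>auto simp: borel_compact fmeasurable_compact\<close>)
    then have "a < measure lborel (L k)" for k by (rule less_le_trans[OF a])
    then show "\<forall>\<^sub>F k in sequentially. a < measure lborel (L k)" by (intro always_eventually allI)
  next
    fix a assume "measure lborel (body_of h) < a"
    then have "\<forall>\<^sub>F j in sequentially. measure lborel (D j) < a" by (rule order_tendstoD(2)[OF lim])
    then obtain j where j: "measure lborel (D j) < a"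
      using eventually_happens'[OF sequentially_bot] by blast
    have "\<forall>\<^sub>F k in sequentially. s k < 1 / Suc j" by (rule order_tendstoD(2)[OF s]) simp
    then show "\<forall>\<^sub>F k in sequentially. measure lborel (L k) < a"
    proof eventually_elim
      case (elim k)
      have "L k \<subseteq> D j"
      proof
        fix y assume y: "y \<in> L k"
        have "s k * norm x \<le> (1 / Suc j) * norm x" for x :: 'a using elim by (intro mult_right_mono) auto
        then have "x \<bullet> y \<le> h x + (1 / Suc j) * norm x" for x
          by (intro order_trans[OF L(3)[OF y] add_left_mono])
        then show "y \<in> D j" by (simp add: D_def body_of_def)
      qed
      then have "measure lborel (L k) \<le> measure lborel (D j)"
        by (rule measure_mono_fmeasurable) (use L(1)[of k] Dm in \<open>auto simp: borel_compact\<close>)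
      then show ?case using j by simp
    qed
  qed
qed

lemma minkowski_comb_mono:
  assumes "\<And>l. A l \<subseteq> B l"
  shows "minkowski_comb t A \<subseteq> minkowski_comb t B"
  unfolding minkowski_comb_def using assms by blast


lemma continuous_on_mixed_discriminant:
  assumes "\<And>l. continuous_on X (\<lambda>x. M l x)"
  shows "continuous_on X (\<lambda>x. mixed_discriminant (\<lambda>l. M l x))"
  unfolding mixed_discriminant_def by (intro continuous_intros assms)

text \<open>The bodies are rounded by balls of radius \<open>1/k\<close>, after \<open>A l1\<close> has been replaced by a smooth body
  that is \<open>1/k\<close>-close to it.\<close>

lemma mixed_volume_origin:
  fixes A :: "'n::finite \<Rightarrow> (real^'n) set"
  assumes A: "\<And>l. compact (A l)" "\<And>l. convex (A l)" "\<And>l. 0 \<in> A l"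
    and C: "\<And>l. l \<noteq> l1 \<Longrightarrow> C2_data (support_fun (A l)) (G l) (J l)"
  obtains c :: "('n \<Rightarrow> 'n) \<Rightarrow> real" where
    "\<And>t. (\<And>l. 0 \<le> t l) \<Longrightarrow> measure lborel (minkowski_comb t A) = mform c t"
    and "(\<Sum>f | bij f. c f) = fact (CARD('n)) * (LINT u|sphere_measure. support_fun (A l1) u *
      mixed_discriminant (\<lambda>l. if l = l1 then mat 1 else J l u))"
proof -
  have ne: "A l \<noteq> {}" for l using A(3) by auto
  let ?h = "\<lambda>l. support_fun (A l)"
  define s where "s k = 1 / real (Suc k)" for k
  have s: "0 < s k" "s k \<le> 1" for k by (auto simp: s_def)
  have s0: "s \<longlonglongrightarrow> 0" unfolding s_def[abs_def] by (intro LIMSEQ_Suc[OF lim_1_over_n])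
  have h0: "0 \<le> ?h l x" for l x using inner_le_support_fun[OF A(1,3), of x l] by simp
  have "\<exists>g G J. sublinear g \<and> C2_data g G J \<and> (\<forall>x. ?h l1 x \<le> g x) \<and> (\<forall>x. g x \<le> ?h l1 x + s k * norm x)" for k
    by (rule smooth_outer_approximation[OF A(1,3) s(1)[of k], of l1]) blast
  then obtain g1 G1 J1 where g1: "\<And>k. sublinear (g1 k)" "\<And>k. C2_data (g1 k) (G1 k) (J1 k)"
    "\<And>k x. ?h l1 x \<le> g1 k x" "\<And>k x. g1 k x \<le> ?h l1 x + s k * norm x" by metis
  \<comment> \<open>Both the smooth replacement and the added ball enlarge the bodies, as
    \<open>measure_body_of_outer_limit\<close> requires. Each costs at most
    \<open>s k * norm x\<close>, hence the factor 2 in \<open>hk_le\<close>.\<close>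
  define hk where "hk k l = (\<lambda>x. (if l = l1 then g1 k else ?h l) x + s k * norm x)" for k l
  define Gk where "Gk k l = (\<lambda>x. (if l = l1 then G1 k else G l) x + s k *\<^sub>R sgn x)" for k l
  define Jk where "Jk k l = (\<lambda>x. (if l = l1 then J1 k else J l) x + s k *\<^sub>R norm_hess x)" for k l
  have R: "rounded (s k) (hk k l) (Gk k l) (Jk k l)" for k l
  proof -
    have "0 \<le> g1 k x" for x using g1(3)[of x k] h0[of l1 x] by linarith
    then have "rounded 0 (if l = l1 then g1 k else ?h l) (if l = l1 then G1 k else G l) (if l = l1 then J1 k else J l)"
      using rounded_0[OF g1(1,2)] rounded_0[OF sublinear_support_fun[OF A(1) ne] C h0] by simp
    from rounded_add[OF this rounded_cmult[OF rounded_norm less_imp_le[OF s(1)[of k]]]]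
    show ?thesis by (simp add: hk_def Gk_def Jk_def)
  qed
  define Ak where "Ak k l = body_of (hk k l)" for k l
  have hk_ge: "?h l x \<le> hk k l x" and hk_le: "hk k l x \<le> ?h l x + 2 * s k * norm x" for k l x
  proof -
    have "0 \<le> s k * norm x" using s(1)[of k] by simp
    moreover have "?h l x \<le> (if l = l1 then g1 k else ?h l) x"
      using g1(3)[of x k] by simp
    moreover have "(if l = l1 then g1 k else ?h l) x \<le> ?h l x + s k * norm x"
      using g1(4)[of k x] \<open>0 \<le> s k * norm x\<close> by simp
    ultimately show "?h l x \<le> hk k l x" "hk k l x \<le> ?h l x + 2 * s k * norm x"
      unfolding hk_def by linarith+
  qed
  have S: "sublinear (hk k l)" and Ck: "C2_data (hk k l) (Gk k l) (Jk k l)" for k l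
    using R[of k l] by (auto simp: rounded_def)
  have Ak: "compact (Ak k l)" "Ak k l \<noteq> {}" "convex (Ak k l)" "support_fun (Ak k l) = hk k l" for k l
    unfolding Ak_def
    by (simp_all add: compact_body_of body_of_nonempty[OF S Ck] convex_body_of support_fun_body_of[OF S Ck])
  have sub: "A l \<subseteq> Ak k l" for k l
  proof
    fix y assume "y \<in> A l"
    then have "x \<bullet> y \<le> hk k l x" for x
      by (intro order_trans[OF inner_le_support_fun[OF A(1)] hk_ge])
    then show "y \<in> Ak k l" by (simp add: Ak_def body_of_def)
  qed
  \<comment> \<open>\<open>J1 k\<close> is absent: slot \<open>l1\<close> holds the identity, so the
    second derivatives of the approximants of \<open>A l1\<close>, over which there is no control,
    do not enter the limit.\<close>
  let ?m = "\<lambda>r u. mixed_discriminant (\<lambda>l. if l = l1 then mat 1 else J l u + r *\<^sub>R norm_hess u)"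
  have "\<exists>c :: ('n \<Rightarrow> 'n) \<Rightarrow> real. (\<forall>t. (\<forall>l. 0 \<le> t l) \<longrightarrow> measure lborel (minkowski_comb t (Ak k)) = mform c t) \<and>
    (\<Sum>f | bij f. c f) = fact (CARD('n)) * (LINT u|sphere_measure. hk k l1 u * ?m (s k) u)" for k
  proof -
    have "(\<lambda>l. if l = l1 then mat 1 else Jk k l u) = (\<lambda>l. if l = l1 then mat 1 else J l u + s k *\<^sub>R norm_hess u)" for u
      by (auto simp: Jk_def)
    then have eqm: "(LINT u|sphere_measure. hk k l1 u * mixed_discriminant (\<lambda>l. if l = l1 then mat 1 else Jk k l u)) =
        (LINT u|sphere_measure. hk k l1 u * ?m (s k) u)" by (simp only:)
    obtain c :: "('n \<Rightarrow> 'n) \<Rightarrow> real" where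
      "\<And>t. (\<And>l. 0 \<le> t l) \<Longrightarrow> measure lborel (minkowski_comb t (\<lambda>l. body_of (hk k l))) = mform c t"
      "(\<Sum>f | bij f. c f) = fact (CARD('n)) *
        (LINT u|sphere_measure. hk k l1 u * mixed_discriminant (\<lambda>l. if l = l1 then mat 1 else Jk k l u))"
      by (rule rounded_mixed_volume[where e = "\<lambda>_. s k" and h = "hk k" and G = "Gk k" and J = "Jk k" and ?l1.0 = l1, OF R s(1)])
        blast
    then show ?thesis unfolding eqm Ak_def[abs_def] by blast
  qed
  then obtain c :: "nat \<Rightarrow> ('n \<Rightarrow> 'n) \<Rightarrow> real" where
    c1: "\<And>k t. (\<And>l. 0 \<le> t l) \<Longrightarrow> measure lborel (minkowski_comb t (Ak k)) = mform (c k) t" and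
    c2: "\<And>k. (\<Sum>f | bij f. c k f) = fact (CARD('n)) * (LINT u|sphere_measure. hk k l1 u * ?m (s k) u)"
    by metis
  have lim: "(\<lambda>k. mform (c k) t) \<longlonglongrightarrow> measure lborel (minkowski_comb t A)" if t: "\<And>l. 0 \<le> t l" for t
  proof -
    note mc = compact_minkowski_comb[OF A(1) ne A(2) t] minkowski_comb_nonempty[OF A(1) ne A(2) t]
      convex_minkowski_comb[OF A(1) ne A(2) t]
    have eq: "body_of (support_fun (minkowski_comb t A)) = minkowski_comb t A"
      by (rule body_of_support_fun[OF mc])
    have "(\<lambda>k. measure lborel (minkowski_comb t (Ak k))) \<longlonglongrightarrow> measure lborel (body_of (support_fun (minkowski_comb t A)))"
    proof (rule measure_body_of_outer_limit)
      show "compact (minkowski_comb t (Ak k))" for k by (rule compact_minkowski_comb[OF Ak(1-3) t])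
      show "body_of (support_fun (minkowski_comb t A)) \<subseteq> minkowski_comb t (Ak k)" for k
        unfolding eq by (rule minkowski_comb_mono[OF sub])
      show "(\<lambda>k. (\<Sum>l\<in>UNIV. t l) * (2 * s k)) \<longlonglongrightarrow> 0"
        by (intro tendsto_mult_right_zero s0)
      fix k x y assume y: "y \<in> minkowski_comb t (Ak k)"
      have "x \<bullet> y \<le> support_fun (minkowski_comb t (Ak k)) x"
        by (rule inner_le_support_fun[OF compact_minkowski_comb[OF Ak(1-3) t] y])
      also have "\<dots> = (\<Sum>l\<in>UNIV. t l * hk k l x)"
        unfolding support_fun_minkowski_comb[OF Ak(1-3) t] Ak(4) ..
      also have "\<dots> \<le> (\<Sum>l\<in>UNIV. t l * (?h l x + 2 * s k * norm x))"
        by (intro sum_mono mult_left_mono hk_le t)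
      also have "\<dots> = support_fun (minkowski_comb t A) x + (\<Sum>l\<in>UNIV. t l) * (2 * s k) * norm x"
        unfolding support_fun_minkowski_comb[OF A(1) ne A(2) t]
        by (simp add: distrib_left sum.distrib sum_distrib_right mult.assoc)
      finally show "x \<bullet> y \<le> support_fun (minkowski_comb t A) x + (\<Sum>l\<in>UNIV. t l) * (2 * s k) * norm x" .
    qed
    then show ?thesis unfolding eq c1[OF t] .
  qed
  obtain c0 :: "('n \<Rightarrow> 'n) \<Rightarrow> real" where
    c0: "\<And>t. t \<in> {t. \<forall>l. 0 \<le> t l} \<Longrightarrow> measure lborel (minkowski_comb t A) = mform c0 t"
  proof (rule mform_limit)
    show "(\<lambda>k. mform (c k) t) \<longlonglongrightarrow> measure lborel (minkowski_comb t A)" if "t \<in> {t. \<forall>l. 0 \<le> t l}" for t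
      using that by (intro lim) auto
  qed (rule that, blast)
  have lim2: "(\<lambda>k. \<Sum>f | bij f. c k f) \<longlonglongrightarrow> (\<Sum>f | bij f. c0 f)"
  proof -
    have "(\<lambda>k. mform (c k) (indicator S)) \<longlonglongrightarrow> mform c0 (indicator S)" for S
      using lim[of "indicator S"] c0[of "indicator S"] by simp
    then show ?thesis unfolding polarization[symmetric] by (intro tendsto_intros)
  qed
  have cJ: "continuous_on (-{0}) (J l)" if "l \<noteq> l1" for l using C2_dataD(5)[OF C[OF that]] .
  have ch: "continuous_on (-{0}) (?h l1)" by (rule continuous_on_support_fun[OF A(1) ne])
  have lim3: "(\<lambda>k. LINT u|sphere_measure. hk k l1 u * ?m (s k) u) \<longlonglongrightarrow>
      (LINT u|sphere_measure. ?h l1 u * ?m 0 u)"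
  proof -
    \<comment> \<open>Continuity jointly in the rounding radius and the direction gives, by
      compactness, a bound uniform in \<open>k\<close> for dominated convergence.\<close>
    have cm: "continuous_on ({0..1} \<times> (-{0})) (\<lambda>p. ?m (fst p) (snd p))"
    proof (rule continuous_on_mixed_discriminant)
      show "continuous_on ({0..1} \<times> (-{0})) (\<lambda>p. if l = l1 then mat 1 else J l (snd p) + fst p *\<^sub>R norm_hess (snd p))" for l
      proof (cases "l = l1")
        case False
        then show ?thesis
          by (auto intro!: continuous_intros continuous_on_compose2[OF cJ] continuous_on_compose2[OF C2_dataD(5)[OF C2_data_norm]])
      qed simp
    qed
    have "compact ((\<lambda>p. ?m (fst p) (snd p)) ` ({0..1} \<times> sphere 0 1))"
      by (intro compact_continuous_image continuous_on_subset[OF cm] compact_Times) auto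
    then obtain B where B0: "\<forall>y\<in>(\<lambda>p. ?m (fst p) (snd p)) ` ({0..1} \<times> sphere 0 1). norm y \<le> B"
      using compact_imp_bounded bounded_iff by blast
    have B: "\<bar>?m r u\<bar> \<le> B" if "r \<in> {0..1}" "u \<in> sphere 0 1" for r u
      using bspec[OF B0, OF imageI[of "(r, u)"]] that by (simp cong: if_cong)
    have "compact (?h l1 ` sphere 0 1)"
      by (intro compact_continuous_image continuous_on_subset[OF ch]) auto
    then obtain B' where B0': "\<forall>y\<in>?h l1 ` sphere 0 1. norm y \<le> B'"
      using compact_imp_bounded bounded_iff by blast
    have B': "\<bar>?h l1 u\<bar> \<le> B'" if "u \<in> sphere 0 1" for u
      using bspec[OF B0', OF imageI[OF that]] by simp
    have cmk: "continuous_on (-{0}) (?m r)" if r: "r \<in> {0..1}" for r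
    proof -
      have "continuous_on (-{0}) (\<lambda>u. (\<lambda>p. ?m (fst p) (snd p)) (r, u))"
        by (rule continuous_on_compose2[OF cm]) (use r in \<open>auto intro: continuous_intros\<close>)
      then show ?thesis by (simp cong: if_cong)
    qed
    show ?thesis
    proof (rule integral_dominated_convergence)
      show "(\<lambda>u. ?h l1 u * ?m 0 u) \<in> borel_measurable sphere_measure"
        by (intro borel_measurable_integrable integrable_sphere_measure continuous_intros ch cmk) auto
      show "(\<lambda>u. hk k l1 u * ?m (s k) u) \<in> borel_measurable sphere_measure" for k
        by (intro borel_measurable_integrable integrable_sphere_measure continuous_intros C2_dataD(3)[OF Ck] cmk)
           (use s[of k] in auto)
      show "integrable (sphere_measure :: (real^'n) measure) (\<lambda>_. (B' + 2) * B)" by simp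
      show "AE u in sphere_measure. (\<lambda>k. hk k l1 u * ?m (s k) u) \<longlonglongrightarrow> ?h l1 u * ?m 0 u"
      proof (rule AE_I2)
        fix u :: "real^'n" assume "u \<in> space sphere_measure"
        then have u: "norm u = 1" by simp
        have "(\<lambda>k. hk k l1 u) \<longlonglongrightarrow> ?h l1 u"
        proof (rule tendsto_sandwich[where f = "\<lambda>_. ?h l1 u" and h = "\<lambda>k. ?h l1 u + 2 * s k * norm u"])
          have "(\<lambda>k. ?h l1 u + 2 * s k * norm u) \<longlonglongrightarrow> ?h l1 u + 2 * 0 * norm u"
            by (intro tendsto_intros s0)
          then show "(\<lambda>k. ?h l1 u + 2 * s k * norm u) \<longlonglongrightarrow> ?h l1 u" by simp
        qed (simp_all add: hk_ge hk_le)
        moreover have "(\<lambda>k. ?m (s k) u) \<longlonglongrightarrow> ?m 0 u"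
        proof -
          have "(\<lambda>k. if l = l1 then mat 1 else J l u + s k *\<^sub>R norm_hess u) \<longlonglongrightarrow>
              (if l = l1 then mat 1 else J l u + 0 *\<^sub>R norm_hess u)" for l
            by (cases "l = l1") (auto intro!: tendsto_eq_intros s0)
          then show ?thesis unfolding mixed_discriminant_def by (intro tendsto_intros)
        qed
        ultimately show "(\<lambda>k. hk k l1 u * ?m (s k) u) \<longlonglongrightarrow> ?h l1 u * ?m 0 u"
          by (rule tendsto_mult)
      qed
      show "AE u in sphere_measure. norm (hk k l1 u * ?m (s k) u) \<le> (B' + 2) * B" for k
      proof (rule AE_I2)
        fix u :: "real^'n" assume "u \<in> space sphere_measure"
        then have u: "u \<in> sphere 0 1" by simp
        have "\<bar>hk k l1 u\<bar> \<le> B' + 2"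
          using hk_ge[of l1 u k] hk_le[of k l1 u] h0[of l1 u] B'[OF u] s[of k] u by auto
        moreover have "\<bar>?m (s k) u\<bar> \<le> B" using s[of k] by (intro B u) auto
        ultimately show "norm (hk k l1 u * ?m (s k) u) \<le> (B' + 2) * B"
          by (simp add: abs_mult mult_mono)
      qed
    qed
  qed
  have "(\<lambda>k. \<Sum>f | bij f. c k f) \<longlonglongrightarrow> fact (CARD('n)) * (LINT u|sphere_measure. ?h l1 u * ?m 0 u)"
    unfolding c2 by (intro tendsto_intros lim3)
  then have eq: "(\<Sum>f | bij f. c0 f) = fact (CARD('n)) * (LINT u|sphere_measure. ?h l1 u * ?m 0 u)"
    using LIMSEQ_unique lim2 by blast
  show thesis
    by (rule that[of c0]) (use c0 eq in \<open>simp_all cong: if_cong\<close>)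
qed

section \<open>The general case\<close>

lemma mixed_volume_eq_sphere_integral_origin:
  fixes A :: "'n::finite \<Rightarrow> (real^'n) set"
  assumes "\<And>l. compact (A l)" "\<And>l. convex (A l)" "\<And>l. 0 \<in> A l"
    and "\<And>l. l \<noteq> l1 \<Longrightarrow> C2_data (support_fun (A l)) (G l) (J l)"
  shows "mixed_volume A = (LINT u|sphere_measure. support_fun (A l1) u *
    mixed_discriminant (\<lambda>l. if l = l1 then mat 1 else J l u))"
proof (rule mixed_volume_origin[of A l1 G J, OF assms])
  fix c :: "('n \<Rightarrow> 'n) \<Rightarrow> real"
  assume P: "\<And>t. (\<And>l. 0 \<le> t l) \<Longrightarrow> measure lborel (minkowski_comb t A) = mform c t"
    and c: "(\<Sum>f | bij f. c f) = fact (CARD('n)) * (LINT u|sphere_measure. support_fun (A l1) u *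
      mixed_discriminant (\<lambda>l. if l = l1 then mat 1 else J l u))"
  show ?thesis using mixed_volume_eq[OF P] by (simp add: c)
qed

text \<open>Holds for nonmeasurable sets as well, where \<open>measure\<close> has the value 0 on
  both sides; hence \<open>mixed_volume_translation\<close> can be stated for arbitrary
  sets.\<close>

lemma measure_lborel_translation:
  fixes b :: "'a::euclidean_space"
  shows "measure lborel ((+) b ` X) = measure lborel X"
proof -
  have t: "(+) c ` Y \<in> sets borel" if "Y \<in> sets borel" for c :: 'a and Y
  proof -
    have "(+) c ` Y = (+) (- c) -` Y" by (force simp: image_iff)
    then show ?thesis using measurable_sets[of "(+) (- c)" borel borel Y] that by simp
  qed
  show ?thesis
  proof (cases "X \<in> sets borel")
    case True
    then show ?thesis using t[OF True, of b] measure_translation[of b X] by simp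
  next
    case False
    then have "(+) b ` X \<notin> sets borel" using t[of "(+) b ` X" "- b"] by (auto simp: image_image)
    then show ?thesis using False by (simp add: measure_notin_sets)
  qed
qed

lemma mixed_volume_translation:
  fixes A :: "'n::finite \<Rightarrow> (real^'n) set"
  shows "mixed_volume (\<lambda>l. (+) (a l) ` A l) = mixed_volume A"
proof -
  have "minkowski_comb t (\<lambda>l. (+) (a l) ` A l) = (+) (\<Sum>l\<in>UNIV. t l *\<^sub>R a l) ` minkowski_comb t A" for t
  proof (intro equalityI subsetI)
    fix y assume "y \<in> minkowski_comb t (\<lambda>l. (+) (a l) ` A l)"
    then obtain x where x: "y = (\<Sum>l\<in>UNIV. t l *\<^sub>R x l)" "\<And>l. x l \<in> (+) (a l) ` A l"
      by (auto simp: minkowski_comb_def)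
    have "\<exists>z. z \<in> A l \<and> x l = a l + z" for l using x(2)[of l] by auto
    then obtain z where z: "\<And>l. z l \<in> A l" "\<And>l. x l = a l + z l" by metis
    have "y = (\<Sum>l\<in>UNIV. t l *\<^sub>R a l) + (\<Sum>l\<in>UNIV. t l *\<^sub>R z l)"
      by (simp add: x(1) z(2) scaleR_add_right sum.distrib)
    moreover have "(\<Sum>l\<in>UNIV. t l *\<^sub>R z l) \<in> minkowski_comb t A" using z(1) by (auto simp: minkowski_comb_def)
    ultimately show "y \<in> (+) (\<Sum>l\<in>UNIV. t l *\<^sub>R a l) ` minkowski_comb t A" by blast
  next
    fix y assume "y \<in> (+) (\<Sum>l\<in>UNIV. t l *\<^sub>R a l) ` minkowski_comb t A"
    then obtain z where z: "y = (\<Sum>l\<in>UNIV. t l *\<^sub>R a l) + (\<Sum>l\<in>UNIV. t l *\<^sub>R z l)" "\<And>l. z l \<in> A l"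
      by (auto simp: minkowski_comb_def)
    then have "y = (\<Sum>l\<in>UNIV. t l *\<^sub>R (a l + z l))" by (simp add: scaleR_add_right sum.distrib)
    then show "y \<in> minkowski_comb t (\<lambda>l. (+) (a l) ` A l)"
      unfolding minkowski_comb_def using z(2) by (auto intro!: exI[of _ "\<lambda>l. a l + z l"])
  qed
  then show ?thesis unfolding mixed_volume_def by (simp only: measure_lborel_translation)
qed

lemma support_fun_translation:
  assumes A: "compact A" "A \<noteq> {}"
  shows "support_fun ((+) a ` A) x = a \<bullet> x + support_fun A x"
proof -
  obtain v where v: "v \<in> A" "support_fun A x = x \<bullet> v" using support_fun_attained[OF A] by metis
  show ?thesis
  proof (rule support_fun_unique)
    show "compact ((+) a ` A)" by (rule compact_translation[OF A(1)])
    show "a + v \<in> (+) a ` A" using v by blast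
    show "x \<bullet> (a + v) = a \<bullet> x + support_fun A x" using v by (simp add: inner_add_right inner_commute)
  qed (use A inner_le_support_fun[OF A(1), of _ x] in \<open>auto simp: inner_add_right inner_commute\<close>)
qed

lemma support_fun_cball: "support_fun (cball 0 1) = (norm :: 'a::euclidean_space \<Rightarrow> real)"
proof
  fix x :: 'a
  show "support_fun (cball 0 1) x = norm x"
  proof (rule support_fun_unique)
    show "sgn x \<in> cball 0 1" by (simp add: norm_sgn)
    show "x \<bullet> sgn x = norm x"
      by (cases "x = 0") (simp_all add: sgn_div_norm power2_norm_eq_inner[symmetric] power2_eq_square)
    show "x \<bullet> v \<le> norm x" if "v \<in> cball 0 1" for v
      using norm_cauchy_schwarz[of x v] mult_left_le[of "norm v" "norm x"] that by simp
  qed auto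
qed

text \<open>For bodies not containing the origin, the linear part of \<open>h\<close> contributes \<open>0\<close>. To see
  this, apply the previous case to the unit ball and to a small translate of it.\<close>

lemma mixed_volume_eq_sphere_integral:
  fixes A :: "'n::finite \<Rightarrow> (real^'n) set"
  assumes A: "\<And>l. compact (A l)" "\<And>l. convex (A l)" "\<And>l. A l \<noteq> {}"
    and C: "\<And>l. l \<noteq> l1 \<Longrightarrow> C2_data (support_fun (A l)) (G l) (J l)"
  shows "mixed_volume A = (LINT u|sphere_measure. support_fun (A l1) u *
    mixed_discriminant (\<lambda>l. if l = l1 then mat 1 else J l u))"
proof -
  let ?m = "\<lambda>u. mixed_discriminant (\<lambda>l. if l = l1 then mat 1 else J l u)"
  have cm: "continuous_on (-{0}) ?m"
  proof (rule continuous_on_mixed_discriminant)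
    show "continuous_on (-{0}) (\<lambda>u. if l = l1 then mat 1 else J l u)" for l
      using C2_dataD(5)[OF C, of l] by (cases "l = l1") auto
  qed
  have int: "integrable sphere_measure (\<lambda>u. f u * ?m u)" if "continuous_on (-{0}) f" for f
    by (intro integrable_sphere_measure continuous_intros that cm)
  obtain a where a: "\<And>l. a l \<in> A l" using A(3) by (meson equals0I)
  define A0 where "A0 l = (+) (- a l) ` A l" for l
  have A0: "compact (A0 l)" "convex (A0 l)" "0 \<in> A0 l" for l
    unfolding A0_def
    by (rule compact_translation[OF A(1)], rule convex_translation[OF A(2)], rule image_eqI[OF _ a]) simp
  have h0: "support_fun (A0 l) x = - (a l \<bullet> x) + support_fun (A l) x" for l x
    using support_fun_translation[OF A(1,3), of "- a l" l x] by (simp add: A0_def)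
  have C0: "C2_data (support_fun (A0 l)) (\<lambda>x. - a l + G l x) (J l)" if "l \<noteq> l1" for l
  proof -
    have "C2_data (\<lambda>x. - (a l \<bullet> x)) (\<lambda>x. - a l) (\<lambda>x. 0)"
      by (auto simp: C2_data_def intro!: derivative_eq_intros)
    from C2_data_add[OF this C[OF that]]
    have "C2_data (\<lambda>x. - (a l \<bullet> x) + support_fun (A l) x) (\<lambda>x. - a l + G l x) (J l)" by simp
    then show ?thesis by (rule C2_data_cong) (rule h0)
  qed
  have lin: "(LINT u|sphere_measure. (b \<bullet> u) * ?m u) = 0" if b: "norm b \<le> 1" for b :: "real^'n"
  proof -
    \<comment> \<open>Slot \<open>l1\<close> now holds the unit ball translated by \<open>c\<close>;
      norm at most 1 keeps the origin in it. The other bodies contain the origin after translations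
      that do not affect \<open>J\<close>, so the discriminant is still \<open>?m\<close>.\<close>
    define B where "B c l = (if l = l1 then (+) c ` cball 0 1 else A0 l)" for c l
    have B: "mixed_volume (B c) = (LINT u|sphere_measure. (c \<bullet> u + norm u) * ?m u)" if c: "norm c \<le> 1" for c
    proof -
      have "support_fun (B c l1) u = c \<bullet> u + norm u" for u
        using support_fun_translation[of "cball 0 1" c u] by (simp add: B_def support_fun_cball)
      moreover have "mixed_volume (B c) = (LINT u|sphere_measure. support_fun (B c l1) u * ?m u)"
      proof (rule mixed_volume_eq_sphere_integral_origin)
        show "0 \<in> B c l" for l using A0(3) c by (auto simp: B_def image_iff intro!: bexI[of _ "- c"])
        show "C2_data (support_fun (B c l)) (\<lambda>x. - a l + G l x) (J l)" if "l \<noteq> l1" for l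
          using C0[OF that] that by (simp add: B_def)
      qed (use A0 in \<open>auto simp: B_def compact_translation convex_translation\<close>)
      ultimately show ?thesis by simp
    qed
    have "B b = (\<lambda>l. (+) (if l = l1 then b else 0) ` B 0 l)" by (auto simp: B_def fun_eq_iff)
    then have "mixed_volume (B b) = mixed_volume (B 0)" by (simp only: mixed_volume_translation)
    then have "(LINT u|sphere_measure. (b \<bullet> u + norm u) * ?m u) = (LINT u|sphere_measure. norm u * ?m u)"
      using B[OF b] B[of 0] by simp
    moreover have "(LINT u|sphere_measure. (b \<bullet> u + norm u) * ?m u) =
        (LINT u|sphere_measure. (b \<bullet> u) * ?m u) + (LINT u|sphere_measure. norm u * ?m u)"
      unfolding distrib_right
      by (rule Bochner_Integration.integral_add) (intro int continuous_intros)+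
    ultimately show ?thesis by simp
  qed
  have lin': "(LINT u|sphere_measure. (b \<bullet> u) * ?m u) = 0" for b :: "real^'n"
  proof (cases "b = 0")
    case False
    have "(LINT u|sphere_measure. (b \<bullet> u) * ?m u) = (LINT u|sphere_measure. norm b * ((sgn b \<bullet> u) * ?m u))"
      using False by (simp add: sgn_div_norm mult.assoc[symmetric])
    also have "\<dots> = norm b * (LINT u|sphere_measure. (sgn b \<bullet> u) * ?m u)" by simp
    also have "(LINT u|sphere_measure. (sgn b \<bullet> u) * ?m u) = 0" by (rule lin) (simp add: norm_sgn)
    finally show ?thesis by simp
  qed simp
  have "mixed_volume A = mixed_volume A0"
    unfolding A0_def[abs_def] by (rule mixed_volume_translation[symmetric])
  also have "\<dots> = (LINT u|sphere_measure. support_fun (A0 l1) u * ?m u)"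
    by (rule mixed_volume_eq_sphere_integral_origin[OF A0 C0])
  also have "\<dots> = (LINT u|sphere_measure. support_fun (A l1) u * ?m u - (a l1 \<bullet> u) * ?m u)"
    by (simp add: h0 algebra_simps)
  also have "\<dots> = (LINT u|sphere_measure. support_fun (A l1) u * ?m u) - (LINT u|sphere_measure. (a l1 \<bullet> u) * ?m u)"
    by (rule Bochner_Integration.integral_diff) (intro int continuous_intros continuous_on_support_fun A)+
  finally show ?thesis by (simp add: lin')
qed

section \<open>From iterated partial derivatives to gradient and Jacobian\<close>

lemma partial_eq:
  assumes "(f has_derivative f') (at x)"
  shows "partial i f x = f' (axis i 1)"
proof -
  have "((\<lambda>t. f (x + t *\<^sub>R axis i 1)) has_field_derivative f' (axis i 1)) (at 0)"
    using directional_derivative[OF assms, of "axis i 1"] by (simp add: has_field_derivative_iff)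
  then show ?thesis unfolding partial_def by (rule DERIV_imp_deriv)
qed

lemma has_derivative_partial:
  assumes "f differentiable_on -{0}" "x \<noteq> 0"
  shows "(f has_derivative (\<lambda>y. (\<chi> i. partial i f x) \<bullet> y)) (at x)"
proof -
  have "f differentiable at x within -{0}" using assms by (simp add: differentiable_on_def)
  then have "f differentiable at x" using assms(2) by (subst (asm) at_within_open) auto
  then obtain f' where f': "(f has_derivative f') (at x)" by (auto simp: differentiable_def)
  have l: "linear f'" using has_derivative_linear[OF f'] .
  have "f' y = (\<chi> i. partial i f x) \<bullet> y" for y
  proof -
    have "f' y = f' (\<Sum>i\<in>UNIV. y $ i *s axis i 1)" by (simp only: basis_expansion)
    also have "\<dots> = (\<Sum>i\<in>UNIV. f' (y $ i *\<^sub>R axis i 1))"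
      using l by (simp add: linear_sum scalar_mult_eq_scaleR)
    also have "\<dots> = (\<Sum>i\<in>UNIV. y $ i * f' (axis i 1))" using l by (simp add: linear_scale)
    finally show ?thesis by (simp add: inner_vec_def partial_eq[OF f'] mult.commute)
  qed
  then have "f' = (\<lambda>y. (\<chi> i. partial i f x) \<bullet> y)" by (rule ext)
  then show ?thesis using f' by simp
qed

text \<open>The derivative of the gradient is the transpose of \<open>hessian\<close>, whose entry \<open>(j, k)\<close> is
  \<open>\<partial>\<^sub>j \<partial>\<^sub>k f\<close>.\<close>

lemma C2_data_hessian:
  assumes "Ck_on 2 f (-{0})"
  shows "C2_data f (\<lambda>x. \<chi> i. partial i f x) (\<lambda>x. transpose (hessian f x))"
proof -
  have f: "f differentiable_on -{0}" "\<And>i. partial i f differentiable_on -{0}"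
    "\<And>i j. continuous_on (-{0}) (partial j (partial i f))"
    using assms by (auto simp: numeral_2_eq_2)
  have "((\<lambda>x. \<chi> i. partial i f x) has_derivative (\<lambda>y. transpose (hessian f x) *v y)) (at x)"
    if x: "x \<noteq> 0" for x
  proof -
    have "((\<lambda>x. \<chi> i. partial i f x) has_derivative (\<lambda>y. \<chi> i. (\<chi> j. partial j (partial i f) x) \<bullet> y)) (at x)"
    proof (rule has_derivative_componentwise_within[THEN iffD2], rule ballI)
      fix b :: "real^'a" assume "b \<in> Basis"
      then obtain i where "b = axis i 1" by (auto simp: Basis_vec_def)
      then show "((\<lambda>x. (\<chi> i. partial i f x) \<bullet> b) has_derivative
          (\<lambda>y. (\<chi> i. (\<chi> j. partial j (partial i f) x) \<bullet> y) \<bullet> b)) (at x)"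
        using has_derivative_partial[OF f(2) x, of i] by (simp add: inner_axis)
    qed
    moreover have "(\<chi> i. (\<chi> j. partial j (partial i f) x) \<bullet> y) = transpose (hessian f x) *v y" for y
      by (simp add: vec_eq_iff inner_vec_def matrix_vector_mult_def transpose_def hessian_def)
    ultimately show ?thesis by simp
  qed
  moreover have "continuous_on (-{0}) (\<lambda>x. transpose (hessian f x))"
    unfolding transpose_def hessian_def vec_lambda_beta by (intro continuous_on_vec_lambda f(3))
  ultimately show ?thesis
    using has_derivative_partial[OF f(1)] by (simp add: C2_data_def)
qed

lemma mixed_discriminant_scaleR:
  fixes M :: "'n::finite \<Rightarrow> real^'n^'n"
  shows "mixed_discriminant (\<lambda>l. c l *\<^sub>R M l) = (\<Prod>l\<in>UNIV. c l) * mixed_discriminant M"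
  by (simp add: mixed_discriminant_def prod.distrib sum_distrib_left mult.left_commute)

theorem lemma9p8:
  fixes A :: "'n::finite \<Rightarrow> (real^'n) set" and l1 :: 'n
  assumes "A l1 \<in> convex_bodies_C 1"
    and "\<And>l. l \<noteq> l1 \<Longrightarrow> A l \<in> convex_bodies_C 2"
  shows "mixed_volume A =
    1 / measure lborel (cball (0 :: real^'n) 1) *
    (LINT u | (sphere_measure :: (complex^'n) measure).
       support_fun (A l1) (Re_vec u) *
       mixed_discriminant (\<lambda>l. if l = l1 then mat 1 else hessian (support_fun (A l)) (Re_vec u)))"
proof -
  have A: "compact (A l)" "convex (A l)" "A l \<noteq> {}" for l
    using assms by (cases "l = l1"; auto simp: convex_bodies_C_def)+
  let ?h = "\<lambda>l. support_fun (A l)"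
  define J where "J l x = transpose (hessian (?h l) x)" for l x
  have C: "C2_data (?h l) (\<lambda>x. \<chi> i. partial i (?h l) x) (J l)" if "l \<noteq> l1" for l
    unfolding J_def[abs_def] using assms(2)[OF that] by (intro C2_data_hessian) (simp add: convex_bodies_C_def)
  note S = sublinear_support_fun[OF A(1,3)]
  let ?m = "\<lambda>x. mixed_discriminant (\<lambda>l. if l = l1 then mat 1 else J l x)"
  define F where "F x = ?h l1 x * ?m x" for x
  have m: "mixed_discriminant (\<lambda>l. if l = l1 then mat 1 else hessian (?h l) x) = ?m x" for x
  proof -
    have "(\<lambda>l. if l = l1 then mat 1 else J l x) = (\<lambda>l. transpose (if l = l1 then mat 1 else hessian (?h l) x))"
      by (auto simp: J_def)
    then show ?thesis by (simp only: mixed_discriminant_transpose)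
  qed
  have "continuous_on (-{0}) ?m"
  proof (rule continuous_on_mixed_discriminant)
    show "continuous_on (-{0}) (\<lambda>u. if l = l1 then mat 1 else J l u)" for l
      using C2_dataD(5)[OF C, of l] by (cases "l = l1") auto
  qed
  then have cF: "continuous_on (-{0}) F"
    unfolding F_def by (intro continuous_intros continuous_on_support_fun A)
  \<comment> \<open>Degree 2 - n in division-free form: 1 from the support function and -1 from each
    of the n - 1 Hessians. At x = 0 both sides vanish since a support function is 0 there, whatever
    value the Hessians take.\<close>
  have hom: "r ^ CARD('n) * F (r *\<^sub>R x) = r\<^sup>2 * F x" if r: "0 < r" for r x
  proof (cases "x = 0")
    case True
    then show ?thesis using sublinearD(3)[OF S] by (simp add: F_def)
  next
    case False
    have "(\<lambda>l. if l = l1 then mat 1 else J l (r *\<^sub>R x)) =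
        (\<lambda>l. (if l = l1 then 1 else 1 / r) *\<^sub>R (if l = l1 then mat 1 else J l x))"
      using hessian_scaleR[OF S C r False] by (auto simp: fun_eq_iff)
    then have "?m (r *\<^sub>R x) = (\<Prod>l\<in>UNIV. if l = l1 then 1 else 1 / r) * ?m x"
      by (simp only: mixed_discriminant_scaleR)
    moreover have "r ^ CARD('n) * (\<Prod>l\<in>UNIV. if l = l1 then 1 else 1 / r) = r"
    proof -
      have "(\<Prod>l\<in>UNIV. if l = l1 then 1 else 1 / r) = (\<Prod>l\<in>UNIV - {l1}. 1 / r)"
        by (subst prod.remove[of _ l1]) (auto intro!: prod.cong)
      also have "\<dots> = (1 / r) ^ (CARD('n) - 1)" by simp
      moreover have "r ^ CARD('n) = r * r ^ (CARD('n) - 1)" by (simp add: power_eq_if)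
      ultimately show ?thesis using r by (simp add: power_divide)
    qed
    moreover have "?h l1 (r *\<^sub>R x) = r * ?h l1 x" using sublinearD(2)[OF S] r by simp
    ultimately have "r ^ CARD('n) * F (r *\<^sub>R x) =
        (r ^ CARD('n) * (\<Prod>l\<in>UNIV. if l = l1 then 1 else 1 / r)) * (r * F x)"
      by (simp add: F_def)
    then show ?thesis
      using \<open>r ^ CARD('n) * (\<Prod>l\<in>UNIV. if l = l1 then 1 else 1 / r) = r\<close> by (simp add: power2_eq_square)
  qed
  have "mixed_volume A = (LINT u|sphere_measure. F u)"
    unfolding F_def by (rule mixed_volume_eq_sphere_integral[OF A C])
  moreover have "(LINT u|(sphere_measure :: (complex^'n) measure). F (Re_vec u)) =
      measure lborel (cball (0::real^'n) 1) * (LINT u|sphere_measure. F u)"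
    by (rule integral_sphere_Re_vec[OF cF hom])
  moreover have "0 < measure lborel (cball (0::real^'n) 1)"
    using content_cball_pos[of 1 "0::real^'n"] by simp
  ultimately show ?thesis by (simp add: F_def m)
qed

end
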